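(* Let $T>0$, $I=[0,T]$, let $\mathcal{H}$ be a separable Hilbert space, and for every $(t,x)\in I\times\mathcal{H}$ let $A(t,x):D(A(t,x))\subset\mathcal{H}\rightrightarrows\mathcal{H}$ be a maximal monotone operator. Assume: (1) There exist a function $\rho:I\to[0,+\infty[$, right-continuous on $[0,T[$ and nondecreasing, with $\rho(0)=0$ and $\rho(T)<+\infty$, and a nonnegative constant $\gamma$ such that $$\mathrm{dis}(A(t,x),A(s,y))\le d\rho(]s,t])+\gamma\|x-y\|\,\frac{d\lambda}{d\nu}(s)\quad\text{for all } 0\le s\le t\le T,\ x,y\in\mathcal{H},$$ where $\nu:=\lambda+d\rho$. (2) There exists a nonnegative real constant $c$ such that $\|A^0(t,x)y\|\le c(1+\|x\|+\|y\|)$ for all $t\in I$, $x\in\mathcal{H}$, $y\in D(A(t,x))$. (3) For any bounded subset $E$ of $\mathcal{H}$, the set $D(A(I\times E))=\bigcup_{(t,x)\in I\times E}D(A(t,x))$ is relatively ball-compact. Let $f:I\times\mathcal{H}\times\mathcal{H}\to\mathcal{H}$ be such that: (4) $t\mapsto f(t,\cdot,\cdot)$ is $\mathcal{B}(I)$-measurable, i.e. $t\mapsto f(t,x,y)$ is Borel measurable on $I$ for every $(x,y)\in\mathcal{H}\times\mathcal{H}$. (5) There is a nonnegative function $k\in L^1(I,\mathbb{R};\lambda)$ such that $\|f(t,x,y)-f(t,x',y')\|\le k(t)(\|x-x'\|+\|y-y'\|)$ for all $t\in I$ and all $(x,y),(x',y')\in\mathcal{H}\times\mathcal{H}$. (6)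 There exists a nonnegative real constant $m$ such that $\|f(t,x,y)\|\le m(1+\|x\|+\|y\|)$ for all $(t,x,y)\in I\times\mathcal{H}\times\mathcal{H}$. Then for any $u_0\in\mathcal{H}$ and $v_0\in D(A(0,u_0))$, there exists a BVRC solution $(u,v):I\to\mathcal{H}\times\mathcal{H}$ of the problem $$\begin{cases} u(0)=u_0,\ v(0)=v_0\in D(A(0,u_0));\\ v(t)\in D(A(t,u(t)))\quad\forall t\in I;\\ \dfrac{du}{d\nu}(t)=v(t)\quad d\nu\text{-a.e. } t\in I;\\ -\dfrac{dv}{d\nu}(t)\in A(t,u(t))v(t)+f(t,u(t),v(t))\dfrac{d\lambda}{d\nu}(t)\quad d\nu\text{-a.e. } t\in I. \end{cases}$$
   Context: A set-valued operator $A:\mathcal{H}\rightrightarrows\mathcal{H}$ has domain $D(A)=\{x: A(x)\neq\emptyset\}$ and graph $Gr(A)=\{(x,y): y\in A(x)\}$. It is monotone if $\langle y_1-y_2,x_1-x_2\rangle\ge0$ for all $(x_i,y_i)\in Gr(A)$, $i=1,2$, and maximal monotone if moreover its graph is not strictly contained in the graph of another monotone operator. For $A$ maximal monotone and $x\in D(A)$, $A(x)$ is nonempty, closed and convex, and $A^0(x)$ denotes the projection of the origin on $A(x)$ (its element of minimal norm). $A(t,x)y$ denotes the value of the operator $A(t,x)$ at $y$, and $A^0(t,x)y$ the minimal norm element of $A(t,x)y$. For two maximal monotone operators $A,B$ of $\mathcal{H}$, Vladimirov's pseudo-distance is $$\mathrm{dis}(A,B)=\sup\Big\{\frac{\langle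 y-y',x'-x\rangle}{1+\|y\|+\|y'\|}:(x,y)\in Gr(A),\ (x',y')\in Gr(B)\Big\}.$$ $\lambda$ is the Lebesgue measure on $I$, $d\rho$ is the Stieltjes measure associated with $\rho$, so $d\rho(]s,t])=\rho(t)-\rho(s)$ for $s\le t$, and $\frac{d\lambda}{d\nu}$ is the density of $\lambda$ with respect to $\nu=\lambda+d\rho$, taken as a fixed representative with values in $[0,1]$ (one has $\frac{d\lambda}{d\nu}(t)=0$ whenever $\nu(\{t\})>0$). $\mathcal{B}(I)$ is the Borel $\sigma$-algebra of $I$. A subset of $\mathcal{H}$ is relatively ball-compact if its intersection with any closed ball of $\mathcal{H}$ is relatively compact. BVRC means right-continuous with bounded variation on $I$. For a BVRC map $u:I\to\mathcal{H}$, $du$ is its differential measure, i.e. the $\mathcal{H}$-valued measure with $u(t)=u(s)+\int_{]s,t]}du$ for $s\le t$ in $I$. $\frac{du}{d\nu}$ denotes the density of $du$ with respect to $\nu$, so that $u(t)=u(0)+\int_{]0,t]}\frac{du}{d\nu}\,d\nu$ for all $t\in I$. A BVRC solution is a pair $(u,v)$ of BVRC maps whose differential measures have densities with respect to $\nu$ and which satisfies all lines of the problem. *)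

theory Defs
  imports "HOL-Analysis.Analysis"
begin

section \<open>Set-valued operators\<close>

definition op_dom :: "('a \<Rightarrow> 'b set) \<Rightarrow> 'a set" where
  "op_dom A = {x. A x \<noteq> {}}"

definition op_graph :: "('a \<Rightarrow> 'b set) \<Rightarrow> ('a \<times> 'b) set" where
  "op_graph A = {(x, y). y \<in> A x}"

definition monotone_operator :: "('a::real_inner \<Rightarrow> 'a set) \<Rightarrow> bool" where
  "monotone_operator A \<longleftrightarrow>
     (\<forall>x\<^sub>1 y\<^sub>1 x\<^sub>2 y\<^sub>2. (x\<^sub>1, y\<^sub>1) \<in> op_graph A \<longrightarrow> (x\<^sub>2, y\<^sub>2) \<in> op_graph A \<longrightarrow>
        (y\<^sub>1 - y\<^sub>2) \<bullet> (x\<^sub>1 - x\<^sub>2) \<ge> 0)"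

definition maximal_monotone :: "('a::real_inner \<Rightarrow> 'a set) \<Rightarrow> bool" where
  "maximal_monotone A \<longleftrightarrow>
     monotone_operator A \<and> \<not> (\<exists>B. monotone_operator B \<and> op_graph A \<subset> op_graph B)"

definition min_section :: "('a::real_normed_vector \<Rightarrow> 'a set) \<Rightarrow> 'a \<Rightarrow> 'a" where
  "min_section A x = arg_min_on norm (A x)"

text \<open>Vladimirov's pseudo-distance; the supremum may be infinite, hence the extended reals.\<close>

definition vladimirov_dis :: "('a::real_inner \<Rightarrow> 'a set) \<Rightarrow> ('a \<Rightarrow> 'a set) \<Rightarrow> ereal" where
  "vladimirov_dis A B =
     Sup {ereal (((y - y') \<bullet> (x' - x)) / (1 + norm y + norm y')) | x y x' y'.
            (x, y) \<in> op_graph A \<and> (x', y') \<in> op_graph B}"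

definition relatively_ball_compact :: "'a::metric_space set \<Rightarrow> bool" where
  "relatively_ball_compact S \<longleftrightarrow> (\<forall>a r. compact (closure (S \<inter> cball a r)))"


section \<open>Measures on the interval\<close>

text \<open>All measures below live on the space \<open>{0..T}\<close> with its Borel sets.\<close>

definition lebesgue_I :: "real \<Rightarrow> real measure" where
  "lebesgue_I T = restrict_space lborel {0..T}"

text \<open>
  The function is extended by constants outside \<open>{0..T}\<close>. Hence \<open>{0}\<close> has mass \<open>0\<close>, and a
  jump of \<open>\<rho>\<close> at \<open>T\<close> (where right-continuity is void) is an atom of mass \<open>\<rho> T - \<rho> (T-)\<close>.
\<close>

definition stieltjes_I :: "real \<Rightarrow> (real \<Rightarrow> real) \<Rightarrow> real measure" where
  "stieltjes_I T \<rho> =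
     restrict_space (interval_measure (\<lambda>t. \<rho> (max 0 (min t T)))) {0..T}"

definition nu_I :: "real \<Rightarrow> (real \<Rightarrow> real) \<Rightarrow> real measure" where
  "nu_I T \<rho> = measure_of {0..T} (sets (restrict_space borel {0..T}))
     (\<lambda>B. emeasure (lebesgue_I T) B + emeasure (stieltjes_I T \<rho>) B)"

lemma sets_lebesgue_I: "sets (lebesgue_I T) = sets (restrict_space borel {0..T})"
  by (simp add: lebesgue_I_def sets_restrict_space)

lemma sets_stieltjes_I: "sets (stieltjes_I T \<rho>) = sets (restrict_space borel {0..T})"
  by (simp add: stieltjes_I_def sets_restrict_space)

lemma space_nu_I: "space (nu_I T \<rho>) = {0..T}"
  unfolding nu_I_def
  by (rule space_measure_of) (auto simp: sets_restrict_space)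

lemma sets_nu_I: "sets (nu_I T \<rho>) = sets (restrict_space borel {0..T})"
proof -
  have "sigma_sets {0..T} (sets (restrict_space borel {0..T})) = sets (restrict_space borel {0..T})"
    using sets.sigma_sets_eq[of "restrict_space borel {0..T}"] by (simp add: space_restrict_space)
  moreover have "sets (restrict_space borel {0..T}) \<subseteq> Pow {0..T}"
    by (auto simp: sets_restrict_space)
  ultimately show ?thesis
    unfolding nu_I_def by (simp add: sets_measure_of)
qed

lemma emeasure_nu_I:
  assumes "B \<in> sets (restrict_space borel {0..T})"
  shows "emeasure (nu_I T \<rho>) B = emeasure (lebesgue_I T) B + emeasure (stieltjes_I T \<rho>) B"
proof (rule emeasure_measure_of[OF nu_I_def])
  show "sets (restrict_space borel {0..T}) \<subseteq> Pow {0..T}"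
    by (auto simp: sets_restrict_space)
  show "B \<in> sets (nu_I T \<rho>)"
    using assms by (simp add: sets_nu_I)
  show "positive (sets (nu_I T \<rho>))
     (\<lambda>B. emeasure (lebesgue_I T) B + emeasure (stieltjes_I T \<rho>) B)"
    by (simp add: positive_def)
  show "countably_additive (sets (nu_I T \<rho>))
     (\<lambda>B. emeasure (lebesgue_I T) B + emeasure (stieltjes_I T \<rho>) B)"
    by (auto simp: countably_additive_def suminf_add[symmetric] suminf_emeasure
        sets_nu_I sets_lebesgue_I sets_stieltjes_I)
qed

lemma emeasure_stieltjes_I_Ioc:
  assumes mono: "mono_on {0..T} \<rho>"
    and rc: "\<And>t. t \<in> {0..<T} \<Longrightarrow> continuous (at_right t) \<rho>"
    and st: "0 \<le> s" "s \<le> t" "t \<le> T"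
  shows "emeasure (stieltjes_I T \<rho>) {s<..t} = ennreal (\<rho> t - \<rho> s)"
proof -
  let ?F = "\<lambda>t. \<rho> (max 0 (min t T))"
  have m: "?F x \<le> ?F y" if "x \<le> y" for x y
    using that st by (intro mono_onD[OF mono]) auto
  have c: "continuous (at_right a) ?F" for a
  proof -
    consider "a < 0" | "a \<ge> 0" "a < T" | "a \<ge> T" by linarith
    then show ?thesis
    proof cases
      case 1
      have "eventually (\<lambda>x. ?F x = ?F a) (at_right a)"
        using eventually_at_right_real[OF 1] by eventually_elim (use 1 st in auto)
      then show ?thesis
        unfolding continuous_within by (rule tendsto_eventually)
    next
      case 2
      have "eventually (\<lambda>x. \<rho> x = ?F x) (at_right a)"
        using eventually_at_right_real[OF 2(2)] by eventually_elim (use 2 st in auto)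
      moreover have "(\<rho> \<longlongrightarrow> ?F a) (at_right a)"
        using rc[of a] 2 by (auto simp: continuous_within)
      ultimately show ?thesis
        unfolding continuous_within by (rule Lim_transform_eventually[rotated])
    next
      case 3
      have "eventually (\<lambda>x. ?F x = ?F a) (at_right a)"
        using eventually_at_right_less[of a] by eventually_elim (use 3 st in auto)
      then show ?thesis
        unfolding continuous_within by (rule tendsto_eventually)
    qed
  qed
  have "emeasure (stieltjes_I T \<rho>) {s<..t} = emeasure (interval_measure ?F) {s<..t}"
    unfolding stieltjes_I_def by (rule emeasure_restrict_space) (use st in auto)
  also have "\<dots> = ennreal (?F t - ?F s)"
    by (rule emeasure_interval_measure_Ioc) (use m c st in auto)
  finally show ?thesis using st by simp
qed

text \<open>
  \<open>\<theta>\<close> is a representative of the density of \<open>\<lambda>\<close> with respect to \<open>\<nu>\<close> with values in \<open>[0,1]\<close>.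
  The pointwise values matter, so the library's \<open>RN_deriv\<close>, an unspecified representative
  with values in the extended reals, is not used.
\<close>

definition lebesgue_density :: "real \<Rightarrow> (real \<Rightarrow> real) \<Rightarrow> (real \<Rightarrow> real) \<Rightarrow> bool" where
  "lebesgue_density T \<rho> \<theta> \<longleftrightarrow>
     \<theta> \<in> borel_measurable (nu_I T \<rho>) \<and>
     (\<forall>t\<in>{0..T}. 0 \<le> \<theta> t \<and> \<theta> t \<le> 1) \<and>
     density (nu_I T \<rho>) (\<lambda>t. ennreal (\<theta> t)) = lebesgue_I T"


section \<open>Maps of bounded variation and their differential measures\<close>

definition bounded_variation_I :: "real \<Rightarrow> (real \<Rightarrow> 'a::real_normed_vector) \<Rightarrow> bool" where
  "bounded_variation_I T u \<longleftrightarrow>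
     (\<exists>V. \<forall>(n::nat) \<tau>. (\<forall>i\<le>n. \<tau> i \<in> {0..T}) \<longrightarrow> (\<forall>i<n. \<tau> i \<le> \<tau> (Suc i)) \<longrightarrow>
        (\<Sum>i<n. norm (u (\<tau> (Suc i)) - u (\<tau> i))) \<le> V)"

definition BVRC :: "real \<Rightarrow> (real \<Rightarrow> 'a::real_normed_vector) \<Rightarrow> bool" where
  "BVRC T u \<longleftrightarrow> bounded_variation_I T u \<and> (\<forall>t\<in>{0..<T}. continuous (at_right t) u)"

text \<open>Only the \<open>\<sigma>\<close>-algebra of \<open>M\<close> is used. Disjoint sequences of empty sets give \<open>m {} = 0\<close>.\<close>

definition vector_measure :: "'b measure \<Rightarrow> ('b set \<Rightarrow> 'a::real_normed_vector) \<Rightarrow> bool" where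
  "vector_measure M m \<longleftrightarrow>
     (\<forall>B. range B \<subseteq> sets M \<longrightarrow> disjoint_family B \<longrightarrow>
        (\<lambda>i::nat. m (B i)) sums m (\<Union>i. B i))"

text \<open>
  The increments determine \<open>du\<close> on \<open>{0<..T}\<close>. The value at \<open>{0}\<close> is \<open>0\<close> as soon as \<open>du\<close> has
  a density with respect to \<open>\<nu>\<close>, because \<open>{0}\<close> is \<open>\<nu>\<close>-null.
\<close>

definition differential_measure ::
    "real \<Rightarrow> (real \<Rightarrow> 'a::real_normed_vector) \<Rightarrow> (real set \<Rightarrow> 'a) \<Rightarrow> bool" where
  "differential_measure T u du \<longleftrightarrow>
     vector_measure (restrict_space borel {0..T}) du \<and>
     (\<forall>s t. 0 \<le> s \<longrightarrow> s \<le> t \<longrightarrow> t \<le> T \<longrightarrow> u t = u s + du {s<..t})"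

definition vector_density ::
    "'b measure \<Rightarrow> ('b set \<Rightarrow> 'a::{banach,second_countable_topology}) \<Rightarrow> ('b \<Rightarrow> 'a) \<Rightarrow> bool" where
  "vector_density M m g \<longleftrightarrow>
     integrable M g \<and> (\<forall>B\<in>sets M. m B = set_lebesgue_integral M B g)"


section \<open>The coupled problem\<close>

definition BVRC_solution ::
    "real \<Rightarrow> (real \<Rightarrow> real) \<Rightarrow> (real \<Rightarrow> real) \<Rightarrow>
     (real \<Rightarrow> 'a \<Rightarrow> 'a \<Rightarrow> 'a set) \<Rightarrow> (real \<Rightarrow> 'a \<Rightarrow> 'a \<Rightarrow> 'a) \<Rightarrow> 'a \<Rightarrow> 'a \<Rightarrow>
     (real \<Rightarrow> 'a::{real_inner,banach,second_countable_topology}) \<Rightarrow> (real \<Rightarrow> 'a) \<Rightarrow> bool" where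
  "BVRC_solution T \<rho> \<theta> A f u\<^sub>0 v\<^sub>0 u v \<longleftrightarrow>
     BVRC T u \<and> BVRC T v \<and>
     (\<exists>du dv u' v'.
        differential_measure T u du \<and> vector_density (nu_I T \<rho>) du u' \<and>
        differential_measure T v dv \<and> vector_density (nu_I T \<rho>) dv v' \<and>
        u 0 = u\<^sub>0 \<and> v 0 = v\<^sub>0 \<and> v\<^sub>0 \<in> op_dom (A 0 u\<^sub>0) \<and>
        (\<forall>t\<in>{0..T}. v t \<in> op_dom (A t (u t))) \<and>
        (AE t in nu_I T \<rho>. u' t = v t) \<and>
        (AE t in nu_I T \<rho>.
           - v' t \<in> {a + \<theta> t *\<^sub>R f t (u t) (v t) | a. a \<in> A t (u t) (v t)}))"

end

theory Submission imports Defs "HOL-Library.Diagonal_Subsequence" begin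

text \<open>
  The idea is an implicit Euler scheme whose estimates live on the clock \<open>\<sigma> t = t + \<rho> t\<close>, for
  which \<open>\<nu> {s<..t} = \<sigma> t - \<sigma> s\<close>. At consecutive nodes \<open>s < t\<close> with \<open>\<delta> = \<sigma> t - \<sigma> s\<close>, the new velocity
  \<open>v'\<close> is the resolvent of \<open>A t (u + \<delta> v)\<close> with step \<open>\<delta>\<close>, applied to \<open>v\<close> minus the integral of the
  perturbation. Testing the pseudo-distance bound with the minimal section at the old velocity shows
  that \<open>|v - v'| / \<delta>\<close> is at most a multiple of \<open>1 + |u| + |v|\<close>, because the two operators are at
  distance at most \<open>\<delta> (1 + \<gamma> |v|)\<close>, which is proportional to \<open>\<delta>\<close> (\<open>implicit_step\<close>). A discrete Gronwall argument
  makes the bounds uniform in the partition (\<open>discrete_trajectory\<close>). Resolvents exist by Minty's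
  theorem (\<open>minty_at_zero\<close>), which is proved by minimising the Fitzpatrick function plus half of the
  squared norm.

  The explicit argument \<open>u + \<delta> v\<close> is harmless. If the new node \<open>t\<close> is not an atom of \<open>\<nu>\<close>, it is the
  value at \<open>t\<close> of the primitive of the step function. If \<open>t\<close> is an atom, then \<open>\<theta> t = 0\<close>, and the
  hypothesis on the pseudo-distance forces \<open>A t x\<close> to be the same operator for all \<open>x\<close>
  (\<open>A_at_atom\<close>). So the discrete position can be taken to be the exact primitive of the discrete
  velocity, jumps included.

  The partitions are nested, their nodes are dense, and every atom of \<open>\<nu>\<close> eventually is a node. The
  velocities take values in a compact set, so a diagonal subsequence converges at every node; the
  \<open>\<sigma>\<close>-Lipschitz bound carries the convergence to every time (\<open>convergent_subsequence\<close>). The limit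
  \<open>v\<close> is \<open>\<sigma>\<close>-Lipschitz, and \<open>u\<close> is defined as its primitive.

  Let \<open>Z\<close>, formally \<open>unforced\<close>, be \<open>v\<close> plus the primitive of the perturbation. Its difference quotients along the nested
  partitions form a martingale that is bounded in \<open>L\<^sup>2\<close>; it converges almost everywhere along a
  subsequence to a density \<open>g\<close> of \<open>Z\<close> (\<open>quotients_converge\<close>). This single argument provides both a
  Radon-Nikodym theorem for Hilbert space valued maps and the differentiation theorem that the
  inclusion needs. Summing the monotonicity inequality over the nodes of a fine partition inside one
  cell of a coarse partition and refining gives, for every \<open>t > 0\<close> and every \<open>y \<in> A t (u t) x\<close>, that the
  quotient \<open>q\<close> of \<open>Z\<close> on the coarse cell satisfies \<open>(q + y) \<bullet> (v t - x) \<le> K (\<nu> {r<..<t} + \<nu> {t<..r'})\<close>,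
  where \<open>r\<close> and \<open>r'\<close> are the ends of the cell (\<open>quotient_inequality\<close>). The right-hand side tends to
  \<open>0\<close> at every \<open>t\<close>, atom or not. Hence \<open>- g t \<in> A t (u t) (v t)\<close> almost everywhere by maximality, and
  the density of \<open>v\<close> is \<open>g\<close> minus the perturbation.
\<close>

section \<open>Maximal monotone operators in a Hilbert space\<close>

text \<open>
    Let \<open>F z\<close> be the supremum of \<open>l \<bullet> z - c\<close> over \<open>(l, c) \<in> K\<close>. The point \<open>z\<^sub>0\<close> minimises
    \<open>F z + |z|\<^sup>2 / 2\<close>, \<open>\<alpha>\<close> is \<open>F z\<^sub>0\<close>, and the second conclusion says that \<open>- z\<^sub>0\<close> is a subgradient of
    \<open>F\<close> at \<open>z\<^sub>0\<close>. Upper bounds \<open>r\<close> are used in place of the supremum because \<open>F\<close> may be infinite. By the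
    parallelogram law a minimising sequence is Cauchy, which replaces weak compactness.
\<close>
lemma proximal_point:
  fixes K :: "('a::{real_inner,banach} \<times> real) set"
  assumes feasible: "\<And>l c. (l, c) \<in> K \<Longrightarrow> l \<bullet> z\<^sub>1 - c \<le> r\<^sub>1"
    and lower: "\<And>z r. (\<And>l c. (l, c) \<in> K \<Longrightarrow> l \<bullet> z - c \<le> r) \<Longrightarrow> b \<le> r + (norm z)\<^sup>2 / 2"
  obtains z\<^sub>0 \<alpha> where "\<And>l c. (l, c) \<in> K \<Longrightarrow> l \<bullet> z\<^sub>0 - c \<le> \<alpha>"
    and "\<And>z r. (\<And>l c. (l, c) \<in> K \<Longrightarrow> l \<bullet> z - c \<le> r) \<Longrightarrow> \<alpha> - z\<^sub>0 \<bullet> (z - z\<^sub>0) \<le> r"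
proof -
  define P where "P z r \<longleftrightarrow> (\<forall>(l, c) \<in> K. l \<bullet> z - c \<le> r)" for z r
  define E where "E = {r + (norm z)\<^sup>2 / 2 | z r. P z r}"
  define \<iota> where "\<iota> = Inf E"
  have "bdd_below E"     using lower by (intro bdd_belowI[of _ b]) (fastforce simp: E_def P_def)
  have "E \<noteq> {}" using feasible by (auto simp: E_def P_def)
  have \<iota>_le: "\<iota> \<le> r + (norm z)\<^sup>2 / 2" if "P z r" for z r
    unfolding \<iota>_def by (rule cInf_lower[OF _ \<open>bdd_below E\<close>]) (use that in \<open>auto simp: E_def\<close>)
  have P_comb: "P ((1 - s) *\<^sub>R z + s *\<^sub>R z') ((1 - s) * r + s * r')"
    if "P z r" "P z' r'" "0 \<le> s" "s \<le> 1" for z z' r r' s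
    unfolding P_def
  proof clarify
    fix l c assume "(l, c) \<in> K"
    then have "l \<bullet> z - c \<le> r" "l \<bullet> z' - c \<le> r'" using that by (auto simp: P_def)
    then have "(1 - s) * (l \<bullet> z - c) + s * (l \<bullet> z' - c) \<le> (1 - s) * r + s * r'"
      using that by (intro add_mono mult_left_mono) auto
    then show "l \<bullet> ((1 - s) *\<^sub>R z + s *\<^sub>R z') - c \<le> (1 - s) * r + s * r'"
      by (simp add: inner_simps algebra_simps)
  qed
  have "\<exists>z r. P z r \<and> r + (norm z)\<^sup>2 / 2 < \<iota> + 1 / real (Suc n)" for n
  proof -
    have "\<exists>e\<in>E. e < \<iota> + 1 / real (Suc n)"
      unfolding \<iota>_def by (rule cInf_lessD[OF \<open>E \<noteq> {}\<close>]) simp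
    then show ?thesis by (auto simp: E_def)
  qed
  then obtain Z R where ZR: "\<And>n. P (Z n) (R n)"
      "\<And>n. R n + (norm (Z n))\<^sup>2 / 2 < \<iota> + 1 / real (Suc n)" by metis
  have close: "(norm (Z i - Z j))\<^sup>2 \<le> 4 * (1 / real (Suc i) + 1 / real (Suc j))" for i j
  proof -
    have "\<iota> \<le> (R i + R j) / 2 + (norm ((1/2) *\<^sub>R Z i + (1/2) *\<^sub>R Z j))\<^sup>2 / 2"
      using \<iota>_le[OF P_comb[OF ZR(1)[of i] ZR(1)[of j], of "1/2"]] by (simp add: add_divide_distrib)
    moreover have "(norm ((1/2) *\<^sub>R Z i + (1/2) *\<^sub>R Z j))\<^sup>2
        = (norm (Z i))\<^sup>2 / 2 + (norm (Z j))\<^sup>2 / 2 - (norm (Z i - Z j))\<^sup>2 / 4"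
      by (simp add: power2_norm_eq_inner inner_simps inner_commute field_simps)
    moreover have "d \<le> 4 * (a + b)" if "\<iota> \<le> (p + q) / 2 + m / 2" "m = x / 2 + y / 2 - d / 4"
        "p + x / 2 < \<iota> + a" "q + y / 2 < \<iota> + b" for a b d m p q x y :: real
      using that by argo
    ultimately show ?thesis using ZR(2)[of i] ZR(2)[of j] by blast
  qed
  have "Cauchy Z"
  proof (rule CauchyI)
    fix e :: real assume "e > 0"
    obtain M where M: "8 / real (Suc M) < e\<^sup>2"
      using reals_Archimedean[of "e\<^sup>2 / 8"] \<open>e > 0\<close> by (auto simp: field_simps)
    have "norm (Z i - Z j) < e" if "i \<ge> M" "j \<ge> M" for i j
    proof -
      have "1 / real (Suc i) \<le> 1 / real (Suc M)" "1 / real (Suc j) \<le> 1 / real (Suc M)"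
        using that by (auto simp: field_simps)
      then have "(norm (Z i - Z j))\<^sup>2 < e\<^sup>2" using close[of i j] M by simp
      then show ?thesis using \<open>e > 0\<close> by (simp add: power_less_imp_less_base)
    qed
    then show "\<exists>M. \<forall>m\<ge>M. \<forall>n\<ge>M. norm (Z m - Z n) < e" by blast
  qed
  then obtain z\<^sub>0 where z0: "Z \<longlonglongrightarrow> z\<^sub>0" by (auto simp: Cauchy_convergent_iff convergent_def)
  define \<alpha> where "\<alpha> = \<iota> - (norm z\<^sub>0)\<^sup>2 / 2"
  have P0: "P z\<^sub>0 \<alpha>" unfolding P_def
  proof clarify
    fix l c assume lc: "(l, c) \<in> K"
    have up: "l \<bullet> Z n - c \<le> \<iota> + 1 / real (Suc n) - (norm (Z n))\<^sup>2 / 2" for n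
      using ZR(1)[of n] ZR(2)[of n] lc unfolding P_def by fastforce
    have "(\<lambda>n. 1 / real (Suc n)) \<longlonglongrightarrow> 0"
      using LIMSEQ_inverse_real_of_nat by (simp add: inverse_eq_divide)
    then have "(\<lambda>n. \<iota> + 1 / real (Suc n) - (norm (Z n))\<^sup>2 / 2) \<longlonglongrightarrow> \<iota> + 0 - (norm z\<^sub>0)\<^sup>2 / 2"
      by (intro tendsto_intros z0) auto
    moreover have "(\<lambda>n. l \<bullet> Z n - c) \<longlonglongrightarrow> l \<bullet> z\<^sub>0 - c" by (intro tendsto_intros z0)
    ultimately show "l \<bullet> z\<^sub>0 - c \<le> \<alpha>"
      using LIMSEQ_le up unfolding \<alpha>_def by fastforce
  qed
  show ?thesis
  proof (rule that[of z\<^sub>0 \<alpha>])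
    show "l \<bullet> z\<^sub>0 - c \<le> \<alpha>" if "(l, c) \<in> K" for l c using P0 that by (auto simp: P_def)
    fix z r assume "\<And>l c. (l, c) \<in> K \<Longrightarrow> l \<bullet> z - c \<le> r"
    then have Pz: "P z r" by (auto simp: P_def)
    define d where "d = r - \<alpha> + z\<^sub>0 \<bullet> (z - z\<^sub>0)"
    \<comment> \<open>Minimality is compared on the segment from \<open>z\<^sub>0\<close> to \<open>z\<close>; then \<open>s\<close> tends to \<open>0\<close>.\<close>
    have main: "0 \<le> d + s * ((norm (z - z\<^sub>0))\<^sup>2 / 2)" if "0 < s" "s \<le> 1" for s
    proof -
      have "\<alpha> + (norm z\<^sub>0)\<^sup>2 / 2 \<le> (1 - s) * \<alpha> + s * r + (norm ((1 - s) *\<^sub>R z\<^sub>0 + s *\<^sub>R z))\<^sup>2 / 2"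
        using \<iota>_le[OF P_comb[OF P0 Pz]] that by (simp add: \<alpha>_def)
      moreover have "(norm ((1 - s) *\<^sub>R z\<^sub>0 + s *\<^sub>R z))\<^sup>2
          = (norm z\<^sub>0)\<^sup>2 + 2 * s * (z\<^sub>0 \<bullet> (z - z\<^sub>0)) + s\<^sup>2 * (norm (z - z\<^sub>0))\<^sup>2"
        by (simp only: power2_norm_eq_inner inner_simps inner_commute[of z z\<^sub>0] scaleR_conv_of_real)
          (simp add: algebra_simps power2_eq_square)
      ultimately have "0 \<le> s * (d + s * ((norm (z - z\<^sub>0))\<^sup>2 / 2))"
        by (simp add: d_def algebra_simps power2_eq_square)
      then show ?thesis using that by (simp add: zero_le_mult_iff)
    qed
    have "((\<lambda>s. d + s * ((norm (z - z\<^sub>0))\<^sup>2 / 2)) \<longlongrightarrow> d + 0 * ((norm (z - z\<^sub>0))\<^sup>2 / 2)) (at_right 0)"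
      by (intro tendsto_intros)
    moreover have "eventually (\<lambda>s. 0 \<le> d + s * ((norm (z - z\<^sub>0))\<^sup>2 / 2)) (at_right 0)"
      using eventually_at_right_real[of 0 "1::real", simplified] by eventually_elim (use main in auto)
    ultimately have "0 \<le> d + 0 * ((norm (z - z\<^sub>0))\<^sup>2 / 2)"
      by (rule tendsto_lowerbound) simp
    then show "\<alpha> - z\<^sub>0 \<bullet> (z - z\<^sub>0) \<le> r" by (simp add: d_def)
  qed
qed

lemma maximal_monotoneD:
  assumes "maximal_monotone A" "y \<in> A x" "y' \<in> A x'"
  shows "(y - y') \<bullet> (x - x') \<ge> 0"
  using assms unfolding maximal_monotone_def monotone_operator_def op_graph_def by auto

lemma maximal_monotone_mem:
  assumes A: "maximal_monotone A" and rel: "\<And>x y. y \<in> A x \<Longrightarrow> (y - b) \<bullet> (x - a) \<ge> 0"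
  shows "b \<in> A a"
proof (rule ccontr)
  assume b: "b \<notin> A a"
  define B where "B x = (if x = a then insert b (A x) else A x)" for x
  have "op_graph A \<subset> op_graph B" using b by (auto simp: op_graph_def B_def)
  moreover have "monotone_operator B"
    unfolding monotone_operator_def op_graph_def
  proof clarsimp
    fix x1 y1 x2 y2 assume "y1 \<in> B x1" "y2 \<in> B x2"
    then have "(y1 \<in> A x1 \<or> x1 = a \<and> y1 = b)" "(y2 \<in> A x2 \<or> x2 = a \<and> y2 = b)"
      by (auto simp: B_def split: if_splits)
    moreover have "(b - y) \<bullet> (a - x) \<ge> 0" if "y \<in> A x" for x y
      using rel[OF that] by (metis inner_minus_left inner_minus_right minus_diff_eq minus_minus)
    ultimately show "0 \<le> (y1 - y2) \<bullet> (x1 - x2)"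
      using rel maximal_monotoneD[OF A] by auto
  qed
  ultimately show False using A by (auto simp: maximal_monotone_def)
qed

lemma maximal_monotone_closed_graph:
  assumes A: "maximal_monotone A" and "X \<longlonglongrightarrow> x" "Y \<longlonglongrightarrow> y" "\<And>n. Y n \<in> A (X n)"
  shows "y \<in> A x"
proof (rule maximal_monotone_mem[OF A])
  fix x' y' assume "y' \<in> A x'"
  then have "(y' - Y n) \<bullet> (x' - X n) \<ge> 0" for n
    using maximal_monotoneD[OF A] assms(4) by blast
  moreover have "(\<lambda>n. (y' - Y n) \<bullet> (x' - X n)) \<longlonglongrightarrow> (y' - y) \<bullet> (x' - x)"
    by (intro tendsto_intros assms)
  ultimately show "(y' - y) \<bullet> (x' - x) \<ge> 0" by (intro LIMSEQ_le_const) auto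
qed

lemma maximal_monotone_nonempty_graph:
  assumes A: "maximal_monotone A"
  obtains a b where "b \<in> A a"
  using maximal_monotone_mem[OF A, of 0 0] by blast

text \<open>
    Minty's theorem at the origin. The family \<open>K\<close> encodes the Fitzpatrick function
    \<open>F (x, y) = Sup {b \<bullet> x + a \<bullet> y - a \<bullet> b | b \<in> A a}\<close>, which lies above the pairing \<open>x \<bullet> y\<close> by maximality and
    agrees with it on the graph. At the minimiser \<open>(x, y)\<close> of \<open>F\<close> plus half of the squared norm, the
    subgradient inequality tested on the graph gives \<open>|x + y|\<^sup>2 \<le> (b + x) \<bullet> (a + y)\<close>. So \<open>(- y, - x)\<close>
    belongs to the graph by maximality, and testing with this point gives \<open>x = - y\<close>.
\<close>
theorem minty_at_zero:
  fixes A :: "'a::{real_inner,banach} \<Rightarrow> 'a set"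
  assumes A: "maximal_monotone A"
  obtains x where "- x \<in> A x"
proof -
  define K where "K = {((b, a), a \<bullet> b) | a b. b \<in> A a}"
  have K: "(l, c) \<in> K \<longleftrightarrow> (\<exists>a b. l = (b, a) \<and> c = a \<bullet> b \<and> b \<in> A a)" for l c
    by (auto simp: K_def)
  obtain a1 b1 where ab1: "b1 \<in> A a1" using maximal_monotone_nonempty_graph[OF A] .
  have graph: "l \<bullet> (a, b) - c \<le> a \<bullet> b" if "b \<in> A a" "(l, c) \<in> K" for l c a b
  proof -
    obtain a' b' where l: "l = (b', a')" "c = a' \<bullet> b'" "b' \<in> A a'" using \<open>(l, c) \<in> K\<close> unfolding K by blast
    show ?thesis using maximal_monotoneD[OF A that(1) l(3)] unfolding l
      by (simp add: inner_simps inner_commute)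
  qed
  have above: "x \<bullet> y \<le> r" if "\<And>l c. (l, c) \<in> K \<Longrightarrow> l \<bullet> (x, y) - c \<le> r" for x y r
  proof (cases "y \<in> A x")
    case True
    then show ?thesis using that[of "(y, x)" "x \<bullet> y"] by (auto simp: K inner_commute)
  next
    case False
    then obtain a b where "b \<in> A a" "(b - y) \<bullet> (a - x) < 0"
      using maximal_monotone_mem[OF A] by (metis not_le)
    then show ?thesis using that[of "(b, a)" "a \<bullet> b"] by (auto simp: K inner_simps inner_commute)
  qed
  obtain z\<^sub>0 \<alpha> where z0: "\<And>l c. (l, c) \<in> K \<Longrightarrow> l \<bullet> z\<^sub>0 - c \<le> \<alpha>"
    and opt: "\<And>z r. (\<And>l c. (l, c) \<in> K \<Longrightarrow> l \<bullet> z - c \<le> r) \<Longrightarrow> \<alpha> - z\<^sub>0 \<bullet> (z - z\<^sub>0) \<le> r"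
  proof (rule proximal_point[of K "(a1, b1)" "a1 \<bullet> b1" 0])
    show "l \<bullet> (a1, b1) - c \<le> a1 \<bullet> b1" if "(l, c) \<in> K" for l c using graph[OF ab1 that] .
    show "0 \<le> r + (norm z)\<^sup>2 / 2" if "\<And>l c. (l, c) \<in> K \<Longrightarrow> l \<bullet> z - c \<le> r" for z r
    proof -
      obtain x y where z: "z = (x, y)" by (cases z)
      have "x \<bullet> y \<le> r" using above that unfolding z by blast
      moreover have "0 \<le> (norm (x + y))\<^sup>2" by simp
      ultimately show ?thesis
        by (simp add: z norm_Pair power2_norm_eq_inner inner_simps inner_commute) argo
    qed
  qed blast
  obtain x y where xy: "z\<^sub>0 = (x, y)" by (cases z\<^sub>0)
  have \<alpha>: "x \<bullet> y \<le> \<alpha>" using above z0 unfolding xy by blast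
  have rel: "(norm (x + y))\<^sup>2 \<le> (b + x) \<bullet> (a + y)" if "b \<in> A a" for a b
  proof -
    have "\<alpha> - (x, y) \<bullet> ((a, b) - (x, y)) \<le> a \<bullet> b"
      using opt[of "(a, b)" "a \<bullet> b"] graph[OF that] xy by auto
    then show ?thesis using \<alpha> by (simp add: power2_norm_eq_inner inner_simps inner_commute)
  qed
  have mem: "- x \<in> A (- y)"
  proof (rule maximal_monotone_mem[OF A])
    fix a b assume "b \<in> A a"
    show "(b - - x) \<bullet> (a - - y) \<ge> 0"
      using order_trans[OF zero_le_power2 rel[OF \<open>b \<in> A a\<close>]] by simp
  qed
  have "(norm (x + y))\<^sup>2 \<le> 0" using rel[OF mem] by simp
  then have "x + y = 0" by simp
  then have "- y = x" by (metis add.commute neg_eq_iff_add_eq_0)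
  then show ?thesis using mem that by simp
qed

text \<open>
    Minty's theorem at the origin is applied to the operator \<open>p \<mapsto> \<delta> A p - z\<close>.
\<close>
lemma resolvent_exists:
  fixes A :: "'a::{real_inner,banach} \<Rightarrow> 'a set"
  assumes A: "maximal_monotone A" and "\<delta> > 0"
  obtains x w where "w \<in> A x" "z = x + \<delta> *\<^sub>R w"
proof -
  define B where "B p = (\<lambda>w. \<delta> *\<^sub>R w - z) ` A p" for p
  have "monotone_operator B" unfolding monotone_operator_def op_graph_def
  proof clarsimp
    fix x1 y1 x2 y2 assume "y1 \<in> B x1" "y2 \<in> B x2"
    then obtain w1 w2 where w: "w1 \<in> A x1" "w2 \<in> A x2" "y1 - y2 = \<delta> *\<^sub>R (w1 - w2)"
      by (auto simp: B_def algebra_simps)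
    show "0 \<le> (y1 - y2) \<bullet> (x1 - x2)"
      using maximal_monotoneD[OF A w(1,2)] \<open>\<delta> > 0\<close> by (simp add: w(3))
  qed
  moreover have "\<not> (\<exists>C. monotone_operator C \<and> op_graph B \<subset> op_graph C)"
  proof (rule notI, elim exE conjE)
    fix C assume C: "monotone_operator C" "op_graph B \<subset> op_graph C"
    then obtain a b where ab: "b \<in> C a" "b \<notin> B a" by (auto simp: op_graph_def)
    have "(1 / \<delta>) *\<^sub>R (b + z) \<in> A a"
    proof (rule maximal_monotone_mem[OF A])
      fix x y assume "y \<in> A x"
      then have "\<delta> *\<^sub>R y - z \<in> C x" using C(2) by (auto simp: op_graph_def B_def)
      then have "0 \<le> (\<delta> *\<^sub>R y - z - b) \<bullet> (x - a)" using C(1) ab(1)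
        by (auto simp: monotone_operator_def op_graph_def)
      also have "\<delta> *\<^sub>R y - z - b = \<delta> *\<^sub>R (y - (1 / \<delta>) *\<^sub>R (b + z))" using \<open>\<delta> > 0\<close>
        by (simp add: algebra_simps)
      finally show "0 \<le> (y - (1 / \<delta>) *\<^sub>R (b + z)) \<bullet> (x - a)"
        using \<open>\<delta> > 0\<close> by (simp add: zero_le_mult_iff)
    qed
    then have "\<delta> *\<^sub>R ((1 / \<delta>) *\<^sub>R (b + z)) - z \<in> B a" unfolding B_def by blast
    then show False using ab(2) \<open>\<delta> > 0\<close> by simp
  qed
  ultimately have "maximal_monotone B" by (simp add: maximal_monotone_def)
  then obtain x where "- x \<in> B x" using minty_at_zero by blast
  then obtain w where "w \<in> A x" "- x = \<delta> *\<^sub>R w - z" by (auto simp: B_def)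
  then show ?thesis using that[of w x] by (simp add: algebra_simps)
qed

text \<open>
    The minimal section is a choice operator, so a minimiser has to exist. \<open>A x\<close> is an intersection of
    half-spaces; the family \<open>K\<close> contains all nonnegative multiples of their constraints, hence its
    supremum is \<open>0\<close> on \<open>A x\<close> and infinite elsewhere, and \<open>z\<^sub>0\<close> is the projection of the origin.
\<close>
lemma min_section_mem:
  fixes A :: "'a::{real_inner,banach} \<Rightarrow> 'a set"
  assumes A: "maximal_monotone A" and x: "x \<in> op_dom A"
  shows "min_section A x \<in> A x"
proof -
  define K where "K = {(s *\<^sub>R (a - x), s * (b \<bullet> (a - x))) | s a b. s \<ge> 0 \<and> b \<in> A a}"
  obtain y\<^sub>1 where y1: "y\<^sub>1 \<in> A x" using x by (auto simp: op_dom_def)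
  have K_le: "l \<bullet> y - c \<le> 0" if "y \<in> A x" "(l, c) \<in> K" for l c y
  proof -
    obtain s a b where l: "l = s *\<^sub>R (a - x)" "c = s * (b \<bullet> (a - x))" "s \<ge> 0" "b \<in> A a"
      using \<open>(l, c) \<in> K\<close> unfolding K_def by blast
    have "0 \<le> s * ((b - y) \<bullet> (a - x))"
      using maximal_monotoneD[OF A l(4) that(1)] l(3) by simp
    then show ?thesis unfolding l by (simp add: inner_simps inner_commute algebra_simps)
  qed
  have zero_K: "(0, 0) \<in> K" using y1 unfolding K_def
    by (intro CollectI exI[of _ 0] exI[of _ x] exI[of _ y\<^sub>1]) auto
  obtain z\<^sub>0 \<alpha> where z0: "\<And>l c. (l, c) \<in> K \<Longrightarrow> l \<bullet> z\<^sub>0 - c \<le> \<alpha>"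
    and opt: "\<And>z r. (\<And>l c. (l, c) \<in> K \<Longrightarrow> l \<bullet> z - c \<le> r) \<Longrightarrow> \<alpha> - z\<^sub>0 \<bullet> (z - z\<^sub>0) \<le> r"
  proof (rule proximal_point[of K y\<^sub>1 0 0])
    show "l \<bullet> y\<^sub>1 - c \<le> 0" if "(l, c) \<in> K" for l c using K_le[OF y1 that] .
    show "0 \<le> r + (norm z)\<^sup>2 / 2" if "\<And>l c. (l, c) \<in> K \<Longrightarrow> l \<bullet> z - c \<le> r" for z r
      using that[OF zero_K] by simp
  qed blast
  have "\<alpha> \<ge> 0" using z0[OF zero_K] by simp
  have mem: "z\<^sub>0 \<in> A x"
  proof (rule maximal_monotone_mem[OF A], rule ccontr)
    fix a b assume "b \<in> A a" "\<not> 0 \<le> (b - z\<^sub>0) \<bullet> (a - x)"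
    define e where "e = (z\<^sub>0 - b) \<bullet> (a - x)"
    have "e > 0" using \<open>\<not> _\<close> by (simp add: e_def inner_simps)
    have "(((\<alpha> + 1) / e) *\<^sub>R (a - x), ((\<alpha> + 1) / e) * (b \<bullet> (a - x))) \<in> K"
      unfolding K_def using \<open>b \<in> A a\<close> \<open>e > 0\<close> \<open>\<alpha> \<ge> 0\<close>
      by (intro CollectI exI[of _ "(\<alpha> + 1) / e"] exI[of _ a] exI[of _ b]) auto
    from z0[OF this] have "((\<alpha> + 1) / e) * ((a - x) \<bullet> z\<^sub>0 - b \<bullet> (a - x)) \<le> \<alpha>"
      by (simp only: inner_scaleR_left right_diff_distrib)
    moreover have "(a - x) \<bullet> z\<^sub>0 - b \<bullet> (a - x) = e"
      by (simp add: e_def inner_commute[of _ "a - x"] flip: inner_diff_right)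
    ultimately show False using \<open>e > 0\<close> by simp
  qed
  have le: "norm z\<^sub>0 \<le> norm z" if "z \<in> A x" for z
  proof -
    have "\<alpha> - z\<^sub>0 \<bullet> (z - z\<^sub>0) \<le> 0" by (rule opt) (use K_le[OF that] in auto)
    then have "(norm z\<^sub>0)\<^sup>2 \<le> z\<^sub>0 \<bullet> z"
      using \<open>\<alpha> \<ge> 0\<close> by (simp add: power2_norm_eq_inner inner_simps)
    also have "\<dots> \<le> norm z\<^sub>0 * norm z" by (rule norm_cauchy_schwarz)
    finally show ?thesis by (cases "z\<^sub>0 = 0") (auto simp: power2_eq_square)
  qed
  have "\<exists>z. is_arg_min norm (\<lambda>z. z \<in> A x) z" using mem le by (auto simp: is_arg_min_linorder)
  then show ?thesis unfolding min_section_def arg_min_on_def arg_min_def is_arg_min_linorder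
    by (rule someI2_ex) auto
qed

text \<open>
    The Yosida approximations \<open>w\<close> of \<open>A\<close> at \<open>v\<close> increase in norm as \<open>\<delta>\<close> decreases, and the squared
    distance of two of them is at most the difference of their squared norms. So they converge as soon
    as they are bounded, and the limit is in \<open>A v\<close> because the graph is closed.
\<close>
lemma mem_op_dom_if_resolvents_bounded:
  fixes A :: "'a::{real_inner,banach} \<Rightarrow> 'a set"
  assumes A: "maximal_monotone A"
    and bound: "\<And>\<delta> x w. \<delta> > 0 \<Longrightarrow> w \<in> A x \<Longrightarrow> v = x + \<delta> *\<^sub>R w \<Longrightarrow> norm w \<le> M"
  shows "v \<in> op_dom A"
proof -
  have "\<exists>x w. w \<in> A x \<and> v = x + (1 / real (Suc n)) *\<^sub>R w" for n
    by (rule resolvent_exists[OF A, of "1 / real (Suc n)" v]) (auto simp del: of_nat_Suc)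
  then obtain X W where XW: "\<And>n. W n \<in> A (X n)" "\<And>n. v = X n + (1 / real (Suc n)) *\<^sub>R W n" by metis
  have W_bound: "norm (W n) \<le> M" for n by (rule bound[OF _ XW]) simp
  have close: "(norm (W i - W j))\<^sup>2 \<le> (norm (W j))\<^sup>2 - (norm (W i))\<^sup>2" if "i < j" for i j
  proof -
    define \<kappa> \<mu> where "\<kappa> = 1 / real (Suc i)" and "\<mu> = 1 / real (Suc j)"
    have lm: "0 < \<mu>" "\<mu> < \<kappa>" using that by (auto simp: \<kappa>_def \<mu>_def field_simps)
    have "X i - X j = \<mu> *\<^sub>R W j - \<kappa> *\<^sub>R W i"
      using XW(2)[of i] XW(2)[of j] unfolding \<kappa>_def \<mu>_def by (metis add_diff_cancel_right' diff_add_eq_diff_diff_swap add_diff_cancel_left' add_diff_eq diff_add_eq)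
    then have "0 \<le> (W i - W j) \<bullet> (\<mu> *\<^sub>R W j - \<kappa> *\<^sub>R W i)"
      using maximal_monotoneD[OF A XW(1)[of i] XW(1)[of j]] by simp
    then have "\<kappa> * (norm (W i - W j))\<^sup>2 \<le> (\<kappa> - \<mu>) * ((W j - W i) \<bullet> W j)"
      by (simp add: power2_norm_eq_inner inner_simps inner_commute algebra_simps)
    moreover have "(\<kappa> - \<mu>) * (norm (W i - W j))\<^sup>2 \<le> \<kappa> * (norm (W i - W j))\<^sup>2"
      using lm by (intro mult_right_mono) auto
    ultimately have "(norm (W i - W j))\<^sup>2 \<le> (W j - W i) \<bullet> W j"
      using lm by (smt (verit) mult_le_cancel_left_pos)
    then show ?thesis by (simp add: power2_norm_eq_inner inner_simps inner_commute)
  qed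
  have "incseq (\<lambda>n. (norm (W n))\<^sup>2)"
  proof (rule incseq_SucI)
    fix n show "(norm (W n))\<^sup>2 \<le> (norm (W (Suc n)))\<^sup>2"
      using close[of n "Suc n"] zero_le_power2[of "norm (W n - W (Suc n))"] by linarith
  qed
  moreover have "(norm (W n))\<^sup>2 \<le> M\<^sup>2" for n using W_bound by (simp add: power_mono)
  ultimately have "convergent (\<lambda>n. (norm (W n))\<^sup>2)" by (metis incseq_convergent convergentI)
  then have C: "Cauchy (\<lambda>n. (norm (W n))\<^sup>2)" by (rule convergent_Cauchy)
  have "Cauchy W"
  proof (rule CauchyI')
    fix e :: real assume e: "e > 0"
    then obtain N where N: "\<And>i j. i \<ge> N \<Longrightarrow> j \<ge> N \<Longrightarrow> norm ((norm (W i))\<^sup>2 - (norm (W j))\<^sup>2) < e\<^sup>2"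
      using CauchyD[OF C, of "e\<^sup>2"] by auto
    have "norm (W i - W j) < e" if "i \<ge> N" "j > i" for i j
    proof -
      have "(norm (W i - W j))\<^sup>2 < e\<^sup>2" using close[OF that(2)] N[of i j] that by auto
      then show ?thesis using e by (simp add: power_less_imp_less_base)
    qed
    then show "\<exists>M. \<forall>m\<ge>M. \<forall>n>m. dist (W m) (W n) < e" unfolding dist_norm by blast
  qed
  then obtain w where w: "W \<longlonglongrightarrow> w" by (auto simp: Cauchy_convergent_iff convergent_def)
  have "(\<lambda>n. 1 / real (Suc n)) \<longlonglongrightarrow> 0"
    using LIMSEQ_inverse_real_of_nat by (simp add: inverse_eq_divide)
  then have "(\<lambda>n. v - (1 / real (Suc n)) *\<^sub>R W n) \<longlonglongrightarrow> v - 0 *\<^sub>R w" by (intro tendsto_intros w)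
  moreover have "v - (1 / real (Suc n)) *\<^sub>R W n = X n" for n using XW(2)[of n] by (metis add_diff_cancel_right')
  ultimately have "X \<longlonglongrightarrow> v" by simp
  then have "w \<in> A v" using maximal_monotone_closed_graph[OF A _ w XW(1)] by blast
  then show ?thesis by (auto simp: op_dom_def)
qed

text \<open>
    The domain survives a limit without weak compactness: testing the asymptotic inequality with the
    resolvent pair of \<open>v\<close> bounds all Yosida approximations at \<open>v\<close> by \<open>M\<close>.
\<close>
lemma mem_op_dom_if_asymptotically_monotone:
  fixes A :: "'a::{real_inner,banach} \<Rightarrow> 'a set"
  assumes A: "maximal_monotone A" and V: "V \<longlonglongrightarrow> v" and W: "\<And>n. norm (W n) \<le> M"
    and rel: "\<And>x y. y \<in> A x \<Longrightarrow> \<exists>e. e \<longlonglongrightarrow> 0 \<and> (\<forall>n. (W n - y) \<bullet> (x - V n) \<le> e n)"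
  shows "v \<in> op_dom A"
proof (rule mem_op_dom_if_resolvents_bounded[OF A])
  fix \<delta> x y assume "\<delta> > 0" "y \<in> A x" and v: "v = x + \<delta> *\<^sub>R y"
  obtain e where e: "e \<longlonglongrightarrow> 0" "\<And>n. (W n - y) \<bullet> (x - V n) \<le> e n" using rel[OF \<open>y \<in> A x\<close>] by blast
  have "\<delta> * (norm y * norm y - M * norm y) \<le> e n + (M + norm y) * norm (V n - v)" for n
  proof -
    have x: "x = v - \<delta> *\<^sub>R y" using v by simp
    have "(W n - y) \<bullet> (x - V n) = \<delta> * (y \<bullet> y) - \<delta> * (W n \<bullet> y) - (W n - y) \<bullet> (V n - v)"
      unfolding x by (simp add: inner_simps inner_commute algebra_simps)
    moreover have "\<delta> * (W n \<bullet> y) \<le> \<delta> * (M * norm y)"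
      using \<open>\<delta> > 0\<close> W[of n]
      by (intro mult_left_mono order_trans[OF norm_cauchy_schwarz] mult_right_mono) auto
    moreover have "(W n - y) \<bullet> (V n - v) \<le> (M + norm y) * norm (V n - v)"
      using W[of n] norm_triangle_ineq4[of "W n" y]
      by (intro order_trans[OF norm_cauchy_schwarz] mult_right_mono) auto
    ultimately show ?thesis using e(2)[of n]
      by (simp add: right_diff_distrib flip: power2_norm_eq_inner) (simp add: power2_eq_square)
  qed
  moreover have "(\<lambda>n. e n + (M + norm y) * norm (V n - v)) \<longlonglongrightarrow> 0 + (M + norm y) * norm (v - v)"
    by (intro tendsto_intros e V)
  ultimately have "\<delta> * (norm y * norm y - M * norm y) \<le> 0"
    by (intro LIMSEQ_le_const) auto
  then have "norm y * (norm y - M) \<le> 0" using \<open>\<delta> > 0\<close> by (simp add: mult_le_0_iff algebra_simps)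
  then show "norm y \<le> M" using W[of 0] norm_ge_zero[of "W 0"] norm_ge_zero[of y] 
    by (smt (verit) mult_pos_pos)
qed

lemma vladimirov_disD:
  assumes "vladimirov_dis A B \<le> ereal d" "y \<in> A x" "y' \<in> B x'"
  shows "(y - y') \<bullet> (x' - x) \<le> d * (1 + norm y + norm y')"
proof -
  have "ereal (((y - y') \<bullet> (x' - x)) / (1 + norm y + norm y')) \<le> vladimirov_dis A B"
    unfolding vladimirov_dis_def by (rule Sup_upper) (use assms in \<open>auto simp: op_graph_def\<close>)
  then have "((y - y') \<bullet> (x' - x)) / (1 + norm y + norm y') \<le> d"
    using assms(1) by (meson ereal_less_eq(3) order_trans)
  moreover have "1 + norm y + norm y' > 0" by (smt (verit) norm_ge_zero)
  ultimately show ?thesis by (simp add: pos_divide_le_eq)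
qed

lemma vladimirov_dis_zero_subset:
  assumes B: "maximal_monotone B" and "vladimirov_dis A B \<le> ereal 0"
  shows "A x \<subseteq> B x"
proof
  fix y assume "y \<in> A x"
  show "y \<in> B x"
  proof (rule maximal_monotone_mem[OF B])
    fix x' y' assume "y' \<in> B x'"
    from vladimirov_disD[OF assms(2) \<open>y \<in> A x\<close> this]
    have "(y - y') \<bullet> (x' - x) \<le> 0" by simp
    then show "0 \<le> (y' - y) \<bullet> (x' - x)" by (simp add: inner_diff_left)
  qed
qed


section \<open>The measure on the time interval\<close>
locale time_measure =
  fixes T :: real and \<rho> :: "real \<Rightarrow> real"
  assumes T_pos: "T > 0"
    and \<rho>_mono: "mono_on {0..T} \<rho>"
    and \<rho>_right_cont: "\<And>t. t \<in> {0..<T} \<Longrightarrow> continuous (at_right t) \<rho>"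
begin

abbreviation \<nu> :: "real measure" where "\<nu> \<equiv> nu_I T \<rho>"

text \<open>
    The distribution function of \<open>\<nu>\<close>; since \<open>{0}\<close> is a null set, its increments determine \<open>\<nu>\<close>.
\<close>
definition \<sigma> :: "real \<Rightarrow> real" where "\<sigma> t = t + \<rho> t"

declare space_nu_I [simp] 

lemma sets_nu [measurable_cong]: "sets \<nu> = sets (restrict_space borel {0..T})"
  by (rule sets_nu_I)

lemma borel_in_sets_nu [intro]: "B \<in> sets borel \<Longrightarrow> B \<subseteq> {0..T} \<Longrightarrow> B \<in> sets \<nu>"
  by (auto simp: sets_nu sets_restrict_space)

lemma borel_measurable_nu: "g \<in> borel_measurable borel \<Longrightarrow> g \<in> borel_measurable \<nu>"
  unfolding measurable_cong_sets[OF sets_nu refl] by (rule measurable_restrict_space1)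

lemma \<sigma>_diff: "s \<in> {0..T} \<Longrightarrow> t \<in> {0..T} \<Longrightarrow> s \<le> t \<Longrightarrow> t - s \<le> \<sigma> t - \<sigma> s"
  "s \<in> {0..T} \<Longrightarrow> t \<in> {0..T} \<Longrightarrow> s \<le> t \<Longrightarrow> \<rho> t - \<rho> s \<le> \<sigma> t - \<sigma> s"
  using \<rho>_mono by (auto simp: \<sigma>_def mono_on_def)

lemma \<sigma>_mono: "s \<in> {0..T} \<Longrightarrow> t \<in> {0..T} \<Longrightarrow> s \<le> t \<Longrightarrow> \<sigma> s \<le> \<sigma> t"
  using \<sigma>_diff(1)[of s t] by auto

lemma \<sigma>_strict_mono: "s \<in> {0..T} \<Longrightarrow> t \<in> {0..T} \<Longrightarrow> s < t \<Longrightarrow> \<sigma> s < \<sigma> t"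
  using \<sigma>_diff(1)[of s t] by auto

lemma measure_stieltjes:
  assumes "0 \<le> s" "s \<le> t" "t \<le> T"
  shows "measure (stieltjes_I T \<rho>) {s<..t} = \<rho> t - \<rho> s"
  using emeasure_stieltjes_I_Ioc[OF \<rho>_mono \<rho>_right_cont assms] assms mono_onD[OF \<rho>_mono, of s t]
  by (simp add: measure_def)

lemma emeasure_stieltjes_zero: "emeasure (stieltjes_I T \<rho>) {0} = 0"
proof -
  let ?F = "\<lambda>t. \<rho> (max 0 (min t T))"
  have mono: "?F x \<le> ?F y" if "x \<le> y" for x y
    using that T_pos by (intro mono_onD[OF \<rho>_mono]) auto
  have rc: "continuous (at_right a) ?F" for a
  proof (cases "a < 0 \<or> a \<ge> T")
    case True
    then have "eventually (\<lambda>x. x \<noteq> a \<longrightarrow> ?F x = ?F a) (at_right a)"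
    proof
      assume "a < 0"
      then show ?thesis using eventually_at_right_real[of a 0]
        by (auto elim!: eventually_mono)
    next
      assume "T \<le> a"
      then show ?thesis using eventually_at_right_less[of a]
        by (auto elim!: eventually_mono)
    qed
    then show ?thesis unfolding continuous_within
      by (intro tendsto_eventually) (auto simp: eventually_at_filter)
  next
    case False
    then have "eventually (\<lambda>x. \<rho> x = ?F x) (at_right a)"
      using eventually_at_right_real[of a T] by (auto elim!: eventually_mono)
    moreover have "(\<rho> \<longlongrightarrow> ?F a) (at_right a)"
      using \<rho>_right_cont[of a] False by (auto simp: continuous_within)
    ultimately show ?thesis
      unfolding continuous_within by (rule Lim_transform_eventually[rotated])
  qed
  have "emeasure (stieltjes_I T \<rho>) {0} = emeasure (interval_measure ?F) {0}"
    unfolding stieltjes_I_def by (rule emeasure_restrict_space) (use T_pos in auto)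
  also have "\<dots> \<le> emeasure (interval_measure ?F) {-1<..0}" by (rule emeasure_mono) auto
  also have "\<dots> = 0" using T_pos by (subst emeasure_interval_measure_Ioc) (auto intro: mono rc)
  finally show ?thesis by simp
qed

lemma emeasure_nu_Ioc:
  assumes "0 \<le> s" "s \<le> t" "t \<le> T"
  shows "emeasure \<nu> {s<..t} = ennreal (\<sigma> t - \<sigma> s)"
proof -
  have "{s<..t} \<in> sets (restrict_space borel {0..T})" using assms
    by (auto simp: sets_restrict_space)
  then have "emeasure \<nu> {s<..t} = emeasure (lebesgue_I T) {s<..t} + emeasure (stieltjes_I T \<rho>) {s<..t}"
    by (rule emeasure_nu_I)
  also have "emeasure (lebesgue_I T) {s<..t} = ennreal (t - s)"
    unfolding lebesgue_I_def using assms by (subst emeasure_restrict_space) auto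
  finally show ?thesis
    using emeasure_stieltjes_I_Ioc[OF \<rho>_mono \<rho>_right_cont assms] assms mono_onD[OF \<rho>_mono, of s t]
    by (simp add: \<sigma>_def flip: ennreal_plus)
qed

lemma emeasure_nu_zero: "emeasure \<nu> {0} = 0"
proof -
  have "{0} \<in> sets (restrict_space borel {0..T})" using T_pos by (auto simp: sets_restrict_space)
  then have "emeasure \<nu> {0} = emeasure (lebesgue_I T) {0} + emeasure (stieltjes_I T \<rho>) {0}"
    by (rule emeasure_nu_I)
  also have "emeasure (lebesgue_I T) {0} = 0"
    unfolding lebesgue_I_def using T_pos by (subst emeasure_restrict_space) auto
  finally show ?thesis by (simp add: emeasure_stieltjes_zero)
qed

sublocale finite_measure \<nu>
proof
  have "emeasure \<nu> (space \<nu>) = emeasure \<nu> ({0} \<union> {0<..T})"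
    using T_pos by (intro arg_cong2[where f = emeasure]) auto
  also have "\<dots> \<le> emeasure \<nu> {0} + emeasure \<nu> {0<..T}"
    using T_pos by (intro emeasure_subadditive) auto
  also have "\<dots> < \<infinity>" using T_pos by (simp add: emeasure_nu_zero emeasure_nu_Ioc)
  finally show "emeasure \<nu> (space \<nu>) \<noteq> \<infinity>" by simp
qed

lemma measure_nu_Ioc:
  "0 \<le> s \<Longrightarrow> s \<le> t \<Longrightarrow> t \<le> T \<Longrightarrow> measure \<nu> {s<..t} = \<sigma> t - \<sigma> s"
  using emeasure_nu_Ioc[of s t] \<sigma>_mono[of s t] by (simp add: measure_def)

lemma AE_nu_pos: "AE t in \<nu>. t \<in> {0<..T}"
  by (rule AE_I[where N = "{0}"]) (use T_pos emeasure_nu_zero in auto)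

lemma measure_nu_Ioo:
  assumes "0 \<le> s" "s < t" "t \<le> T"
  shows "measure \<nu> {s<..<t} = \<sigma> t - \<sigma> s - measure \<nu> {t}"
proof -
  have "measure \<nu> {s<..t} = measure \<nu> ({s<..<t} \<union> {t})"
    using assms by (intro arg_cong2[where f = measure]) auto
  also have "\<dots> = measure \<nu> {s<..<t} + measure \<nu> {t}"
    using assms by (intro finite_measure_Union) auto
  finally show ?thesis using measure_nu_Ioc[of s t] assms by simp
qed

text \<open>
    The left limit of \<open>\<sigma>\<close> at \<open>t\<close> is \<open>\<sigma> t - measure \<nu> {t}\<close>.
\<close>
lemma \<sigma>_left_limit:
  assumes "0 < t" "t \<le> T" "e > 0"
  obtains s where "0 \<le> s" "s < t" "\<And>r. s \<le> r \<Longrightarrow> r < t \<Longrightarrow> \<sigma> t - measure \<nu> {t} - \<sigma> r < e"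
proof -
  define s where "s n = t - t / real (Suc n)" for n
  have s: "0 \<le> s n" "s n < t" for n using assms by (auto simp: s_def field_simps)
  have "(\<lambda>n. measure \<nu> {s n<..<t}) \<longlonglongrightarrow> measure \<nu> (\<Inter>n. {s n<..<t})"
  proof (rule finite_Lim_measure_decseq)
    show "range (\<lambda>n. {s n<..<t}) \<subseteq> sets \<nu>"
      using s assms by (intro image_subsetI borel_in_sets_nu) (auto intro: less_imp_le[OF le_less_trans[OF s(1)]])
    show "decseq (\<lambda>n. {s n<..<t})"
    proof (rule decseq_SucI)
      fix n
      have "s n \<le> s (Suc n)" using assms by (auto simp: s_def intro!: divide_left_mono)
      then show "{s (Suc n)<..<t} \<subseteq> {s n<..<t}" by auto
    qed
  qed
  moreover have "(\<Inter>n. {s n<..<t}) = {}"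
  proof (rule ccontr)
    assume "(\<Inter>n. {s n<..<t}) \<noteq> {}"
    then obtain x where "x \<in> (\<Inter>n. {s n<..<t})" by (meson ex_in_conv)
    then have x: "\<And>n. s n < x" "x < t" by auto
    have "(\<lambda>n. t / real (Suc n)) \<longlonglongrightarrow> 0" using lim_const_over_n[of t] by (rule LIMSEQ_Suc)
    then have "s \<longlonglongrightarrow> t - 0" unfolding s_def by (intro tendsto_intros)
    then have "t \<le> x" using x(1) by (intro LIMSEQ_le_const2[of s]) (auto intro: less_imp_le)
    then show False using x by simp
  qed
  ultimately have "(\<lambda>n. measure \<nu> {s n<..<t}) \<longlonglongrightarrow> 0" by simp
  then have "eventually (\<lambda>n. measure \<nu> {s n<..<t} < e) sequentially"
    using \<open>e > 0\<close> by (rule order_tendstoD)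
  then obtain n where n: "measure \<nu> {s n<..<t} < e" by (auto simp: eventually_sequentially)
  show ?thesis
  proof (rule that[OF s[of n]])
    fix r assume r: "s n \<le> r" "r < t"
    have "\<sigma> (s n) \<le> \<sigma> r" using r s[of n] assms by (intro \<sigma>_mono) auto
    then show "\<sigma> t - measure \<nu> {t} - \<sigma> r < e"
      using n measure_nu_Ioo[OF s[of n]] assms by simp
  qed
qed

lemma \<sigma>_right_limit:
  assumes "0 \<le> t" "t < T" "e > 0"
  obtains s where "t < s" "s \<le> T" "\<And>r. t \<le> r \<Longrightarrow> r \<le> s \<Longrightarrow> \<sigma> r - \<sigma> t < e"
proof -
  have "(\<sigma> \<longlongrightarrow> \<sigma> t) (at_right t)"
    using \<rho>_right_cont[of t] assms unfolding \<sigma>_def continuous_within by (intro tendsto_intros) auto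
  then have "eventually (\<lambda>r. \<sigma> r < \<sigma> t + e) (at_right t)"
    using \<open>e > 0\<close> by (intro order_tendstoD) auto
  then obtain b where b: "b > t" "\<And>r. t < r \<Longrightarrow> r < b \<Longrightarrow> \<sigma> r < \<sigma> t + e"
    unfolding eventually_at_right_field by blast
  define s where "s = min T ((t + b) / 2)"
  have s: "t < s" "s \<le> T" "s < b" using b(1) assms by (auto simp: s_def min_def)
  show ?thesis
    by (rule that[OF s(1,2)]) (use b s \<open>e > 0\<close> in \<open>force simp: le_less\<close>)
qed

lemma integrable_bounded:
  fixes g :: "real \<Rightarrow> 'b::{banach,second_countable_topology}"
  assumes "g \<in> borel_measurable \<nu>" "\<And>t. t \<in> {0..T} \<Longrightarrow> norm (g t) \<le> C"
  shows "integrable \<nu> g"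
  by (rule integrable_const_bound[where B = C]) (use assms in auto)

lemma set_integrable_Ioc:
  fixes g :: "real \<Rightarrow> 'b::{banach,second_countable_topology}"
  assumes "integrable \<nu> g" "0 \<le> s" "t \<le> T"
  shows "set_integrable \<nu> {s<..t} g"
  unfolding set_integrable_def using assms by (intro integrable_mult_indicator) auto

lemma set_integral_Ioc_split:
  fixes g :: "real \<Rightarrow> 'b::{banach,second_countable_topology}"
  assumes "integrable \<nu> g" "0 \<le> r" "r \<le> s" "s \<le> t" "t \<le> T"
  shows "(LINT x:{r<..t}|\<nu>. g x) = (LINT x:{r<..s}|\<nu>. g x) + (LINT x:{s<..t}|\<nu>. g x)"
proof -
  have "{r<..t} = {r<..s} \<union> {s<..t}" using assms by auto
  then show ?thesis using assms by (simp only:) (intro set_integral_Un set_integrable_Ioc, auto)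
qed

lemma set_integral_const_Ioc:
  fixes c :: "'b::{banach,second_countable_topology}"
  assumes "0 \<le> s" "s \<le> t" "t \<le> T"
  shows "(LINT x:{s<..t}|\<nu>. c) = (\<sigma> t - \<sigma> s) *\<^sub>R c"
proof -
  have "{s<..t} \<in> sets \<nu>" using assms by auto
  moreover have "{s<..t} \<inter> {0..T} = {s<..t}" using assms by auto
  ultimately show ?thesis
    unfolding set_lebesgue_integral_def using assms
    by (subst integral_scaleR_left) (auto simp: measure_nu_Ioc emeasure_nu_Ioc)
qed

lemma norm_set_integral_Ioc_le:
  fixes g :: "real \<Rightarrow> 'b::{banach,second_countable_topology}"
  assumes "integrable \<nu> g" "AE x in \<nu>. x \<in> {s<..t} \<longrightarrow> norm (g x) \<le> C" "0 \<le> s" "s \<le> t" "t \<le> T"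
  shows "norm (LINT x:{s<..t}|\<nu>. g x) \<le> C * (\<sigma> t - \<sigma> s)"
proof -
  have "norm (LINT x:{s<..t}|\<nu>. g x) \<le> (LINT x:{s<..t}|\<nu>. norm (g x))"
    using assms by (intro set_integral_norm_bound set_integrable_Ioc)
  also have "\<dots> \<le> (LINT x:{s<..t}|\<nu>. C)"
  proof (rule set_integral_mono_AE)
    show "set_integrable \<nu> {s<..t} (\<lambda>x. norm (g x))" "set_integrable \<nu> {s<..t} (\<lambda>x. C)"
      using assms by (auto intro!: set_integrable_Ioc)
    show "AE x\<in>{s<..t} in \<nu>. norm (g x) \<le> C" using assms(2) by simp
  qed
  finally show ?thesis using assms by (simp add: set_integral_const_Ioc mult.commute)
qed

lemma tendsto_set_integral_Ioc:
  fixes g :: "nat \<Rightarrow> real \<Rightarrow> 'b::{banach,second_countable_topology}"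
  assumes "\<And>n. g n \<in> borel_measurable \<nu>" "h \<in> borel_measurable \<nu>"
    "AE x in \<nu>. (\<lambda>n. g n x) \<longlonglongrightarrow> h x" "\<And>n x. x \<in> {0..T} \<Longrightarrow> norm (g n x) \<le> C"
    "0 \<le> s" "t \<le> T"
  shows "(\<lambda>n. LINT x:{s<..t}|\<nu>. g n x) \<longlonglongrightarrow> (LINT x:{s<..t}|\<nu>. h x)"
  unfolding set_lebesgue_integral_def
proof (rule integral_dominated_convergence[where w = "\<lambda>_. C"])
  have [measurable]: "{s<..t} \<in> sets \<nu>" using assms by auto
  show "(\<lambda>x. indicator {s<..t} x *\<^sub>R h x) \<in> borel_measurable \<nu>"
    "(\<lambda>x. indicator {s<..t} x *\<^sub>R g n x) \<in> borel_measurable \<nu>" for n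
    using assms(1,2) by measurable
  show "AE x in \<nu>. (\<lambda>n. indicator {s<..t} x *\<^sub>R g n x) \<longlonglongrightarrow> indicator {s<..t} x *\<^sub>R h x"
    using assms(3) by eventually_elim (intro tendsto_intros)
  show "AE x in \<nu>. norm (indicator {s<..t} x *\<^sub>R g n x) \<le> C" for n
  proof (rule AE_I2)
    fix x assume "x \<in> space \<nu>"
    then have "norm (g n x) \<le> C" using assms(4) by simp
    then show "norm (indicator {s<..t} x *\<^sub>R g n x) \<le> C"
      using order_trans[OF norm_ge_zero \<open>norm (g n x) \<le> C\<close>] by (auto simp: indicator_def)
  qed
qed auto

text \<open>
    A Lebesgue null singleton has mass \<open>\<theta> t * measure \<nu> {t}\<close> under the density.
\<close>
lemma density_zero_at_atoms:
  assumes \<theta>: "lebesgue_density T \<rho> \<theta>" and t: "t \<in> {0..T}" and atom: "measure \<nu> {t} \<noteq> 0"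
  shows "\<theta> t = 0"
proof -
  have [measurable]: "\<theta> \<in> borel_measurable \<nu>" "{t} \<in> sets \<nu>" and nn: "\<theta> t \<ge> 0"
    using \<theta> t by (auto simp: lebesgue_density_def)
  have "emeasure (lebesgue_I T) {t} = 0"
    unfolding lebesgue_I_def using t by (subst emeasure_restrict_space) auto
  then have "0 = emeasure (density \<nu> (\<lambda>t. ennreal (\<theta> t))) {t}"
    using \<theta> by (simp add: lebesgue_density_def)
  also have "\<dots> = (\<integral>\<^sup>+x. ennreal (\<theta> t) * indicator {t} x \<partial>\<nu>)"
    by (subst emeasure_density) (auto intro!: nn_integral_cong split: split_indicator)
  also have "\<dots> = ennreal (\<theta> t) * emeasure \<nu> {t}" by (simp add: nn_integral_cmult_indicator)
  finally have "\<theta> t = 0 \<or> emeasure \<nu> {t} = 0" using nn by (auto simp: ennreal_eq_0_iff)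
  then show ?thesis using atom by (auto simp: measure_def)
qed

lemma countable_atoms: "countable {t \<in> {0..T}. measure \<nu> {t} \<noteq> 0}"
  by (rule countable_subset[OF _ countable_support]) auto

end


section \<open>Partitions and difference quotients\<close>
locale partition = time_measure +
  fixes N :: nat and \<tau> :: "nat \<Rightarrow> real"
  assumes N_pos: "0 < N" and \<tau>_0: "\<tau> 0 = 0" and \<tau>_N: "\<tau> N = T"
    and \<tau>_less: "\<And>i j. i < j \<Longrightarrow> j \<le> N \<Longrightarrow> \<tau> i < \<tau> j"
begin

lemma \<tau>_le: "i \<le> j \<Longrightarrow> j \<le> N \<Longrightarrow> \<tau> i \<le> \<tau> j"
  using \<tau>_less[of i j] by (cases "i = j") auto

lemma \<tau>_bounds: "i \<le> N \<Longrightarrow> 0 \<le> \<tau> i" "i \<le> N \<Longrightarrow> \<tau> i \<le> T"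
  using \<tau>_le[of 0 i] \<tau>_le[of i N] \<tau>_0 \<tau>_N by auto

lemma \<tau>_mem: "i \<le> N \<Longrightarrow> \<tau> i \<in> {0..T}" using \<tau>_bounds by auto

lemma \<tau>_le_iff: "i \<le> N \<Longrightarrow> j \<le> N \<Longrightarrow> \<tau> i \<le> \<tau> j \<longleftrightarrow> i \<le> j"
  using \<tau>_less[of j i] \<tau>_le[of i j] by (auto simp: not_le[symmetric] dest: leD)

lemma \<tau>_less_iff: "i \<le> N \<Longrightarrow> j \<le> N \<Longrightarrow> \<tau> i < \<tau> j \<longleftrightarrow> i < j"
  using \<tau>_le_iff[of j i] by auto

text \<open>
    Two indices are attached to a time \<open>t\<close>: \<open>floor_index\<close> belongs to the last node \<open>\<le> t\<close>, which suits
    right-continuous step functions, and \<open>cell_index\<close> to the left end of the cell \<open>{\<tau> i<..\<tau> (Suc i)}\<close>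
    that contains \<open>t > 0\<close>, which suits densities. As cardinalities they are total and measurable.
\<close>
definition floor_index :: "real \<Rightarrow> nat" where "floor_index t = card {i \<in> {1..N}. \<tau> i \<le> t}"

definition cell_index :: "real \<Rightarrow> nat" where "cell_index t = card {i \<in> {1..N}. \<tau> i < t}"

lemma floor_index_eq:
  assumes "i \<le> N" "\<tau> i \<le> t" "i < N \<Longrightarrow> t < \<tau> (Suc i)"
  shows "floor_index t = i"
proof -
  have "{j \<in> {1..N}. \<tau> j \<le> t} = {1..i}"
  proof (intro equalityI subsetI)
    fix j assume j: "j \<in> {j \<in> {1..N}. \<tau> j \<le> t}"
    show "j \<in> {1..i}"
    proof (rule ccontr)
      assume "j \<notin> {1..i}"
      then have "Suc i \<le> j" "i < N" using j by auto
      then have "t < \<tau> j" using assms(3) \<tau>_le[of "Suc i" j] j by auto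
      then show False using j by auto
    qed
  next
    fix j assume "j \<in> {1..i}"
    then show "j \<in> {j \<in> {1..N}. \<tau> j \<le> t}" using \<tau>_le[of j i] assms by auto
  qed
  then show ?thesis by (simp add: floor_index_def)
qed

lemma cell_index_eq:
  assumes "i < N" "\<tau> i < t" "t \<le> \<tau> (Suc i)"
  shows "cell_index t = i"
proof -
  have "{j \<in> {1..N}. \<tau> j < t} = {1..i}"
  proof (intro equalityI subsetI)
    fix j assume j: "j \<in> {j \<in> {1..N}. \<tau> j < t}"
    show "j \<in> {1..i}"
    proof (rule ccontr)
      assume "j \<notin> {1..i}"
      then have "Suc i \<le> j" using j by auto
      then have "t \<le> \<tau> j" using assms(3) \<tau>_le[of "Suc i" j] j by auto
      then show False using j by auto
    qed
  next
    fix j assume "j \<in> {1..i}"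
    then show "j \<in> {j \<in> {1..N}. \<tau> j < t}" using \<tau>_le[of j i] assms by auto
  qed
  then show ?thesis by (simp add: cell_index_def)
qed

lemma floor_index_\<tau>: "i \<le> N \<Longrightarrow> floor_index (\<tau> i) = i"
  by (rule floor_index_eq) (use \<tau>_less[of i "Suc i"] in auto)

lemma floor_index_ex:
  assumes "t \<in> {0..T}"
  obtains i where "floor_index t = i" "i \<le> N" "\<tau> i \<le> t" "i < N \<Longrightarrow> t < \<tau> (Suc i)"
proof -
  define i where "i = Max {i. i \<le> N \<and> \<tau> i \<le> t}"
  have fin: "finite {i. i \<le> N \<and> \<tau> i \<le> t}" by simp
  have "0 \<in> {i. i \<le> N \<and> \<tau> i \<le> t}" using assms \<tau>_0 by auto
  then have i: "i \<in> {i. i \<le> N \<and> \<tau> i \<le> t}" unfolding i_def by (intro Max_in[OF fin]) auto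
  have "t < \<tau> (Suc i)" if "i < N"
    using that Max_ge[OF fin, of "Suc i"] unfolding i_def[symmetric] by force
  then show ?thesis using i floor_index_eq[of i t] by (intro that[of i]) auto
qed

lemma cell_index_ex:
  assumes "t \<in> {0<..T}"
  obtains i where "cell_index t = i" "i < N" "\<tau> i < t" "t \<le> \<tau> (Suc i)"
proof -
  define i where "i = Max {i. i < N \<and> \<tau> i < t}"
  have fin: "finite {i. i < N \<and> \<tau> i < t}" by simp
  have "0 \<in> {i. i < N \<and> \<tau> i < t}" using assms \<tau>_0 N_pos by auto
  then have i: "i \<in> {i. i < N \<and> \<tau> i < t}" unfolding i_def by (intro Max_in[OF fin]) auto
  have "t \<le> \<tau> (Suc i)"
  proof (cases "Suc i < N")
    case True
    then show ?thesis using Max_ge[OF fin, of "Suc i"] unfolding i_def[symmetric] by force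
  next
    case False
    then have "Suc i = N" using i by auto
    then show ?thesis using \<tau>_N assms by auto
  qed
  then show ?thesis using i cell_index_eq[of i t] by (intro that[of i]) auto
qed

lemma cell_index_less:
  assumes "t \<in> {0..T}"
  shows "cell_index t < N"
proof (cases "t = 0")
  case True
  then have "{i \<in> {1..N}. \<tau> i < t} = {}" using \<tau>_bounds(1) by (auto simp: not_less)
  then show ?thesis using N_pos by (simp add: cell_index_def del: Collect_empty_eq)
next
  case False
  then show ?thesis using cell_index_ex[of t] assms by fastforce
qed

lemma cell_index_in_cell: "i < N \<Longrightarrow> t \<in> {\<tau> i<..\<tau> (Suc i)} \<Longrightarrow> cell_index t = i"
  by (rule cell_index_eq) auto

lemma index_measurable [measurable]:
  "floor_index \<in> measurable \<nu> (count_space UNIV)" "cell_index \<in> measurable \<nu> (count_space UNIV)"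
proof -
  have id: "id \<in> borel_measurable \<nu>" by (rule borel_measurable_nu) simp
  have "Measurable.pred \<nu> (\<lambda>t. \<tau> i \<le> t)" "Measurable.pred \<nu> (\<lambda>t. \<tau> i < t)" for i
    using measurable_compose[OF id, of "\<lambda>t. \<tau> i \<le> t" "count_space UNIV"]
      measurable_compose[OF id, of "\<lambda>t. \<tau> i < t" "count_space UNIV"] by simp_all
  then show "floor_index \<in> measurable \<nu> (count_space UNIV)" "cell_index \<in> measurable \<nu> (count_space UNIV)"
    unfolding floor_index_def[abs_def] cell_index_def[abs_def]
    by (auto intro!: measurable_card measurable_pred_countable) 
qed

lemma step_measurable:
  fixes X :: "nat \<Rightarrow> 'b::topological_space"
  shows "(\<lambda>t. X (floor_index t)) \<in> borel_measurable \<nu>" "(\<lambda>t. X (cell_index t)) \<in> borel_measurable \<nu>"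
  by (auto intro: measurable_compose[OF index_measurable(1)] measurable_compose[OF index_measurable(2)])

lemma indexed_measurable:
  fixes X :: "nat \<Rightarrow> real \<Rightarrow> 'b::topological_space"
  assumes "\<And>i. X i \<in> borel_measurable \<nu>"
  shows "(\<lambda>t. X (cell_index t) t) \<in> borel_measurable \<nu>"
  by (rule measurable_compose_countable[OF assms index_measurable(2)])

lemma sum_cells:
  fixes g :: "real \<Rightarrow> 'b::{banach,second_countable_topology}"
  assumes "integrable \<nu> g" "i \<le> j" "j \<le> N"
  shows "(LINT x:{\<tau> i<..\<tau> j}|\<nu>. g x) = (\<Sum>l = i..<j. LINT x:{\<tau> l<..\<tau> (Suc l)}|\<nu>. g x)"
  using assms(2,3)
proof (induction j rule: dec_induct)
  case base
  then show ?case by (simp add: set_lebesgue_integral_def)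
next
  case (step j)
  then show ?case
    using set_integral_Ioc_split[OF assms(1), of "\<tau> i" "\<tau> j" "\<tau> (Suc j)"] \<tau>_bounds \<tau>_le[of i j]
      \<tau>_le[of j "Suc j"] by (auto simp: sum.op_ivl_Suc)
qed

lemma set_integral_cell_cong:
  fixes g h :: "real \<Rightarrow> 'b::{banach,second_countable_topology}"
  assumes "\<And>x. x \<in> {\<tau> i<..\<tau> (Suc i)} \<Longrightarrow> g x = h x"
  shows "(LINT x:{\<tau> i<..\<tau> (Suc i)}|\<nu>. g x) = (LINT x:{\<tau> i<..\<tau> (Suc i)}|\<nu>. h x)"
  unfolding set_lebesgue_integral_def
  by (rule Bochner_Integration.integral_cong) (auto simp: assms indicator_def)

definition left_end :: "real \<Rightarrow> real" where "left_end t = \<tau> (cell_index t)"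

definition right_end :: "real \<Rightarrow> real" where "right_end t = \<tau> (Suc (cell_index t))"

definition node_below :: "real \<Rightarrow> real" where "node_below t = \<tau> (floor_index t)"

text \<open>
    The difference quotient with respect to the clock \<open>\<sigma>\<close> on the cell of \<open>t\<close>. When \<open>V\<close> is a primitive,
    it is the conditional expectation of the density given the partition.
\<close>
definition quotient :: "(real \<Rightarrow> 'b::real_vector) \<Rightarrow> real \<Rightarrow> 'b" where
  "quotient V t = (let i = cell_index t in (1 / (\<sigma> (\<tau> (Suc i)) - \<sigma> (\<tau> i))) *\<^sub>R (V (\<tau> (Suc i)) - V (\<tau> i)))"

lemma \<sigma>_cell_pos: "i < N \<Longrightarrow> 0 < \<sigma> (\<tau> (Suc i)) - \<sigma> (\<tau> i)"
  using \<sigma>_strict_mono[of "\<tau> i" "\<tau> (Suc i)"] \<tau>_less[of i "Suc i"] \<tau>_mem by auto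

lemma quotient_bound:
  assumes "\<And>s t. 0 \<le> s \<Longrightarrow> s \<le> t \<Longrightarrow> t \<le> T \<Longrightarrow> norm (V t - V s) \<le> C * (\<sigma> t - \<sigma> s)" "t \<in> {0..T}"
  shows "norm (quotient V t) \<le> C"
proof -
  obtain i where i: "cell_index t = i" "i < N" using cell_index_less[OF assms(2)] by metis
  show ?thesis
    using assms(1)[of "\<tau> i" "\<tau> (Suc i)"] \<sigma>_cell_pos[OF i(2)] \<tau>_bounds \<tau>_le[of i "Suc i"] i
    by (simp add: quotient_def pos_divide_le_eq)
qed

lemma quotient_measurable:
  fixes V :: "real \<Rightarrow> 'b::{real_normed_vector,second_countable_topology}"
  shows "quotient V \<in> borel_measurable \<nu>"
  unfolding quotient_def[abs_def] Let_def by (rule step_measurable(2))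

lemma quotient_integrable:
  fixes V :: "real \<Rightarrow> 'b::{banach,second_countable_topology}"
  assumes "\<And>s t. 0 \<le> s \<Longrightarrow> s \<le> t \<Longrightarrow> t \<le> T \<Longrightarrow> norm (V t - V s) \<le> C * (\<sigma> t - \<sigma> s)"
  shows "integrable \<nu> (quotient V)"
  by (rule integrable_bounded[where C = C, OF quotient_measurable]) (rule quotient_bound[OF assms])

lemma set_integral_quotient_cell:
  fixes V :: "real \<Rightarrow> 'b::{banach,second_countable_topology}"
  assumes "i < N"
  shows "(LINT x:{\<tau> i<..\<tau> (Suc i)}|\<nu>. quotient V x) = V (\<tau> (Suc i)) - V (\<tau> i)"
proof -
  have "(LINT x:{\<tau> i<..\<tau> (Suc i)}|\<nu>. quotient V x)
      = (LINT x:{\<tau> i<..\<tau> (Suc i)}|\<nu>. (1 / (\<sigma> (\<tau> (Suc i)) - \<sigma> (\<tau> i))) *\<^sub>R (V (\<tau> (Suc i)) - V (\<tau> i)))"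
    using assms by (intro set_integral_cell_cong) (simp add: quotient_def cell_index_in_cell)
  then show ?thesis
    using assms \<tau>_bounds \<tau>_le[of i "Suc i"] \<sigma>_cell_pos[of i] by (subst (asm) set_integral_const_Ioc) auto
qed

lemma set_integral_quotient:
  fixes V :: "real \<Rightarrow> 'b::{banach,second_countable_topology}"
  assumes "\<And>s t. 0 \<le> s \<Longrightarrow> s \<le> t \<Longrightarrow> t \<le> T \<Longrightarrow> norm (V t - V s) \<le> C * (\<sigma> t - \<sigma> s)" "i \<le> j" "j \<le> N"
  shows "(LINT x:{\<tau> i<..\<tau> j}|\<nu>. quotient V x) = V (\<tau> j) - V (\<tau> i)"
proof -
  have "(LINT x:{\<tau> i<..\<tau> j}|\<nu>. quotient V x) = (\<Sum>l = i..<j. V (\<tau> (Suc l)) - V (\<tau> l))"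
    using assms by (subst sum_cells[OF quotient_integrable]) (auto intro!: sum.cong set_integral_quotient_cell)
  also have "\<dots> = V (\<tau> j) - V (\<tau> i)" using assms by (intro sum_Suc_diff') auto
  finally show ?thesis .
qed

lemma integral_eq_Ioc:
  fixes g :: "real \<Rightarrow> 'b::{banach,second_countable_topology}"
  assumes g: "integrable \<nu> g"
  shows "integral\<^sup>L \<nu> g = (\<Sum>i<N. LINT x:{\<tau> i<..\<tau> (Suc i)}|\<nu>. g x)"
proof -
  have [measurable]: "{0<..T} \<in> sets \<nu>" using T_pos by auto
  have [measurable]: "g \<in> borel_measurable \<nu>" using g by auto
  have "integral\<^sup>L \<nu> g = (LINT x:{\<tau> 0<..\<tau> N}|\<nu>. g x)"
    unfolding set_lebesgue_integral_def \<tau>_0 \<tau>_N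
  proof (rule integral_cong_AE)
    show "AE x in \<nu>. g x = indicator {0<..T} x *\<^sub>R g x" using AE_nu_pos by eventually_elim simp
  qed measurable
  then show ?thesis using sum_cells[OF g, of 0 N] by (simp add: atLeast0LessThan)
qed

text \<open>
    The orthogonality of martingale increments: on a cell the quotient is a constant \<open>c\<close>, so the integral
    of \<open>q \<bullet> c\<close> depends only on the integral of \<open>q\<close> over the cell, which is the same as for the quotient.
\<close>
lemma integral_inner_quotient:
  fixes V :: "real \<Rightarrow> 'b::{real_inner,banach,second_countable_topology}"
  assumes lip: "\<And>s t. 0 \<le> s \<Longrightarrow> s \<le> t \<Longrightarrow> t \<le> T \<Longrightarrow> norm (V t - V s) \<le> C * (\<sigma> t - \<sigma> s)"
    and q: "integrable \<nu> q" "\<And>t. t \<in> {0..T} \<Longrightarrow> norm (q t) \<le> C"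
    and increments: "\<And>i. i < N \<Longrightarrow> (LINT x:{\<tau> i<..\<tau> (Suc i)}|\<nu>. q x) = V (\<tau> (Suc i)) - V (\<tau> i)"
  shows "integral\<^sup>L \<nu> (\<lambda>x. q x \<bullet> quotient V x) = integral\<^sup>L \<nu> (\<lambda>x. (norm (quotient V x))\<^sup>2)"
proof -
  define c where "c i = (1 / (\<sigma> (\<tau> (Suc i)) - \<sigma> (\<tau> i))) *\<^sub>R (V (\<tau> (Suc i)) - V (\<tau> i))" for i
  have eq: "integral\<^sup>L \<nu> (\<lambda>x. g x \<bullet> quotient V x) = (\<Sum>i<N. (V (\<tau> (Suc i)) - V (\<tau> i)) \<bullet> c i)"
    if g: "integrable \<nu> g" "\<And>t. t \<in> {0..T} \<Longrightarrow> norm (g t) \<le> C"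
     and gi: "\<And>i. i < N \<Longrightarrow> (LINT x:{\<tau> i<..\<tau> (Suc i)}|\<nu>. g x) = V (\<tau> (Suc i)) - V (\<tau> i)" for g
  proof -
    have [measurable]: "g \<in> borel_measurable \<nu>" "quotient V \<in> borel_measurable \<nu>"
      using g quotient_measurable by auto
    have int: "integrable \<nu> (\<lambda>x. g x \<bullet> quotient V x)"
    proof (rule integrable_bounded[where C = "C * C"])
      fix t assume t: "t \<in> {0..T}"
      have "norm (g t \<bullet> quotient V t) \<le> norm (g t) * norm (quotient V t)"
        using Cauchy_Schwarz_ineq2 by auto
      also have "\<dots> \<le> C * C"
        using g(2)[OF t] quotient_bound[OF lip t] by (intro mult_mono) (auto intro: order_trans[OF norm_ge_zero])
      finally show "norm (g t \<bullet> quotient V t) \<le> C * C" .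
    qed measurable
    have "(LINT x:{\<tau> i<..\<tau> (Suc i)}|\<nu>. g x \<bullet> quotient V x) = (V (\<tau> (Suc i)) - V (\<tau> i)) \<bullet> c i"
      if "i < N" for i
    proof -
      have "(LINT x:{\<tau> i<..\<tau> (Suc i)}|\<nu>. g x \<bullet> quotient V x) = (LINT x:{\<tau> i<..\<tau> (Suc i)}|\<nu>. g x \<bullet> c i)"
        by (rule set_integral_cell_cong) (use that in \<open>simp add: quotient_def cell_index_in_cell c_def\<close>)
      also have "\<dots> = (LINT x|\<nu>. (indicator {\<tau> i<..\<tau> (Suc i)} x *\<^sub>R g x) \<bullet> c i)"
        by (simp add: set_lebesgue_integral_def)
      also have "\<dots> = (LINT x|\<nu>. indicator {\<tau> i<..\<tau> (Suc i)} x *\<^sub>R g x) \<bullet> c i"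
        using set_integrable_Ioc[OF g(1), of "\<tau> i" "\<tau> (Suc i)"] \<tau>_bounds that
        by (intro integral_inner_left) (auto simp: set_integrable_def)
      also have "\<dots> = (V (\<tau> (Suc i)) - V (\<tau> i)) \<bullet> c i"
        using gi[OF that] by (simp add: set_lebesgue_integral_def)
      finally show ?thesis .
    qed
    then show ?thesis using integral_eq_Ioc[OF int] by simp
  qed
  have "integral\<^sup>L \<nu> (\<lambda>x. q x \<bullet> quotient V x) = integral\<^sup>L \<nu> (\<lambda>x. quotient V x \<bullet> quotient V x)"
    using eq[OF q increments] eq[OF quotient_integrable[OF lip] quotient_bound[OF lip] set_integral_quotient_cell]
    by simp
  then show ?thesis by (simp add: power2_norm_eq_inner)
qed

end


section \<open>Densities along refining partitions\<close>
lemma (in time_measure) partition_of_finite_set: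
  assumes P: "finite P" "P \<subseteq> {0..T}" "0 \<in> P" "T \<in> P"
  obtains N \<tau> where "partition T \<rho> N \<tau>" "\<tau> ` {..N} = P"
proof -
  define xs where "xs = sorted_list_of_set P"
  define N where "N = length xs - 1"
  have set_xs: "set xs = P" using P by (simp add: xs_def)
  have sorted: "sorted_wrt (<) xs" by (simp add: xs_def)
  have len: "length xs = Suc N" using set_xs P(3) by (cases xs) (auto simp: N_def)
  have nth_less: "xs ! i < xs ! j" if "i < j" "j \<le> N" for i j
    using sorted_wrt_nth_less[OF sorted, of i j] that len by auto
  have image: "(\<lambda>i. xs ! i) ` {..N} = P"
    unfolding set_xs[symmetric] set_conv_nth using len by (auto simp: less_Suc_eq_le image_iff)
  have xs_0: "xs ! 0 = 0"
  proof -
    obtain i where i: "i \<le> N" "xs ! i = 0" using image P(3) by (auto simp: image_iff)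
    have "xs ! 0 \<in> {0..T}" using image P(2) by auto
    then show ?thesis using nth_less[of 0 i] i by (cases "i = 0") auto
  qed
  have xs_N: "xs ! N = T"
  proof -
    obtain i where i: "i \<le> N" "xs ! i = T" using image P(4) by (auto simp: image_iff)
    have "xs ! N \<in> {0..T}" using image P(2) by auto
    then show ?thesis using nth_less[of i N] i by (cases "i = N") auto
  qed
  have "0 < N" using xs_0 xs_N T_pos by (cases N) auto
  then have "partition T \<rho> N (\<lambda>i. xs ! i)"
    by unfold_locales (use xs_0 xs_N nth_less in auto)
  then show ?thesis using that image by blast
qed

text \<open>
    The two limits say that the cell of \<open>t\<close> shrinks to \<open>t\<close> in measure: the part to the left of \<open>t\<close> and
    the part to the right of \<open>t\<close> both lose their mass, while an atom at \<open>t\<close> stays in the cell.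
\<close>
locale refining = time_measure +
  fixes N :: "nat \<Rightarrow> nat" and \<tau> :: "nat \<Rightarrow> nat \<Rightarrow> real"
  assumes part: "\<And>n. partition T \<rho> (N n) (\<tau> n)"
    and nested: "\<And>m n i. m \<le> n \<Longrightarrow> i \<le> N m \<Longrightarrow> \<exists>j\<le>N n. \<tau> n j = \<tau> m i"
    and left_end_lim: "\<And>t. t \<in> {0<..T} \<Longrightarrow>
      (\<lambda>n. \<sigma> (partition.left_end (N n) (\<tau> n) t)) \<longlonglongrightarrow> \<sigma> t - measure \<nu> {t}"
    and right_end_lim: "\<And>t. t \<in> {0<..T} \<Longrightarrow>
      (\<lambda>n. \<sigma> (partition.right_end (N n) (\<tau> n) t)) \<longlonglongrightarrow> \<sigma> t"
    and atoms_are_nodes: "\<And>t. t \<in> {0..T} \<Longrightarrow> measure \<nu> {t} \<noteq> 0 \<Longrightarrow> \<exists>n. \<exists>i\<le>N n. \<tau> n i = t"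

sublocale refining \<subseteq> P: partition T \<rho> "N n" "\<tau> n" for n
  by (rule part)

context refining
begin

lemma left_end: "t \<in> {0<..T} \<Longrightarrow> 0 \<le> P.left_end n t \<and> P.left_end n t < t"
  using P.cell_index_ex[of t n] P.\<tau>_bounds by (metis P.left_end_def less_imp_le)

lemma right_end: "t \<in> {0<..T} \<Longrightarrow> t \<le> P.right_end n t \<and> P.right_end n t \<le> T"
  using P.cell_index_ex[of t n] P.\<tau>_bounds by (metis P.right_end_def Suc_leI)

lemma node_below: "t \<in> {0..T} \<Longrightarrow> 0 \<le> P.node_below n t \<and> P.node_below n t \<le> t"
  using P.floor_index_ex[of t n] P.\<tau>_bounds by (metis P.node_below_def)

lemma node_below_node: "i \<le> N n \<Longrightarrow> P.node_below n (\<tau> n i) = \<tau> n i"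
  by (simp add: P.node_below_def P.floor_index_\<tau>)

lemma node_below_mono:
  assumes "s \<in> {0..T}" "t \<in> {0..T}" "s \<le> t"
  shows "P.floor_index n s \<le> P.floor_index n t" "P.node_below n s \<le> P.node_below n t"
proof -
  show *: "P.floor_index n s \<le> P.floor_index n t"
    unfolding P.floor_index_def using assms by (intro card_mono) auto
  moreover have "P.floor_index n t \<le> N n" using P.floor_index_ex[OF assms(2)] by metis
  ultimately show "P.node_below n s \<le> P.node_below n t"
    unfolding P.node_below_def by (rule P.\<tau>_le)
qed

text \<open>
    This is where atoms have to become nodes: at an atom that never is a node, \<open>\<sigma>\<close> at the last node
    before \<open>t\<close> would only tend to the left limit of \<open>\<sigma>\<close>.
\<close>
lemma node_below_lim:
  assumes t: "t \<in> {0..T}"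
  shows "(\<lambda>n. \<sigma> (P.node_below n t)) \<longlonglongrightarrow> \<sigma> t"
proof (cases "\<exists>m. \<exists>i\<le>N m. \<tau> m i = t")
  case True
  then obtain m i where m: "i \<le> N m" "\<tau> m i = t" by blast
  have "P.node_below n t = t" if "n \<ge> m" for n
    using nested[OF that m(1)] m(2) node_below_node by metis
  then show ?thesis by (intro tendsto_eventually) (auto simp: eventually_sequentially intro!: exI[of _ m])
next
  case False
  then have no_node: "\<tau> n i \<noteq> t" if "i \<le> N n" for n i using that by blast
  have "t \<noteq> 0" "t \<noteq> T" using no_node[of 0] no_node[of "N n" n for n] P.\<tau>_0 P.\<tau>_N by auto
  then have t': "t \<in> {0<..T}" "t < T" using t by auto
  have "P.node_below n t = P.left_end n t" for n
  proof -
    obtain i where i: "P.floor_index n t = i" "i \<le> N n" "\<tau> n i \<le> t" "i < N n \<Longrightarrow> t < \<tau> n (Suc i)"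
      using P.floor_index_ex[OF t] by metis
    have "i < N n" "\<tau> n i < t" using i no_node[OF i(2)] t' P.\<tau>_N[of n] by (cases "i = N n"; auto)+
    then have "P.cell_index n t = i" using i by (intro P.cell_index_eq) auto
    then show ?thesis using i by (simp add: P.node_below_def P.left_end_def)
  qed
  moreover have "measure \<nu> {t} = 0" using atoms_are_nodes[OF t] no_node by blast
  ultimately show ?thesis using left_end_lim[OF t'(1)] by simp
qed

lemma subsequence:
  assumes \<phi>: "strict_mono \<phi>"
  shows "refining T \<rho> (\<lambda>n. N (\<phi> n)) (\<lambda>n. \<tau> (\<phi> n))"
proof unfold_locales
  show "\<exists>j\<le>N (\<phi> n). \<tau> (\<phi> n) j = \<tau> (\<phi> m) i" if "m \<le> n" "i \<le> N (\<phi> m)" for m n i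
    using nested[OF _ that(2)] strict_mono_leD[OF \<phi> that(1)] by blast
  fix t assume t: "t \<in> {0<..T}"
  show "(\<lambda>n. \<sigma> (P.left_end (\<phi> n) t)) \<longlonglongrightarrow> \<sigma> t - measure \<nu> {t}"
    using LIMSEQ_subseq_LIMSEQ[OF left_end_lim[OF t] \<phi>] by (simp add: o_def)
  show "(\<lambda>n. \<sigma> (P.right_end (\<phi> n) t)) \<longlonglongrightarrow> \<sigma> t"
    using LIMSEQ_subseq_LIMSEQ[OF right_end_lim[OF t] \<phi>] by (simp add: o_def)
next
  fix t assume "t \<in> {0..T}" "measure \<nu> {t} \<noteq> 0"
  then obtain n i where "i \<le> N n" "\<tau> n i = t" using atoms_are_nodes by blast
  then show "\<exists>n. \<exists>i\<le>N (\<phi> n). \<tau> (\<phi> n) i = t"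
    using nested[of n "\<phi> n" i] seq_suble[OF \<phi>, of n] by metis
qed

end

text \<open>
    The nodes are the first elements of an enumeration of the rational points, the atoms and both ends.
\<close>
lemma (in time_measure) refining_exists: "\<exists>N \<tau>. refining T \<rho> N \<tau>"
proof -
  define D where "D = {0, T} \<union> ({0..T} \<inter> \<rat>) \<union> {t \<in> {0..T}. measure \<nu> {t} \<noteq> 0}"
  have "countable D" unfolding D_def using countable_atoms countable_rat by auto
  have D: "D \<noteq> {}" "D \<subseteq> {0..T}" using T_pos by (auto simp: D_def)
  define d where "d = from_nat_into D"
  have range_d: "range d = D" unfolding d_def using \<open>countable D\<close> D(1) by (rule range_from_nat_into[rotated])
  define P where "P n = {0, T} \<union> d ` {..n}" for n
  have P: "finite (P n)" "P n \<subseteq> {0..T}" "0 \<in> P n" "T \<in> P n" for n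
    using range_d D T_pos by (auto simp: P_def)
  have P_mono: "P m \<subseteq> P n" if "m \<le> n" for m n using that by (auto simp: P_def)
  have P_ex: "\<exists>n. x \<in> P n" if "x \<in> D" for x using that range_d unfolding P_def by blast
  have "\<exists>N \<tau>. partition T \<rho> N \<tau> \<and> \<tau> ` {..N} = P n" for n
    using partition_of_finite_set[OF P[of n]] by metis
  then obtain N \<tau> where part: "\<And>n. partition T \<rho> (N n) (\<tau> n)" and im: "\<And>n. \<tau> n ` {..N n} = P n"
    by metis
  interpret P: partition T \<rho> "N n" "\<tau> n" for n by (rule part)
  have node: "\<exists>j\<le>N n. \<tau> n j = x" if "x \<in> P n" for x n
    using that im[of n] by (metis atMost_iff imageE)
  have "refining T \<rho> N \<tau>"
  proof unfold_locales
    show "\<exists>j\<le>N n. \<tau> n j = \<tau> m i" if "m \<le> n" "i \<le> N m" for m n i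
      using node P_mono[OF that(1)] im[of m] that(2) by blast
    show "\<exists>n. \<exists>i\<le>N n. \<tau> n i = t" if "t \<in> {0..T}" "measure \<nu> {t} \<noteq> 0" for t
      using P_ex[of t] node[of t] that unfolding D_def by blast
    fix t assume t: "t \<in> {0<..T}"
    have cell: "P.left_end n t < t" "0 \<le> P.left_end n t" "t \<le> P.right_end n t" "P.right_end n t \<le> T" for n
      using P.cell_index_ex[OF t, of n] P.\<tau>_bounds[of _ n]
      by (metis P.left_end_def P.right_end_def Suc_leI less_imp_le)+
    have between: "x \<le> P.left_end n t" if "x \<in> P n" "x < t" for x n
    proof -
      obtain i where i: "P.cell_index n t = i" "i < N n" "\<tau> n i < t" "t \<le> \<tau> n (Suc i)"
        using P.cell_index_ex[OF t] by metis
      obtain j where j: "j \<le> N n" "\<tau> n j = x" using node[OF \<open>x \<in> P n\<close>] by blast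
      have "j < Suc i" using P.\<tau>_less_iff[of j n "Suc i"] i j that by auto
      then show ?thesis using P.\<tau>_le[of j i n] i j by (simp add: P.left_end_def)
    qed
    have between': "P.right_end n t \<le> x" if "x \<in> P n" "t \<le> x" for x n
    proof -
      obtain i where i: "P.cell_index n t = i" "i < N n" "\<tau> n i < t" "t \<le> \<tau> n (Suc i)"
        using P.cell_index_ex[OF t] by metis
      obtain j where j: "j \<le> N n" "\<tau> n j = x" using node[OF \<open>x \<in> P n\<close>] by blast
      have "i < j" using P.\<tau>_less_iff[of i n j] i j that by auto
      then show ?thesis using P.\<tau>_le[of "Suc i" j n] i j by (simp add: P.right_end_def)
    qed
    show "(\<lambda>n. \<sigma> (P.left_end n t)) \<longlonglongrightarrow> \<sigma> t - measure \<nu> {t}"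
    proof (rule LIMSEQ_I)
      fix e :: real assume "e > 0"
      obtain s where s: "0 \<le> s" "s < t" "\<And>r. s \<le> r \<Longrightarrow> r < t \<Longrightarrow> \<sigma> t - measure \<nu> {t} - \<sigma> r < e"
        using \<sigma>_left_limit[of t e] t \<open>e > 0\<close> by auto
      obtain x where x: "x \<in> \<rat>" "s < x" "x < t" using Rats_dense_in_real[OF s(2)] by blast
      then have "x \<in> D" using s t by (auto simp: D_def)
      then obtain m where m: "x \<in> P m" using P_ex by blast
      have "norm (\<sigma> (P.left_end n t) - (\<sigma> t - measure \<nu> {t})) < e" if "n \<ge> m" for n
      proof -
        have "s \<le> P.left_end n t" using between[of x n] P_mono[OF that] m x by auto
        then have "\<sigma> t - measure \<nu> {t} - \<sigma> (P.left_end n t) < e" using s(3) cell by auto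
        moreover have "0 \<le> \<sigma> t - measure \<nu> {t} - \<sigma> (P.left_end n t)"
          using measure_nu_Ioo[of "P.left_end n t" t] cell[of n] t measure_nonneg[of \<nu> "{P.left_end n t<..<t}"]
          by auto
        ultimately show ?thesis by auto
      qed
      then show "\<exists>m. \<forall>n\<ge>m. norm (\<sigma> (P.left_end n t) - (\<sigma> t - measure \<nu> {t})) < e" by blast
    qed
    show "(\<lambda>n. \<sigma> (P.right_end n t)) \<longlonglongrightarrow> \<sigma> t"
    proof (cases "t = T")
      case True
      then have "P.right_end n t = t" for n using cell[of n] by auto
      then show ?thesis by simp
    next
      case False
      show ?thesis
      proof (rule LIMSEQ_I)
        fix e :: real assume "e > 0"
        obtain s where s: "t < s" "s \<le> T" "\<And>r. t \<le> r \<Longrightarrow> r \<le> s \<Longrightarrow> \<sigma> r - \<sigma> t < e"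
          using \<sigma>_right_limit[of t e] t \<open>e > 0\<close> False by auto
        obtain x where x: "x \<in> \<rat>" "t < x" "x < s" using Rats_dense_in_real[OF s(1)] by blast
        then have "x \<in> D" using s t by (auto simp: D_def)
        then obtain m where m: "x \<in> P m" using P_ex by blast
        have "norm (\<sigma> (P.right_end n t) - \<sigma> t) < e" if "n \<ge> m" for n
        proof -
          have "P.right_end n t \<le> s" using between'[of x n] P_mono[OF that] m x by auto
          then have "\<sigma> (P.right_end n t) - \<sigma> t < e" using s(3) cell by auto
          moreover have "\<sigma> t \<le> \<sigma> (P.right_end n t)" using cell[of n] t by (intro \<sigma>_mono) auto
          ultimately show ?thesis by auto
        qed
        then show "\<exists>m. \<forall>n\<ge>m. norm (\<sigma> (P.right_end n t) - \<sigma> t) < e" by blast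
      qed
    qed
  qed
  then show ?thesis by blast
qed

context refining
begin

text \<open>
    A Radon-Nikodym and differentiation theorem. By orthogonality the squared \<open>L\<^sup>2\<close> distance of the
    \<open>n\<close>-th and \<open>m\<close>-th quotients is the difference of their squared \<open>L\<^sup>2\<close> norms, which increase and are
    bounded. A subsequence whose successive distances decay geometrically converges almost everywhere,
    and bounded convergence identifies the integrals of the limit, at the nodes first.
\<close>
lemma quotients_converge:
  fixes V :: "real \<Rightarrow> 'b::{real_inner,banach,second_countable_topology}"
  assumes lip: "\<And>s t. 0 \<le> s \<Longrightarrow> s \<le> t \<Longrightarrow> t \<le> T \<Longrightarrow> norm (V t - V s) \<le> C * (\<sigma> t - \<sigma> s)"
  obtains \<phi> :: "nat \<Rightarrow> nat" and g :: "real \<Rightarrow> 'b" where "strict_mono \<phi>" "g \<in> borel_measurable \<nu>" "\<forall>t. norm (g t) \<le> C"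
    "AE t in \<nu>. (\<lambda>k. P.quotient (\<phi> k) V t) \<longlonglongrightarrow> g t"
    "\<forall>t\<in>{0..T}. V t = V 0 + (LINT x:{0<..t}|\<nu>. g x)"
proof -
  let ?Q = "\<lambda>n. P.quotient n V"
  have "C * (\<sigma> T - \<sigma> 0) \<ge> 0" using lip[of 0 T] T_pos norm_ge_zero order_trans by (metis less_imp_le order_refl)
  then have C: "C \<ge> 0" using \<sigma>_strict_mono[of 0 T] T_pos by (simp add: zero_le_mult_iff)
  have Q_le: "norm (?Q n t) \<le> C" if "t \<in> {0..T}" for n t using P.quotient_bound[OF lip that] .
  have Q_int: "integrable \<nu> (?Q n)" for n using P.quotient_integrable[OF lip] .
  have Q_meas [measurable]: "?Q n \<in> borel_measurable \<nu>" for n by (rule P.quotient_measurable)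
  have Q_node: "(LINT x:{\<tau> m i<..\<tau> m j}|\<nu>. ?Q n x) = V (\<tau> m j) - V (\<tau> m i)"
    if mn: "m \<le> n" and ij: "i \<le> j" "j \<le> N m" for m n i j
  proof -
    obtain i' where i': "i' \<le> N n" "\<tau> n i' = \<tau> m i" using nested[OF mn, of i] ij by auto
    obtain j' where j': "j' \<le> N n" "\<tau> n j' = \<tau> m j" using nested[OF mn, of j] ij by auto
    have "i' \<le> j'" using P.\<tau>_le_iff[OF i'(1) j'(1)] i' j' P.\<tau>_le[OF ij] by auto
    then show ?thesis using P.set_integral_quotient[OF lip, of i' j' n] i' j' by auto
  qed
  define a where "a n = integral\<^sup>L \<nu> (\<lambda>x. (norm (?Q n x))\<^sup>2)" for n
  have sq_int: "integrable \<nu> (\<lambda>x. (norm (?Q n x))\<^sup>2)" for n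
    by (rule integrable_bounded[where C = "C\<^sup>2"]) (auto intro!: power_mono Q_le)
  have inner_int: "integrable \<nu> (\<lambda>x. ?Q n x \<bullet> ?Q m x)" for m n
  proof (rule integrable_bounded[where C = "C * C"])
    fix t assume t: "t \<in> {0..T}"
    have "norm (?Q n t \<bullet> ?Q m t) \<le> norm (?Q n t) * norm (?Q m t)" using Cauchy_Schwarz_ineq2 by auto
    also have "\<dots> \<le> C * C" using Q_le[OF t] C by (intro mult_mono) auto
    finally show "norm (?Q n t \<bullet> ?Q m t) \<le> C * C" .
  qed measurable
  have expand: "(norm (?Q n x - ?Q m x))\<^sup>2 = (norm (?Q n x))\<^sup>2 + (norm (?Q m x))\<^sup>2 - 2 * (?Q n x \<bullet> ?Q m x)" for m n x
    by (simp add: power2_norm_eq_inner inner_simps inner_commute)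
  have pythagoras: "integral\<^sup>L \<nu> (\<lambda>x. (norm (?Q n x - ?Q m x))\<^sup>2) = a n - a m" if "m \<le> n" for m n
  proof -
    have "integral\<^sup>L \<nu> (\<lambda>x. ?Q n x \<bullet> ?Q m x) = a m"
      unfolding a_def
      by (rule P.integral_inner_quotient[OF lip Q_int Q_le]) (use Q_node[OF that] in auto)
    then show ?thesis unfolding expand using sq_int inner_int by (simp add: a_def)
  qed
  have sqd_int: "integrable \<nu> (\<lambda>x. (norm (?Q n x - ?Q m x))\<^sup>2)" for m n
    unfolding expand using sq_int inner_int by auto
  have a_mono: "a m \<le> a n" if "m \<le> n" for m n
  proof -
    have "0 \<le> integral\<^sup>L \<nu> (\<lambda>x. (norm (?Q n x - ?Q m x))\<^sup>2)" by (rule integral_nonneg_AE) auto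
    then show ?thesis using pythagoras[OF that] by simp
  qed
  have a_bound: "a n \<le> C\<^sup>2 * measure \<nu> (space \<nu>)" for n
  proof -
    have "a n \<le> integral\<^sup>L \<nu> (\<lambda>_. C\<^sup>2)" unfolding a_def
      by (intro integral_mono sq_int) (auto intro!: power_mono Q_le)
    then show ?thesis by (simp add: mult.commute)
  qed
  obtain L where L: "a \<longlonglongrightarrow> L" "\<And>n. a n \<le> L"
    using incseq_convergent[of a] a_mono a_bound by (metis incseq_def)
  have "\<exists>\<phi>. \<forall>k. (L - a (\<phi> k) < (1/4) ^ k) \<and> \<phi> k < \<phi> (Suc k)"
  proof (rule dependent_nat_choice)
    have ex: "\<exists>n0. \<forall>n\<ge>n0. L - a n < (1/4) ^ k" for k :: nat
    proof -
      have "eventually (\<lambda>n. L - (1/4) ^ k < a n) sequentially" by (rule order_tendstoD(1)[OF L(1)]) auto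
      then show ?thesis by (auto simp: eventually_sequentially algebra_simps)
    qed
    show "\<exists>n. L - a n < (1/4) ^ 0" using ex[of 0] by auto
    show "\<exists>y. L - a y < (1/4) ^ Suc k \<and> x < y" for x k
      using ex[of "Suc k"] by (metis Suc_le_eq le_cases order.refl order.trans)
  qed
  then obtain \<phi> where \<phi>: "\<And>k. L - a (\<phi> k) < (1/4) ^ k" "strict_mono \<phi>"
    by (auto simp: strict_mono_Suc_iff)
  define \<delta> where "\<delta> k x = norm (?Q (\<phi> (Suc k)) x - ?Q (\<phi> k) x)" for k x
  define K where "K = 1 + measure \<nu> (space \<nu>)"
  have K: "K \<ge> 0" by (simp add: K_def)
  have \<delta>_meas [measurable]: "\<delta> k \<in> borel_measurable \<nu>" for k unfolding \<delta>_def by measurable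
  have \<delta>_int: "integrable \<nu> (\<delta> k)" for k
    unfolding \<delta>_def using Q_int by (intro integrable_norm Bochner_Integration.integrable_diff)
  have int_\<delta>: "integral\<^sup>L \<nu> (\<delta> k) \<le> K * (1/2) ^ k" for k
  proof -
    have "integral\<^sup>L \<nu> (\<lambda>x. (\<delta> k x)\<^sup>2) = a (\<phi> (Suc k)) - a (\<phi> k)"
      unfolding \<delta>_def using \<phi>(2) by (intro pythagoras) (auto simp: strict_mono_def less_imp_le)
    then have sq: "integral\<^sup>L \<nu> (\<lambda>x. (\<delta> k x)\<^sup>2) \<le> (1/4) ^ k" using \<phi>(1)[of k] L(2)[of "\<phi> (Suc k)"] by linarith
    \<comment> \<open>Young's inequality turns the \<open>L\<^sup>2\<close> bound into a summable \<open>L\<^sup>1\<close> bound, with weight \<open>2 ^ k\<close>.\<close>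
    have young: "\<delta> k x \<le> 2 ^ k * (\<delta> k x)\<^sup>2 + (1/2) ^ k" for x
    proof (cases "2 ^ k * \<delta> k x \<le> 1")
      case True
      then have "\<delta> k x \<le> (1/2) ^ k" by (simp add: power_one_over field_simps)
      then show ?thesis by (simp add: add_increasing)
    next
      case False
      then have "1 * \<delta> k x \<le> (2 ^ k * \<delta> k x) * \<delta> k x" by (intro mult_right_mono) (auto simp: \<delta>_def)
      then show ?thesis by (simp add: power2_eq_square mult.assoc add_increasing2)
    qed
    have i: "integrable \<nu> (\<lambda>x. (\<delta> k x)\<^sup>2)" unfolding \<delta>_def by (rule sqd_int)
    have "integral\<^sup>L \<nu> (\<delta> k) \<le> integral\<^sup>L \<nu> (\<lambda>x. 2 ^ k * (\<delta> k x)\<^sup>2 + (1/2) ^ k)"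
      by (intro integral_mono \<delta>_int young Bochner_Integration.integrable_add integrable_mult_right i) auto
    also have "\<dots> = 2 ^ k * integral\<^sup>L \<nu> (\<lambda>x. (\<delta> k x)\<^sup>2) + (1/2) ^ k * measure \<nu> (space \<nu>)"
      using i by simp
    also have "\<dots> \<le> 2 ^ k * (1/4) ^ k + (1/2) ^ k * measure \<nu> (space \<nu>)"
      using sq by (intro add_right_mono mult_left_mono) auto
    also have "(2::real) ^ k * (1/4) ^ k = (1/2) ^ k" by (simp flip: power_mult_distrib)
    finally show ?thesis by (simp add: K_def algebra_simps)
  qed
  have "(\<integral>\<^sup>+x. (\<Sum>k. ennreal (\<delta> k x)) \<partial>\<nu>) = (\<Sum>k. \<integral>\<^sup>+x. ennreal (\<delta> k x) \<partial>\<nu>)"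
    by (rule nn_integral_suminf) measurable
  also have "\<dots> \<le> (\<Sum>k. ennreal (K * (1/2) ^ k))"
  proof (intro suminf_le)
    fix k
    have "(\<integral>\<^sup>+x. ennreal (\<delta> k x) \<partial>\<nu>) = ennreal (integral\<^sup>L \<nu> (\<delta> k))"
      by (intro nn_integral_eq_integral \<delta>_int) (auto simp: \<delta>_def)
    then show "(\<integral>\<^sup>+x. ennreal (\<delta> k x) \<partial>\<nu>) \<le> ennreal (K * (1/2) ^ k)" using int_\<delta>[of k] by (simp add: ennreal_leI)
  qed auto
  also have "\<dots> < \<infinity>"
  proof -
    have "summable (\<lambda>k. K * (1/2) ^ k)" by (intro summable_mult summable_geometric) auto
    then show ?thesis using K by (subst suminf_ennreal2) auto
  qed
  finally have "(\<integral>\<^sup>+x. (\<Sum>k. ennreal (\<delta> k x)) \<partial>\<nu>) \<noteq> \<infinity>" by simp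
  then have "AE x in \<nu>. (\<Sum>k. ennreal (\<delta> k x)) \<noteq> \<infinity>" by (intro nn_integral_PInf_AE) auto
  then have conv: "AE x in \<nu>. convergent (\<lambda>k. ?Q (\<phi> k) x)"
  proof eventually_elim
    case (elim x)
    then have "summable (\<lambda>k. \<delta> k x)" by (intro summable_suminf_not_top) (auto simp: \<delta>_def)
    then have "summable (\<lambda>k. ?Q (\<phi> (Suc k)) x - ?Q (\<phi> k) x)"
      unfolding \<delta>_def by (rule summable_norm_cancel)
    then have "convergent (\<lambda>n. ?Q (\<phi> 0) x + (\<Sum>k<n. ?Q (\<phi> (Suc k)) x - ?Q (\<phi> k) x))"
      by (intro convergent_add convergent_const) (simp add: summable_iff_convergent)
    moreover have "?Q (\<phi> 0) x + (\<Sum>k<n. ?Q (\<phi> (Suc k)) x - ?Q (\<phi> k) x) = ?Q (\<phi> n) x" for n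
      using sum_lessThan_telescope[of "\<lambda>k. ?Q (\<phi> k) x" n] by simp
    ultimately show ?case by simp
  qed
  define h where "h x = lim (\<lambda>k. ?Q (\<phi> k) x)" for x
  \<comment> \<open>The truncation changes the limit on a null set only and makes the bound hold everywhere.\<close>
  define g where "g x = (if norm (h x) \<le> C then h x else 0)" for x
  have h_meas [measurable]: "h \<in> borel_measurable \<nu>" unfolding h_def[abs_def] by measurable
  have g_meas: "g \<in> borel_measurable \<nu>" unfolding g_def[abs_def] by measurable
  have g_le: "norm (g t) \<le> C" for t using C by (simp add: g_def)
  have g_lim: "AE t in \<nu>. (\<lambda>k. ?Q (\<phi> k) t) \<longlonglongrightarrow> g t"
    using conv AE_space
  proof eventually_elim
    case (elim x)
    then have lim: "(\<lambda>k. ?Q (\<phi> k) x) \<longlonglongrightarrow> h x" by (simp add: convergent_LIMSEQ_iff h_def)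
    moreover have "norm (h x) \<le> C"
      by (rule LIMSEQ_le_const2[OF tendsto_norm[OF lim]]) (use elim Q_le in auto)
    ultimately show ?case by (simp add: g_def)
  qed
  have g_int: "integrable \<nu> g" by (rule integrable_bounded[OF g_meas g_le])
  have g_node: "(LINT x:{0<..\<tau> m j}|\<nu>. g x) = V (\<tau> m j) - V 0" if "j \<le> N m" for m j
  proof (rule LIMSEQ_unique)
    show "(\<lambda>k. LINT x:{0<..\<tau> m j}|\<nu>. ?Q (\<phi> k) x) \<longlonglongrightarrow> (LINT x:{0<..\<tau> m j}|\<nu>. g x)"
      by (rule tendsto_set_integral_Ioc[OF Q_meas g_meas g_lim Q_le]) (use P.\<tau>_bounds that in auto)
    have "(LINT x:{0<..\<tau> m j}|\<nu>. ?Q (\<phi> k) x) = V (\<tau> m j) - V 0" if "k \<ge> m" for k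
      using Q_node[of m "\<phi> k" 0 j] \<open>j \<le> N m\<close> that seq_suble[OF \<phi>(2), of k] P.\<tau>_0 by auto
    then show "(\<lambda>k. LINT x:{0<..\<tau> m j}|\<nu>. ?Q (\<phi> k) x) \<longlonglongrightarrow> V (\<tau> m j) - V 0"
      by (intro tendsto_eventually) (auto simp: eventually_sequentially)
  qed
  have "V t = V 0 + (LINT x:{0<..t}|\<nu>. g x)" if t: "0 \<le> t" "t \<le> T" for t
  proof (cases "t = 0")
    case True
    then show ?thesis by (simp add: set_lebesgue_integral_def)
  next
    case False
    then have t': "t \<in> {0<..T}" using t by auto
    let ?r = "\<lambda>n. P.right_end n t"
    have "norm (V t - (V 0 + (LINT x:{0<..t}|\<nu>. g x))) \<le> 2 * C * (\<sigma> (?r n) - \<sigma> t)" for n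
    proof -
      have r: "t \<le> ?r n" "?r n \<le> T" using right_end[OF t'] by auto
      obtain j where "?r n = \<tau> n j" "j \<le> N n" using P.cell_index_ex[OF t'] by (metis P.right_end_def Suc_leI)
      then have "V 0 = V (?r n) - (LINT x:{0<..?r n}|\<nu>. g x)" using g_node by simp
      also have "(LINT x:{0<..?r n}|\<nu>. g x) = (LINT x:{0<..t}|\<nu>. g x) + (LINT x:{t<..?r n}|\<nu>. g x)"
        using t r by (intro set_integral_Ioc_split[OF g_int]) auto
      finally have "V t - (V 0 + (LINT x:{0<..t}|\<nu>. g x)) = (LINT x:{t<..?r n}|\<nu>. g x) - (V (?r n) - V t)"
        by (simp add: algebra_simps)
      also have "norm \<dots> \<le> C * (\<sigma> (?r n) - \<sigma> t) + C * (\<sigma> (?r n) - \<sigma> t)"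
        using t r g_le by (intro order_trans[OF norm_triangle_ineq4] add_mono norm_set_integral_Ioc_le[OF g_int] lip) auto
      finally show ?thesis by simp
    qed
    moreover have "(\<lambda>n. 2 * C * (\<sigma> (?r n) - \<sigma> t)) \<longlonglongrightarrow> 2 * C * (\<sigma> t - \<sigma> t)"
      by (intro tendsto_intros right_end_lim t')
    ultimately have "norm (V t - (V 0 + (LINT x:{0<..t}|\<nu>. g x))) \<le> 0"
      by (intro LIMSEQ_le_const) auto
    then show ?thesis by simp
  qed
  then have increments: "\<forall>t\<in>{0..T}. V t = V 0 + (LINT x:{0<..t}|\<nu>. g x)"
    by (intro ballI) (simp only: atLeastAtMost_iff)
  show thesis by (rule that[OF \<phi>(2) g_meas allI[OF g_le] g_lim increments])
qed

end


section \<open>The implicit scheme\<close>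
locale evolution_problem = time_measure T \<rho> for T :: real and \<rho> :: "real \<Rightarrow> real" +
  fixes \<gamma> c m :: real and \<theta> k :: "real \<Rightarrow> real"
    and A :: "real \<Rightarrow> 'a::{real_inner,banach,second_countable_topology} \<Rightarrow> 'a \<Rightarrow> 'a set"
    and f :: "real \<Rightarrow> 'a \<Rightarrow> 'a \<Rightarrow> 'a"
  assumes A_maxmon: "\<And>t x. t \<in> {0..T} \<Longrightarrow> maximal_monotone (A t x)"
    and \<theta>_density: "lebesgue_density T \<rho> \<theta>"
    and \<gamma>_nonneg: "\<gamma> \<ge> 0"
    and A_dis: "\<And>s t x y. 0 \<le> s \<Longrightarrow> s \<le> t \<Longrightarrow> t \<le> T \<Longrightarrow>
      vladimirov_dis (A t x) (A s y)
        \<le> ereal (measure (stieltjes_I T \<rho>) {s<..t} + \<gamma> * norm (x - y) * \<theta> s)"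
    and c_nonneg: "c \<ge> 0"
    and A_growth: "\<And>t x y. t \<in> {0..T} \<Longrightarrow> y \<in> op_dom (A t x) \<Longrightarrow>
      norm (min_section (A t x) y) \<le> c * (1 + norm x + norm y)"
    and A_compact: "\<And>E. bounded E \<Longrightarrow>
      relatively_ball_compact (\<Union>(t, x)\<in>{0..T} \<times> E. op_dom (A t x))"
    and f_measurable: "\<And>x y. (\<lambda>t. f t x y) \<in> borel_measurable (restrict_space borel {0..T})"
    and f_lipschitz: "\<And>t x y x' y'. t \<in> {0..T} \<Longrightarrow>
      norm (f t x y - f t x' y') \<le> k t * (norm (x - x') + norm (y - y'))"
    and m_nonneg: "m \<ge> 0"
    and f_growth: "\<And>t x y. t \<in> {0..T} \<Longrightarrow> norm (f t x y) \<le> m * (1 + norm x + norm y)"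
begin

lemma \<theta>_range: "t \<in> {0..T} \<Longrightarrow> 0 \<le> \<theta> t \<and> \<theta> t \<le> 1"
  and \<theta>_measurable [measurable]: "\<theta> \<in> borel_measurable \<nu>"
  using \<theta>_density by (auto simp: lebesgue_density_def)

lemma f_measurable_nu [measurable]: "(\<lambda>t. f t x y) \<in> borel_measurable \<nu>"
  using f_measurable by (simp add: measurable_cong_sets[OF sets_nu refl])

text \<open>
    The pseudo-distance is symmetric while the hypothesis is one-sided in time; after \<open>\<theta> \<le> 1\<close> and
    \<open>\<rho> t - \<rho> s \<le> \<sigma> t - \<sigma> s\<close> both time orders are covered.
\<close>
lemma dis_le:
  assumes s: "s \<in> {0..T}" and t: "t \<in> {0..T}" and y: "y \<in> A t x p" "y' \<in> A s x' p'"
  shows "(y - y') \<bullet> (p' - p) \<le> (\<bar>\<sigma> t - \<sigma> s\<bar> + \<gamma> * norm (x - x')) * (1 + norm y + norm y')"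
proof -
  have ordered: "(y - y') \<bullet> (p' - p) \<le> (\<bar>\<sigma> t - \<sigma> s\<bar> + \<gamma> * norm (x - x')) * (1 + norm y + norm y')"
    if st: "0 \<le> s" "s \<le> t" "t \<le> T" and y: "y \<in> A t x p" "y' \<in> A s x' p'" for s t x x' y y' p p'
  proof -
    have "\<gamma> * norm (x - x') * \<theta> s \<le> \<gamma> * norm (x - x') * 1"
      using \<gamma>_nonneg \<theta>_range[of s] st by (intro mult_left_mono) auto
    moreover have "\<rho> t - \<rho> s \<le> \<bar>\<sigma> t - \<sigma> s\<bar>" using \<sigma>_diff(2)[of s t] st by auto
    ultimately have "measure (stieltjes_I T \<rho>) {s<..t} + \<gamma> * norm (x - x') * \<theta> s
        \<le> \<bar>\<sigma> t - \<sigma> s\<bar> + \<gamma> * norm (x - x')" using measure_stieltjes[OF st] by simp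
    then have "vladimirov_dis (A t x) (A s x') \<le> ereal (\<bar>\<sigma> t - \<sigma> s\<bar> + \<gamma> * norm (x - x'))"
      using A_dis[OF st, of x x'] by (meson ereal_less_eq(3) order_trans)
    then show ?thesis using y by (rule vladimirov_disD)
  qed
  show ?thesis
  proof (cases "s \<le> t")
    case True
    then show ?thesis using ordered[of s t] assms by auto
  next
    case False
    have "(y - y') \<bullet> (p' - p) = (y' - y) \<bullet> (p - p')" by (simp add: inner_simps)
    also have "\<dots> \<le> (\<bar>\<sigma> s - \<sigma> t\<bar> + \<gamma> * norm (x' - x)) * (1 + norm y' + norm y)"
      using False assms by (intro ordered) auto
    finally show ?thesis by (simp add: abs_minus_commute norm_minus_commute add_ac)
  qed
qed

text \<open>
    With \<open>\<theta> t = 0\<close> the pseudo-distance of \<open>A t x\<close> and \<open>A t y\<close> is at most \<open>0\<close>, so their graphs are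
    monotonically related and coincide by maximality.
\<close>
lemma A_at_atom:
  assumes t: "t \<in> {0..T}" and atom: "measure \<nu> {t} \<noteq> 0"
  shows "A t x = A t y"
proof -
  have "\<theta> t = 0" by (rule density_zero_at_atoms[OF \<theta>_density t atom])
  then have "vladimirov_dis (A t x) (A t y) \<le> ereal 0" for x y
    using A_dis[of t t x y] t by simp
  then show ?thesis
    using vladimirov_dis_zero_subset[OF A_maxmon[OF t]] by (meson subset_antisym ext)
qed

text \<open>
    A single constant above the constants of all hypotheses, so that the perturbation, the minimal
    section and the pseudo-distance are all controlled by \<open>L * (1 + norm x + norm v)\<close>.
\<close>
definition L :: real where "L = 1 + \<gamma> + c + m"

lemma L_ge: "1 \<le> L" "m \<le> L" "c \<le> L" "1 + \<gamma> \<le> L"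
  using \<gamma>_nonneg c_nonneg m_nonneg by (auto simp: L_def)

text \<open>
    The key estimate. With \<open>a\<close> the minimal section at the old velocity and \<open>v - v' = \<delta> (F + w)\<close>, the
    pseudo-distance bound reads \<open>(w - a) \<bullet> (F + w) \<le> (1 + \<gamma> |v|) (1 + |w| + |a|)\<close>: the factor \<open>\<delta>\<close>
    cancels because the operators move by a multiple of \<open>\<delta>\<close>. With all data below \<open>R \<ge> 1\<close> this is the
    quadratic inequality \<open>|w|\<^sup>2 \<le> 3 R |w| + 3 R\<^sup>2\<close>, whence \<open>|w| \<le> 4 R\<close>.
\<close>
lemma implicit_step:
  assumes st: "0 \<le> s" "s < t" "t \<le> T" and v: "v \<in> op_dom (A s x)"
    and F: "norm F \<le> m * (1 + norm x + norm v)"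
  defines "\<delta> \<equiv> \<sigma> t - \<sigma> s"
  obtains v' w where "w \<in> A t (x + \<delta> *\<^sub>R v) v'" "v' = v - \<delta> *\<^sub>R F - \<delta> *\<^sub>R w"
    "norm w \<le> 4 * (L * (1 + norm x + norm v))"
proof -
  have st': "s \<in> {0..T}" "t \<in> {0..T}" using st by auto
  have \<delta>: "\<delta> > 0" unfolding \<delta>_def using \<sigma>_strict_mono[OF st' st(2)] by simp
  define R where "R = L * (1 + norm x + norm v)"
  have scale: "q * (1 + norm x + norm v) \<le> R" if "q \<le> L" for q
    unfolding R_def using that by (intro mult_right_mono) auto
  have R1: "1 \<le> R"
  proof -
    have "1 * 1 \<le> L * (1 + norm x + norm v)" using L_ge by (intro mult_mono) auto
    then show ?thesis by (simp add: R_def)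
  qed
  define a where "a = min_section (A s x) v"
  have a: "a \<in> A s x v" unfolding a_def by (rule min_section_mem[OF A_maxmon[OF st'(1)] v])
  have a_le: "norm a \<le> R"
    using A_growth[OF st'(1) v] scale[OF L_ge(3)] by (simp add: a_def)
  have F_le: "norm F \<le> R" using F scale[OF L_ge(2)] by simp
  have K_le: "1 + \<gamma> * norm v \<le> R"
  proof -
    have "1 + \<gamma> * norm v \<le> (1 + \<gamma>) * (1 + norm x + norm v)"
      using \<gamma>_nonneg by (simp add: algebra_simps)
    then show ?thesis using scale[OF L_ge(4)] by simp
  qed
  obtain v' w where w: "w \<in> A t (x + \<delta> *\<^sub>R v) v'" "v - \<delta> *\<^sub>R F = v' + \<delta> *\<^sub>R w"
    using resolvent_exists[OF A_maxmon[OF st'(2)] \<delta>] by metis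
  have diff: "v - v' = \<delta> *\<^sub>R (F + w)" using w(2) by (simp add: algebra_simps)
  have "(w - a) \<bullet> (v - v') \<le> (\<bar>\<sigma> t - \<sigma> s\<bar> + \<gamma> * norm (x + \<delta> *\<^sub>R v - x)) * (1 + norm w + norm a)"
    by (rule dis_le[OF st' w(1) a])
  also have "\<bar>\<sigma> t - \<sigma> s\<bar> + \<gamma> * norm (x + \<delta> *\<^sub>R v - x) = \<delta> * (1 + \<gamma> * norm v)"
    unfolding \<delta>_def[symmetric] using \<delta> by (simp add: algebra_simps)
  finally have "\<delta> * ((w - a) \<bullet> (F + w)) \<le> \<delta> * ((1 + \<gamma> * norm v) * (1 + norm w + norm a))"
    unfolding diff by (simp add: mult.assoc)
  then have "(w - a) \<bullet> (F + w) \<le> (1 + \<gamma> * norm v) * (1 + norm w + norm a)"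
    using \<delta> by simp
  also have "\<dots> \<le> R * (1 + norm w + R)" using K_le a_le R1 by (intro mult_mono) auto
  finally have 1: "(w - a) \<bullet> (F + w) \<le> R * (1 + norm w + R)" .
  have "norm w * norm w = (w - a) \<bullet> (F + w) - w \<bullet> F + a \<bullet> F + a \<bullet> w"
    by (simp add: inner_simps flip: power2_norm_eq_inner) (simp add: power2_eq_square)
  also have "\<dots> \<le> R * (1 + norm w + R) + norm w * R + R * R + R * norm w"
  proof -
    have "- (w \<bullet> F) \<le> norm w * norm F" using norm_cauchy_schwarz[of "- w" F] by simp
    also have "\<dots> \<le> norm w * R" using F_le by (intro mult_left_mono) auto
    finally have 2: "- (w \<bullet> F) \<le> norm w * R" .
    have "a \<bullet> F \<le> norm a * norm F" by (rule norm_cauchy_schwarz)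
    also have "\<dots> \<le> R * R" using F_le a_le R1 by (intro mult_mono) auto
    finally have 3: "a \<bullet> F \<le> R * R" .
    have "a \<bullet> w \<le> norm a * norm w" by (rule norm_cauchy_schwarz)
    also have "\<dots> \<le> R * norm w" using a_le by (intro mult_right_mono) auto
    finally have 4: "a \<bullet> w \<le> R * norm w" .
    show ?thesis using 1 2 3 4 by linarith
  qed
  also have "\<dots> \<le> 3 * R * norm w + 3 * R * R"
    using mult_left_mono[OF R1, of R] R1 by (simp add: algebra_simps)
  finally have quad: "norm w * norm w \<le> 3 * R * norm w + 3 * R * R" .
  have "norm w \<le> 4 * R"
  proof (rule ccontr)
    assume "\<not> norm w \<le> 4 * R"
    then have w4: "4 * R < norm w" by simp
    have "3 * R * R \<le> R * norm w" using w4 R1 mult_left_mono[of "3 * R" "norm w" R] by (simp add: algebra_simps)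
    then have "norm w * norm w \<le> (4 * R) * norm w" using quad by (simp add: algebra_simps)
    moreover have "(4 * R) * norm w < norm w * norm w" using w4 R1 by (intro mult_strict_right_mono) auto
    ultimately show False by simp
  qed
  then show ?thesis using that[OF w(1)] w(2) by (simp add: R_def algebra_simps)
qed

definition force :: "real \<Rightarrow> real \<Rightarrow> 'a \<Rightarrow> 'a \<Rightarrow> 'a" where
  "force s t x y = (LINT r:{s<..t}|\<nu>. \<theta> r *\<^sub>R f r x y)"

lemma norm_\<theta>_f_le:
  assumes "t \<in> {0..T}"
  shows "norm (\<theta> t *\<^sub>R f t x y) \<le> m * (1 + norm x + norm y)"
proof -
  have "norm (\<theta> t *\<^sub>R f t x y) \<le> 1 * norm (f t x y)"
    using \<theta>_range[OF assms] by (simp add: mult_left_le_one_le)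
  then show ?thesis using f_growth[OF assms, of x y] by simp
qed

lemma \<theta>_f_integrable: "integrable \<nu> (\<lambda>t. \<theta> t *\<^sub>R f t x y)"
  by (rule integrable_bounded[where C = "m * (1 + norm x + norm y)"]) (measurable, rule norm_\<theta>_f_le)

lemma norm_force_le:
  assumes "0 \<le> s" "s \<le> t" "t \<le> T"
  shows "norm (force s t x y) \<le> m * (1 + norm x + norm y) * (\<sigma> t - \<sigma> s)"
  unfolding force_def
  by (rule norm_set_integral_Ioc_le[OF \<theta>_f_integrable _ assms])
    (intro AE_I2 impI norm_\<theta>_f_le, use assms in auto)

definition growth_rate :: real where "growth_rate = 5 * L + 2 + 5 * L * (\<sigma> T - \<sigma> 0)"

text \<open>
    \<open>(u, v)\<close> are position and velocity at \<open>s\<close>, and \<open>(u', v')\<close> at \<open>t\<close>. The position equation integrates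
    exactly the velocity that is \<open>v\<close> on \<open>{s..<t}\<close> and \<open>v'\<close> at \<open>t\<close>, so it is implicit only through an atom.
\<close>
definition is_step :: "real \<Rightarrow> real \<Rightarrow> 'a \<Rightarrow> 'a \<Rightarrow> 'a \<Rightarrow> 'a \<Rightarrow> 'a \<Rightarrow> bool" where
  "is_step s t u v u' v' w' \<longleftrightarrow> w' \<in> A t u' v' \<and> norm w' \<le> 4 * (L * (1 + norm u + norm v)) \<and>
     v' = v - force s t u v - (\<sigma> t - \<sigma> s) *\<^sub>R w' \<and>
     u' = u + (\<sigma> t - \<sigma> s - measure \<nu> {t}) *\<^sub>R v + measure \<nu> {t} *\<^sub>R v'"

lemma step_exists:
  assumes st: "0 \<le> s" "s < t" "t \<le> T" and v: "v \<in> op_dom (A s u)"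
  obtains u' v' w' where "is_step s t u v u' v' w'"
proof -
  define \<delta> where "\<delta> = \<sigma> t - \<sigma> s"
  have \<delta>: "\<delta> > 0" unfolding \<delta>_def using \<sigma>_strict_mono[of s t] st by simp
  have "norm ((1 / \<delta>) *\<^sub>R force s t u v) \<le> m * (1 + norm u + norm v)"
    using norm_force_le[of s t u v] st \<delta> by (simp add: \<delta>_def pos_divide_le_eq)
  then obtain v' w where w: "w \<in> A t (u + \<delta> *\<^sub>R v) v'"
    "v' = v - \<delta> *\<^sub>R ((1 / \<delta>) *\<^sub>R force s t u v) - \<delta> *\<^sub>R w" "norm w \<le> 4 * (L * (1 + norm u + norm v))"
    using implicit_step[OF st v, of "(1 / \<delta>) *\<^sub>R force s t u v"] unfolding \<delta>_def by metis
  define u' where "u' = u + (\<delta> - measure \<nu> {t}) *\<^sub>R v + measure \<nu> {t} *\<^sub>R v'"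
  \<comment> \<open>Without an atom \<open>u'\<close> is \<open>u + \<delta> v\<close>; at an atom the operator does not depend on the position.\<close>
  have "w \<in> A t u' v'"
  proof (cases "measure \<nu> {t} = 0")
    case True
    then show ?thesis using w(1) by (simp add: u'_def)
  next
    case False
    then show ?thesis using w(1) A_at_atom[of t u' "u + \<delta> *\<^sub>R v"] st by simp
  qed
  then show ?thesis using w \<delta> that[of u' v' w] unfolding is_step_def \<delta>_def[symmetric] u'_def by simp
qed

lemma atom_le_increment: "0 \<le> s \<Longrightarrow> s < t \<Longrightarrow> t \<le> T \<Longrightarrow> measure \<nu> {t} \<le> \<sigma> t - \<sigma> s"
  using measure_nu_Ioo[of s t] measure_nonneg[of \<nu> "{s<..<t}"] by linarith

lemma step_bound_v:
  assumes st: "0 \<le> s" "s < t" "t \<le> T" and step: "is_step s t u v u' v' w'"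
  shows "norm (v' - v) \<le> 5 * L * (1 + norm u + norm v) * (\<sigma> t - \<sigma> s)"
proof -
  define Y where "Y = 1 + norm u + norm v"
  have \<delta>: "0 \<le> \<sigma> t - \<sigma> s" using \<sigma>_mono[of s t] st by simp
  have Y: "Y \<ge> 0" by (simp add: Y_def)
  have "v' - v = - (force s t u v) - (\<sigma> t - \<sigma> s) *\<^sub>R w'" using step by (simp add: is_step_def)
  then have "norm (v' - v) \<le> norm (force s t u v) + (\<sigma> t - \<sigma> s) * norm w'"
    using norm_triangle_ineq4[of "- force s t u v" "(\<sigma> t - \<sigma> s) *\<^sub>R w'"] \<delta> by simp
  also have "\<dots> \<le> m * Y * (\<sigma> t - \<sigma> s) + (\<sigma> t - \<sigma> s) * (4 * (L * Y))"
    using norm_force_le[of s t u v] st step \<delta> by (intro add_mono mult_left_mono) (auto simp: is_step_def Y_def)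
  also have "\<dots> \<le> L * Y * (\<sigma> t - \<sigma> s) + (\<sigma> t - \<sigma> s) * (4 * (L * Y))"
    using L_ge \<delta> Y by (intro add_right_mono mult_right_mono) auto
  finally show ?thesis by (simp add: Y_def algebra_simps)
qed

lemma step_growth:
  assumes st: "0 \<le> s" "s < t" "t \<le> T" and step: "is_step s t u v u' v' w'"
  shows "1 + norm u' + norm v' \<le> (1 + norm u + norm v) * exp (growth_rate * (\<sigma> t - \<sigma> s))"
proof -
  define Y \<delta> \<mu> where "Y = 1 + norm u + norm v" and "\<delta> = \<sigma> t - \<sigma> s" and "\<mu> = measure \<nu> {t}"
  have \<delta>: "0 \<le> \<delta>" using \<sigma>_mono[of s t] st by (simp add: \<delta>_def)
  have \<delta>S: "\<delta> \<le> \<sigma> T - \<sigma> 0" using \<sigma>_mono[of t T] \<sigma>_mono[of 0 s] st by (simp add: \<delta>_def)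
  have \<mu>: "0 \<le> \<mu>" "\<mu> \<le> \<delta>" using atom_le_increment[OF st] by (auto simp: \<mu>_def \<delta>_def)
  have Y: "1 \<le> Y" "norm v \<le> Y" by (auto simp: Y_def)
  have dv: "norm (v' - v) \<le> 5 * L * Y * \<delta>" using step_bound_v[OF st step] by (simp add: Y_def \<delta>_def)
  then have v'_le: "norm v' \<le> norm v + 5 * L * Y * \<delta>" using norm_triangle_ineq2[of v' v] by linarith
  also have "\<dots> \<le> Y + 5 * L * Y * (\<sigma> T - \<sigma> 0)"
    using Y \<delta>S L_ge by (intro add_mono mult_left_mono) auto
  finally have v'Y: "norm v' \<le> Y + 5 * L * Y * (\<sigma> T - \<sigma> 0)" .
  have "norm u' \<le> norm u + norm ((\<delta> - \<mu>) *\<^sub>R v) + norm (\<mu> *\<^sub>R v')"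
    using step norm_triangle_ineq[of "u + (\<delta> - \<mu>) *\<^sub>R v" "\<mu> *\<^sub>R v'"] norm_triangle_ineq[of u "(\<delta> - \<mu>) *\<^sub>R v"]
    unfolding is_step_def \<delta>_def[symmetric] \<mu>_def[symmetric] by auto
  also have "\<dots> = norm u + (\<delta> - \<mu>) * norm v + \<mu> * norm v'" using \<mu> by simp
  also have "\<dots> \<le> norm u + \<delta> * Y + \<delta> * (Y + 5 * L * Y * (\<sigma> T - \<sigma> 0))"
    using \<mu> \<delta> Y v'Y by (intro add_mono mult_mono) auto
  finally have "1 + norm u' + norm v' \<le> Y + 5 * L * Y * \<delta> + \<delta> * Y + \<delta> * (Y + 5 * L * Y * (\<sigma> T - \<sigma> 0))"
    using v'_le by (simp add: Y_def)
  also have "\<dots> = Y * (1 + growth_rate * \<delta>)" by (simp add: growth_rate_def algebra_simps)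
  also have "\<dots> \<le> Y * exp (growth_rate * \<delta>)" using Y by (intro mult_left_mono exp_ge_add_one_self) auto
  finally show ?thesis by (simp add: Y_def \<delta>_def)
qed

text \<open>
    The steps are chained with \<open>step_growth\<close> as a discrete Gronwall inequality; the exponents add up to
    at most \<open>\<sigma> T - \<sigma> 0\<close>, whatever the partition.
\<close>
lemma discrete_trajectory:
  assumes part: "partition T \<rho> N \<tau>" and v\<^sub>0: "v\<^sub>0 \<in> op_dom (A 0 u\<^sub>0)"
  defines "M \<equiv> (1 + norm u\<^sub>0 + norm v\<^sub>0) * exp (growth_rate * (\<sigma> T - \<sigma> 0))"
  obtains U V W where "U 0 = u\<^sub>0" "V 0 = v\<^sub>0"
    "\<And>i. i \<le> N \<Longrightarrow> W i \<in> A (\<tau> i) (U i) (V i)"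
    "\<And>i. i \<le> N \<Longrightarrow> norm (W i) \<le> 4 * (L * M)"
    "\<And>i. i \<le> N \<Longrightarrow> 1 + norm (U i) + norm (V i) \<le> M"
    "\<And>i. i < N \<Longrightarrow> is_step (\<tau> i) (\<tau> (Suc i)) (U i) (V i) (U (Suc i)) (V (Suc i)) (W (Suc i))"
proof -
  interpret P: partition T \<rho> N \<tau> by (rule part)
  define Y\<^sub>0 where "Y\<^sub>0 = 1 + norm u\<^sub>0 + norm v\<^sub>0"
  have Y\<^sub>0: "Y\<^sub>0 \<ge> 1" by (simp add: Y\<^sub>0_def)
  have rate: "growth_rate \<ge> 0" using L_ge \<sigma>_mono[of 0 T] T_pos by (simp add: growth_rate_def)
  have exp_le: "Y\<^sub>0 * exp (growth_rate * (\<sigma> (\<tau> i) - \<sigma> 0)) \<le> M" if "i \<le> N" for i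
    unfolding M_def Y\<^sub>0_def[symmetric]
    using rate Y\<^sub>0 \<sigma>_mono[of "\<tau> i" T] P.\<tau>_mem[OF that] T_pos by (intro mult_left_mono) (auto intro!: mult_left_mono)
  define inv where "inv i z \<longleftrightarrow> (case z of (u, v, w) \<Rightarrow>
    (i = 0 \<longrightarrow> u = u\<^sub>0 \<and> v = v\<^sub>0) \<and>
    (i \<le> N \<longrightarrow> w \<in> A (\<tau> i) u v \<and> norm w \<le> 4 * (L * M) \<and>
      1 + norm u + norm v \<le> Y\<^sub>0 * exp (growth_rate * (\<sigma> (\<tau> i) - \<sigma> 0))))" for i z
  define rel where "rel i (z :: 'a \<times> 'a \<times> 'a) (z' :: 'a \<times> 'a \<times> 'a) \<longleftrightarrow> (case z of (u, v, w) \<Rightarrow> case z' of (u', v', w') \<Rightarrow>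
    i < N \<longrightarrow> is_step (\<tau> i) (\<tau> (Suc i)) u v u' v' w')" for i z z'
  have "\<exists>z. \<forall>i. inv i (z i) \<and> rel i (z i) (z (Suc i))"
  proof (rule dependent_nat_choice)
    have "norm (min_section (A 0 u\<^sub>0) v\<^sub>0) \<le> c * Y\<^sub>0" using A_growth[of 0 v\<^sub>0 u\<^sub>0] T_pos v\<^sub>0 by (simp add: Y\<^sub>0_def)
    also have "\<dots> \<le> L * M" using L_ge c_nonneg exp_le[of 0] Y\<^sub>0 by (intro mult_mono) (auto simp: P.\<tau>_0)
    also have "\<dots> \<le> 4 * (L * M)" using L_ge exp_le[of 0] Y\<^sub>0 by (auto simp: P.\<tau>_0)
    finally have "inv 0 (u\<^sub>0, v\<^sub>0, min_section (A 0 u\<^sub>0) v\<^sub>0)"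
      using min_section_mem[OF A_maxmon v\<^sub>0] T_pos by (simp add: inv_def P.\<tau>_0 Y\<^sub>0_def)
    then show "\<exists>z. inv 0 z" by blast
  next
    fix z i assume inv: "inv i z"
    obtain u v w where z: "z = (u, v, w)" by (cases z)
    show "\<exists>z'. inv (Suc i) z' \<and> rel i z z'"
    proof (cases "i < N")
      case False
      then show ?thesis by (auto simp: inv_def rel_def)
    next
      case True
      then have st: "0 \<le> \<tau> i" "\<tau> i < \<tau> (Suc i)" "\<tau> (Suc i) \<le> T"
        using P.\<tau>_bounds P.\<tau>_less by auto
      have z': "w \<in> A (\<tau> i) u v" "1 + norm u + norm v \<le> Y\<^sub>0 * exp (growth_rate * (\<sigma> (\<tau> i) - \<sigma> 0))"
        using inv True by (auto simp: inv_def z)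
      then have "v \<in> op_dom (A (\<tau> i) u)" by (auto simp: op_dom_def)
      then obtain u' v' w' where step: "is_step (\<tau> i) (\<tau> (Suc i)) u v u' v' w'"
        using step_exists[OF st] by metis
      have "norm w' \<le> 4 * (L * (1 + norm u + norm v))" using step by (simp add: is_step_def)
      also have "\<dots> \<le> 4 * (L * M)"
        using L_ge z'(2) exp_le[of i] True by (intro mult_left_mono) auto
      finally have w': "norm w' \<le> 4 * (L * M)" .
      have "1 + norm u' + norm v' \<le> (1 + norm u + norm v) * exp (growth_rate * (\<sigma> (\<tau> (Suc i)) - \<sigma> (\<tau> i)))"
        by (rule step_growth[OF st step])
      also have "\<dots> \<le> Y\<^sub>0 * exp (growth_rate * (\<sigma> (\<tau> i) - \<sigma> 0)) * exp (growth_rate * (\<sigma> (\<tau> (Suc i)) - \<sigma> (\<tau> i)))"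
        using z'(2) by (intro mult_right_mono) auto
      also have "\<dots> = Y\<^sub>0 * exp (growth_rate * (\<sigma> (\<tau> (Suc i)) - \<sigma> 0))"
        by (simp add: mult.assoc algebra_simps flip: exp_add)
      finally have "inv (Suc i) (u', v', w')" using step w' by (auto simp: inv_def is_step_def)
      moreover have "rel i z (u', v', w')" using step by (simp add: rel_def z)
      ultimately show ?thesis by blast
    qed
  qed
  then obtain z where z: "\<And>i. inv i (z i)" "\<And>i. rel i (z i) (z (Suc i))" by blast
  define U V W where "U i = fst (z i)" and "V i = fst (snd (z i))" and "W i = snd (snd (z i))" for i
  have z_eq: "z i = (U i, V i, W i)" for i by (simp add: U_def V_def W_def)
  show ?thesis
  proof (rule that[of U V W])
    show "U 0 = u\<^sub>0" "V 0 = v\<^sub>0" using z(1)[of 0] by (auto simp: inv_def z_eq)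
    show "W i \<in> A (\<tau> i) (U i) (V i)" "norm (W i) \<le> 4 * (L * M)" if "i \<le> N" for i
      using z(1)[of i] that by (auto simp: inv_def z_eq)
    show "1 + norm (U i) + norm (V i) \<le> M" if "i \<le> N" for i
      using z(1)[of i] that exp_le[OF that] by (auto simp: inv_def z_eq)
    show "is_step (\<tau> i) (\<tau> (Suc i)) (U i) (V i) (U (Suc i)) (V (Suc i)) (W (Suc i))" if "i < N" for i
      using z(2)[of i] that by (auto simp: rel_def z_eq)
  qed
qed

end


section \<open>Differential measures of maps with a density\<close>
context time_measure
begin

lemma BVRC_of_increments:
  assumes lip: "\<And>s t. 0 \<le> s \<Longrightarrow> s \<le> t \<Longrightarrow> t \<le> T \<Longrightarrow> norm (w t - w s) \<le> C * (\<sigma> t - \<sigma> s)"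
  shows "BVRC T w"
proof -
  have "C * (\<sigma> T - \<sigma> 0) \<ge> 0" using lip[of 0 T] T_pos norm_ge_zero order_trans by (metis less_imp_le order_refl)
  then have C: "C \<ge> 0" using \<sigma>_strict_mono[of 0 T] T_pos by (simp add: zero_le_mult_iff)
  have "bounded_variation_I T w"
    unfolding bounded_variation_I_def
  proof (intro exI allI impI)
    fix n :: nat and p assume p: "\<forall>i\<le>n. p i \<in> {0..T}" "\<forall>i<n. p i \<le> p (Suc i)"
    have "(\<Sum>i<n. norm (w (p (Suc i)) - w (p i))) \<le> (\<Sum>i<n. C * (\<sigma> (p (Suc i)) - \<sigma> (p i)))"
      using p by (intro sum_mono lip) auto
    also have "\<dots> = C * (\<sigma> (p n) - \<sigma> (p 0))"
      using sum_lessThan_telescope[of "\<lambda>i. \<sigma> (p i)" n] by (simp flip: sum_distrib_left)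
    also have "\<dots> \<le> C * (\<sigma> T - \<sigma> 0)"
      using C \<sigma>_mono[of "p n" T] \<sigma>_mono[of 0 "p 0"] p T_pos by (intro mult_left_mono) auto
    finally show "(\<Sum>i<n. norm (w (p (Suc i)) - w (p i))) \<le> C * (\<sigma> T - \<sigma> 0)" .
  qed
  moreover have "continuous (at_right t) w" if t: "t \<in> {0..<T}" for t
    unfolding continuous_within
  proof (rule Lim_null_comparison[THEN LIM_zero_cancel])
    show "eventually (\<lambda>s. norm (w s - w t) \<le> C * (\<sigma> s - \<sigma> t)) (at_right t)"
      using eventually_at_right_real[of t T] t by (auto elim!: eventually_mono intro!: lip)
    have "(\<sigma> \<longlongrightarrow> \<sigma> t) (at_right t)"
      using \<rho>_right_cont[OF t] unfolding \<sigma>_def continuous_within by (intro tendsto_intros) auto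
    then have "((\<lambda>s. C * (\<sigma> s - \<sigma> t)) \<longlongrightarrow> C * (\<sigma> t - \<sigma> t)) (at_right t)" by (intro tendsto_intros)
    then show "((\<lambda>s. C * (\<sigma> s - \<sigma> t)) \<longlongrightarrow> 0) (at_right t)" by simp
  qed
  ultimately show ?thesis by (simp add: BVRC_def)
qed

lemma differential_measure_of_density:
  fixes g :: "real \<Rightarrow> 'b::{banach,second_countable_topology}"
  assumes g: "integrable \<nu> g" and w: "\<And>t. 0 \<le> t \<Longrightarrow> t \<le> T \<Longrightarrow> w t = w 0 + (LINT x:{0<..t}|\<nu>. g x)"
  shows "differential_measure T w (\<lambda>B. LINT x:B|\<nu>. g x)"
    and "vector_density \<nu> (\<lambda>B. LINT x:B|\<nu>. g x) g"
proof -
  show "vector_density \<nu> (\<lambda>B. LINT x:B|\<nu>. g x) g" using g by (simp add: vector_density_def)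
  have set_int: "set_integrable \<nu> B g" if "B \<in> sets \<nu>" for B
    using g that unfolding set_integrable_def by (intro integrable_mult_indicator)
  have "vector_measure (restrict_space borel {0..T}) (\<lambda>B. LINT x:B|\<nu>. g x)"
    unfolding vector_measure_def sets_nu[symmetric]
  proof (intro allI impI)
    fix B :: "nat \<Rightarrow> real set" assume B: "range B \<subseteq> sets \<nu>" "disjoint_family B"
    have B_sets: "(\<Union>i. B i) \<in> sets \<nu>" "\<And>i. B i \<in> sets \<nu>"
      using sets.countable_UN[OF B(1)] B(1) by blast+
    have partial_sets: "(\<Union>i<n. B i) \<in> sets \<nu>" for n using B_sets(2) by (intro sets.finite_UN) simp_all
    have partial_Un: "(\<Union>n. \<Union>i<n. B i) = (\<Union>i. B i)"
      using UN_UN_finite_eq[of B] by (simp only: atLeast0LessThan)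
    have eq: "(LINT x:(\<Union>i<n. B i)|\<nu>. g x) = (\<Sum>i<n. LINT x:B i|\<nu>. g x)" for n
    proof (induction n)
      case 0
      then show ?case by (simp add: set_lebesgue_integral_def)
    next
      case (Suc n)
      have disj: "(\<Union>i<n. B i) \<inter> B n = {}"
      proof (rule equals0I)
        fix x assume "x \<in> (\<Union>i<n. B i) \<inter> B n"
        then obtain i where "i < n" "x \<in> B i" "x \<in> B n" by blast
        then show False using disjoint_family_onD[OF B(2), of i n] by (metis UNIV_I disjoint_iff less_irrefl)
      qed
      have "(LINT x:(\<Union>i<n. B i) \<union> B n|\<nu>. g x) = (LINT x:(\<Union>i<n. B i)|\<nu>. g x) + (LINT x:B n|\<nu>. g x)"
        by (intro set_integral_Un disj set_int B_sets(2) partial_sets)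
      moreover have "(\<Union>i<Suc n. B i) = (\<Union>i<n. B i) \<union> B n" unfolding lessThan_Suc by blast
      ultimately show ?case using Suc.IH by (simp only: sum.lessThan_Suc)
    qed
    have "(\<lambda>n. LINT x:(\<Union>i<n. B i)|\<nu>. g x) \<longlonglongrightarrow> (LINT x:(\<Union>n. \<Union>i<n. B i)|\<nu>. g x)"
    proof (rule set_integral_cont_up)
      show "(\<Union>i<n. B i) \<in> sets \<nu>" for n by (rule partial_sets)
      show "incseq (\<lambda>n. \<Union>i<n. B i)"
        by (intro incseq_SucI UN_mono) (simp_all add: lessThan_Suc subset_insertI)
      show "set_integrable \<nu> (\<Union>n. \<Union>i<n. B i) g" unfolding partial_Un by (rule set_int[OF B_sets(1)])
    qed
    then show "(\<lambda>i. LINT x:B i|\<nu>. g x) sums (LINT x:(\<Union>i. B i)|\<nu>. g x)"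
      unfolding sums_def eq partial_Un .
  qed
  moreover have "w t = w s + (LINT x:{s<..t}|\<nu>. g x)" if st: "0 \<le> s" "s \<le> t" "t \<le> T" for s t
  proof -
    have "w t = w 0 + (LINT x:{0<..t}|\<nu>. g x)" using st by (intro w) auto
    also have "\<dots> = w 0 + (LINT x:{0<..s}|\<nu>. g x) + (LINT x:{s<..t}|\<nu>. g x)"
      using set_integral_Ioc_split[OF g order_refl st] by (simp only: add.assoc)
    also have "w 0 + (LINT x:{0<..s}|\<nu>. g x) = w s" using st by (intro w[symmetric]) auto
    finally show ?thesis .
  qed
  ultimately show "differential_measure T w (\<lambda>B. LINT x:B|\<nu>. g x)"
    unfolding differential_measure_def by blast
qed

end

section \<open>Compactness of the discrete solutions\<close>
locale discretization = evolution_problem T \<rho> \<gamma> c m \<theta> k A f + refining T \<rho> N \<tau>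
  for T :: real and \<rho> :: "real \<Rightarrow> real" and \<gamma> c m :: real and \<theta> k :: "real \<Rightarrow> real"
    and A :: "real \<Rightarrow> 'a::{real_inner,banach,second_countable_topology} \<Rightarrow> 'a \<Rightarrow> 'a set"
    and f :: "real \<Rightarrow> 'a \<Rightarrow> 'a \<Rightarrow> 'a" and N :: "nat \<Rightarrow> nat" and \<tau> :: "nat \<Rightarrow> nat \<Rightarrow> real" +
  fixes U V W :: "nat \<Rightarrow> nat \<Rightarrow> 'a" and u\<^sub>0 v\<^sub>0 :: 'a and M :: real
  assumes U_0: "U n 0 = u\<^sub>0" and V_0: "V n 0 = v\<^sub>0"
    and W_mem: "i \<le> N n \<Longrightarrow> W n i \<in> A (\<tau> n i) (U n i) (V n i)"
    and W_le: "i \<le> N n \<Longrightarrow> norm (W n i) \<le> 4 * (L * M)"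
    and UV_le: "i \<le> N n \<Longrightarrow> 1 + norm (U n i) + norm (V n i) \<le> M"
    and step: "i < N n \<Longrightarrow>
      is_step (\<tau> n i) (\<tau> n (Suc i)) (U n i) (V n i) (U n (Suc i)) (V n (Suc i)) (W n (Suc i))"
begin

definition U_at :: "nat \<Rightarrow> real \<Rightarrow> 'a" where "U_at n t = U n (P.floor_index n t)"
definition V_at :: "nat \<Rightarrow> real \<Rightarrow> 'a" where "V_at n t = V n (P.floor_index n t)"
text \<open>
    The bound on the speed of the discrete velocities with respect to \<open>\<sigma>\<close>.
\<close>
definition C :: real where "C = 5 * L * M"

lemma M_ge: "1 \<le> M" using UV_le[of 0 0] norm_ge_zero[of "U 0 0"] norm_ge_zero[of "V 0 0"] by linarith

lemma C_nonneg: "0 \<le> C" using M_ge L_ge by (simp add: C_def)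

lemma floor_le: "t \<in> {0..T} \<Longrightarrow> P.floor_index n t \<le> N n"
  using P.floor_index_ex by metis

lemma V_le: "i \<le> N n \<Longrightarrow> norm (V n i) \<le> M" and U_le: "i \<le> N n \<Longrightarrow> norm (U n i) \<le> M"
  using UV_le[of i n] norm_ge_zero[of "U n i"] norm_ge_zero[of "V n i"] by linarith+

lemma lipschitz_by_steps:
  fixes X :: "nat \<Rightarrow> 'a"
  assumes "\<And>i. i < N n \<Longrightarrow> norm (X (Suc i) - X i) \<le> B * (\<sigma> (\<tau> n (Suc i)) - \<sigma> (\<tau> n i))" "i \<le> j" "j \<le> N n"
  shows "norm (X j - X i) \<le> B * (\<sigma> (\<tau> n j) - \<sigma> (\<tau> n i))"
  using assms(2,3)
proof (induction j rule: dec_induct)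
  case (step j)
  then have "norm (X (Suc j) - X i) \<le> norm (X (Suc j) - X j) + norm (X j - X i)"
    using norm_triangle_ineq[of "X (Suc j) - X j" "X j - X i"] by simp
  also have "\<dots> \<le> B * (\<sigma> (\<tau> n (Suc j)) - \<sigma> (\<tau> n j)) + B * (\<sigma> (\<tau> n j) - \<sigma> (\<tau> n i))"
    using step assms(1)[of j] by (intro add_mono) auto
  finally show ?case by (simp add: algebra_simps)
qed simp

lemma step_points: "i < N n \<Longrightarrow> 0 \<le> \<tau> n i \<and> \<tau> n i < \<tau> n (Suc i) \<and> \<tau> n (Suc i) \<le> T"
  using P.\<tau>_bounds P.\<tau>_less by auto

lemma V_lip: "i \<le> j \<Longrightarrow> j \<le> N n \<Longrightarrow> norm (V n j - V n i) \<le> C * (\<sigma> (\<tau> n j) - \<sigma> (\<tau> n i))"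
proof (rule lipschitz_by_steps)
  fix i assume i: "i < N n"
  then have st: "0 \<le> \<tau> n i" "\<tau> n i < \<tau> n (Suc i)" "\<tau> n (Suc i) \<le> T" using step_points by auto
  have "norm (V n (Suc i) - V n i) \<le> 5 * L * (1 + norm (U n i) + norm (V n i)) * (\<sigma> (\<tau> n (Suc i)) - \<sigma> (\<tau> n i))"
    by (rule step_bound_v[OF st step[OF i]])
  also have "\<dots> \<le> C * (\<sigma> (\<tau> n (Suc i)) - \<sigma> (\<tau> n i))"
    unfolding C_def using UV_le[of i n] L_ge P.\<sigma>_cell_pos[OF i] i by (intro mult_right_mono mult_left_mono) auto
  finally show "norm (V n (Suc i) - V n i) \<le> C * (\<sigma> (\<tau> n (Suc i)) - \<sigma> (\<tau> n i))" .
qed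

lemma U_lip: "i \<le> j \<Longrightarrow> j \<le> N n \<Longrightarrow> norm (U n j - U n i) \<le> M * (\<sigma> (\<tau> n j) - \<sigma> (\<tau> n i))"
proof (rule lipschitz_by_steps)
  fix i assume i: "i < N n"
  let ?\<delta> = "\<sigma> (\<tau> n (Suc i)) - \<sigma> (\<tau> n i)" and ?\<mu> = "measure \<nu> {\<tau> n (Suc i)}"
  have \<mu>: "?\<mu> \<le> ?\<delta>" using atom_le_increment[of "\<tau> n i" "\<tau> n (Suc i)"] step_points[OF i] by simp
  have "U n (Suc i) - U n i = (?\<delta> - ?\<mu>) *\<^sub>R V n i + ?\<mu> *\<^sub>R V n (Suc i)"
    using step[OF i] by (simp add: is_step_def)
  also have "norm \<dots> \<le> (?\<delta> - ?\<mu>) * norm (V n i) + ?\<mu> * norm (V n (Suc i))"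
    using \<mu> by (intro norm_triangle_le) simp
  also have "\<dots> \<le> (?\<delta> - ?\<mu>) * M + ?\<mu> * M"
    using \<mu> V_le[of i n] V_le[of "Suc i" n] i by (intro add_mono mult_left_mono) auto
  finally show "norm (U n (Suc i) - U n i) \<le> M * ?\<delta>" by (simp add: algebra_simps)
qed

lemma V_at_lip:
  assumes "0 \<le> s" "s \<le> t" "t \<le> T"
  shows "norm (V_at n t - V_at n s) \<le> C * (\<sigma> (P.node_below n t) - \<sigma> (P.node_below n s))"
  unfolding V_at_def P.node_below_def using assms
  by (intro V_lip node_below_mono floor_le) auto

lemma V_at_measurable [measurable]: "V_at n \<in> borel_measurable \<nu>"
  unfolding V_at_def[abs_def] by (rule P.step_measurable)

lemma V_at_le: "t \<in> {0..T} \<Longrightarrow> norm (V_at n t) \<le> M"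
  unfolding V_at_def by (intro V_le floor_le)

lemma V_at_integrable: "integrable \<nu> (V_at n)"
  by (rule integrable_bounded[OF V_at_measurable V_at_le])

lemma node_value_in_domain: "i \<le> N n \<Longrightarrow> V n i \<in> op_dom (A (\<tau> n i) (U n i))"
  using W_mem[of i n] by (auto simp: op_dom_def)

lemma V_at_values_compact:
  obtains K where "compact K" "\<And>n t. t \<in> {0..T} \<Longrightarrow> V_at n t \<in> K"
proof -
  define D where "D = (\<Union>(t, x)\<in>{0..T} \<times> cball 0 M. op_dom (A t x))"
  have compact: "compact (closure (D \<inter> cball 0 M))"
    using A_compact[of "cball 0 M"] by (simp add: relatively_ball_compact_def D_def)
  have mem: "V_at n t \<in> closure (D \<inter> cball 0 M)" if t: "t \<in> {0..T}" for n t
  proof -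
    have i: "P.floor_index n t \<le> N n" by (rule floor_le[OF t])
    have "(\<tau> n (P.floor_index n t), U n (P.floor_index n t)) \<in> {0..T} \<times> cball 0 M"
      using P.\<tau>_mem[OF i] U_le[OF i] by simp
    then have "V_at n t \<in> D"
      unfolding D_def V_at_def by (rule UN_I) (simp add: node_value_in_domain[OF i])
    moreover have "V_at n t \<in> cball 0 M" using V_le[OF i] by (simp add: V_at_def)
    ultimately show ?thesis by (intro subsetD[OF closure_subset] IntI)
  qed
  show thesis by (rule that[OF compact mem])
qed

text \<open>
    A diagonal subsequence converges at the countably many nodes. At any other \<open>t\<close> the sequence is Cauchy:
    as partitions are nested, the node \<open>s\<close> below \<open>t\<close> of a fixed partition is a node of all later ones, and
    the discrete velocities vary by at most \<open>C (\<sigma> t - \<sigma> s)\<close> between \<open>s\<close> and \<open>t\<close>.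
\<close>
lemma convergent_subsequence:
  obtains \<phi> :: "nat \<Rightarrow> nat" and v where "strict_mono \<phi>" "\<forall>t\<in>{0..T}. (\<lambda>n. V_at (\<phi> n) t) \<longlonglongrightarrow> v t"
proof -
  define D where "D = (\<Union>n. \<tau> n ` {..N n})"
  define d where "d = from_nat_into D"
  have "countable D" unfolding D_def by (intro countable_UN) simp_all
  moreover have "\<tau> 0 0 \<in> D" by (auto simp: D_def)
  ultimately have range_d: "range d = D" unfolding d_def by (intro range_from_nat_into) auto
  have D_sub: "D \<subseteq> {0..T}" using P.\<tau>_mem by (auto simp: D_def)
  have d_mem: "d i \<in> {0..T}" for i using D_sub rangeI[of d i] unfolding range_d by (rule subsetD)
  obtain K where K: "compact K" "\<And>n t. t \<in> {0..T} \<Longrightarrow> V_at n t \<in> K" by (rule V_at_values_compact) blast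
  interpret S: subseqs "\<lambda>i s. convergent (\<lambda>n. V_at (s n) (d i))"
  proof
    fix i and s :: "nat \<Rightarrow> nat"
    have "\<forall>n. V_at (s n) (d i) \<in> K" using K(2)[OF d_mem] by simp
    then obtain l r where r: "l \<in> K" "strict_mono r" "((\<lambda>n. V_at (s n) (d i)) \<circ> r) \<longlonglongrightarrow> l"
      by (rule seq_compactE[OF K(1)[unfolded compact_eq_seq_compact_metric]])
    from r(3) have "convergent (\<lambda>n. V_at ((s \<circ> r) n) (d i))"
      unfolding o_def convergent_def by (rule exI)
    then show "\<exists>r'. strict_mono r' \<and> convergent (\<lambda>n. V_at ((s \<circ> r') n) (d i))" using r(2) by (intro exI conjI)
  qed
  have tail: "convergent (\<lambda>n. V_at ((S.diagseq \<circ> (+) (Suc i)) n) (d i))" for i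
  proof (rule S.diagseq_holds)
    fix i and r s :: "nat \<Rightarrow> nat" assume "strict_mono r" "convergent (\<lambda>n. V_at (s n) (d i))"
    from convergent_subseq_convergent[OF this(2,1)]
    show "convergent (\<lambda>n. V_at ((s \<circ> r) n) (d i))" by (simp only: o_def)
  qed
  have "convergent (\<lambda>n. V_at (S.diagseq (n + Suc i)) (d i))" for i
    using tail[of i] unfolding o_def by (simp only: add.commute)
  then have conv_d: "convergent (\<lambda>n. V_at (S.diagseq n) (d i))" for i
    by (rule convergent_ignore_initial_segment[THEN iffD1])
  have conv_D: "convergent (\<lambda>n. V_at (S.diagseq n) s)" if "s \<in> D" for s
  proof -
    from that obtain i where "s = d i" unfolding range_d[symmetric] by (rule rangeE)
    then show ?thesis using conv_d[of i] by (simp only:)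
  qed
  have "convergent (\<lambda>n. V_at (S.diagseq n) t)" if t: "t \<in> {0..T}" for t
  proof -
    have "Cauchy (\<lambda>n. V_at (S.diagseq n) t)"
    proof (rule CauchyI)
      fix e :: real assume e: "e > 0"
      have "(\<lambda>l. C * (\<sigma> t - \<sigma> (P.node_below l t))) \<longlonglongrightarrow> C * (\<sigma> t - \<sigma> t)"
        by (intro tendsto_intros node_below_lim t)
      then have "eventually (\<lambda>l. C * (\<sigma> t - \<sigma> (P.node_below l t)) < e / 3) sequentially"
        using e by (intro order_tendstoD(2)) auto
      then obtain l where l: "C * (\<sigma> t - \<sigma> (P.node_below l t)) < e / 3"
        by (auto simp: eventually_sequentially)
      define s where "s = P.node_below l t"
      have s: "0 \<le> s" "s \<le> t" using node_below[OF t] by (auto simp: s_def)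
      have s_node: "s = \<tau> l (P.floor_index l t)" by (simp add: s_def P.node_below_def)
      then have "s \<in> D" using floor_le[OF t, of l] by (auto simp: D_def)
      have near: "norm (V_at n t - V_at n s) < e / 3" if "l \<le> n" for n
      proof -
        obtain j where j: "j \<le> N n" "\<tau> n j = s" using nested[OF \<open>l \<le> n\<close> floor_le[OF t]] s_node by auto
        have "P.node_below n s = s" using node_below_node[OF j(1)] j(2) by simp
        then have "norm (V_at n t - V_at n s) \<le> C * (\<sigma> (P.node_below n t) - \<sigma> s)"
          using V_at_lip[of s t n] s t by simp
        also have "\<dots> \<le> C * (\<sigma> t - \<sigma> s)"
          using node_below[OF t, of n] t C_nonneg by (intro mult_left_mono diff_right_mono \<sigma>_mono) auto
        finally show ?thesis using l by (simp add: s_def)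
      qed
      have "Cauchy (\<lambda>n. V_at (S.diagseq n) s)" using conv_D[OF \<open>s \<in> D\<close>] by (rule convergent_Cauchy)
      then obtain n0 where n0: "\<And>n n'. n \<ge> n0 \<Longrightarrow> n' \<ge> n0 \<Longrightarrow>
          norm (V_at (S.diagseq n) s - V_at (S.diagseq n') s) < e / 3"
        using CauchyD[of "\<lambda>n. V_at (S.diagseq n) s" "e / 3"] e by auto
      have "norm (V_at (S.diagseq n) t - V_at (S.diagseq n') t) < e" if "n \<ge> max n0 l" "n' \<ge> max n0 l" for n n'
      proof -
        have "l \<le> S.diagseq n" "l \<le> S.diagseq n'"
          using seq_suble[OF S.subseq_diagseq, of n] seq_suble[OF S.subseq_diagseq, of n'] that by auto
        then have "norm (V_at (S.diagseq n) t - V_at (S.diagseq n) s) < e / 3"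
            "norm (V_at (S.diagseq n') t - V_at (S.diagseq n') s) < e / 3" by - (erule near)+
        moreover have "norm (V_at (S.diagseq n) s - V_at (S.diagseq n') s) < e / 3" using that by (intro n0) auto
        moreover have "dist a b \<le> dist a a' + dist a' b' + dist b b'" for a a' b b' :: 'a
          using dist_triangle[of a b a'] dist_triangle[of a' b b'] dist_commute[of b b'] by linarith
        note this[unfolded dist_norm, of "V_at (S.diagseq n) t" "V_at (S.diagseq n') t"
            "V_at (S.diagseq n) s" "V_at (S.diagseq n') s"]
        ultimately show ?thesis by linarith
      qed
      then show "\<exists>M. \<forall>m\<ge>M. \<forall>n\<ge>M. norm (V_at (S.diagseq m) t - V_at (S.diagseq n) t) < e" by blast
    qed
    then show ?thesis by (simp add: Cauchy_convergent_iff)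
  qed
  then have "\<forall>t\<in>{0..T}. (\<lambda>n. V_at (S.diagseq n) t) \<longlonglongrightarrow> lim (\<lambda>n. V_at (S.diagseq n) t)"
    by (intro ballI convergent_LIMSEQ_iff[THEN iffD1])
  then show thesis by (rule that[OF S.subseq_diagseq])
qed

end

section \<open>Passage to the limit\<close>
locale approximation = discretization T \<rho> \<gamma> c m \<theta> k A f N \<tau> U V W u\<^sub>0 v\<^sub>0 M
  for T :: real and \<rho> :: "real \<Rightarrow> real" and \<gamma> c m :: real and \<theta> k :: "real \<Rightarrow> real"
    and A :: "real \<Rightarrow> 'a::{real_inner,banach,second_countable_topology} \<Rightarrow> 'a \<Rightarrow> 'a set"
    and f :: "real \<Rightarrow> 'a \<Rightarrow> 'a \<Rightarrow> 'a" and N :: "nat \<Rightarrow> nat" and \<tau> :: "nat \<Rightarrow> nat \<Rightarrow> real"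
    and U V W :: "nat \<Rightarrow> nat \<Rightarrow> 'a" and u\<^sub>0 v\<^sub>0 :: 'a and M :: real +
  fixes v :: "real \<Rightarrow> 'a"
  assumes V_lim: "t \<in> {0..T} \<Longrightarrow> (\<lambda>n. V n (P.floor_index n t)) \<longlonglongrightarrow> v t"
begin

definition u :: "real \<Rightarrow> 'a" where "u t = u\<^sub>0 + (LINT x:{0<..t}|\<nu>. v x)"

lemma v_lip:
  assumes "0 \<le> s" "s \<le> t" "t \<le> T"
  shows "norm (v t - v s) \<le> C * (\<sigma> t - \<sigma> s)"
proof (rule LIMSEQ_le)
  show "(\<lambda>n. norm (V_at n t - V_at n s)) \<longlonglongrightarrow> norm (v t - v s)"
    unfolding V_at_def using assms by (intro tendsto_intros V_lim) auto
  show "(\<lambda>n. C * (\<sigma> (P.node_below n t) - \<sigma> (P.node_below n s))) \<longlonglongrightarrow> C * (\<sigma> t - \<sigma> s)"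
    using assms by (intro tendsto_intros node_below_lim) auto
qed (use V_at_lip[OF assms] in auto)

lemma v_measurable [measurable]: "v \<in> borel_measurable \<nu>"
  by (rule borel_measurable_LIMSEQ_metric[OF V_at_measurable]) (auto simp: V_at_def intro: V_lim)

lemma v_le: "t \<in> {0..T} \<Longrightarrow> norm (v t) \<le> M"
  using LIMSEQ_le_const2[OF tendsto_norm[OF V_lim]] V_at_le unfolding V_at_def by blast

lemma v_integrable: "integrable \<nu> v"
  by (rule integrable_bounded[OF v_measurable v_le])

lemma v_0: "v 0 = v\<^sub>0"
proof (rule LIMSEQ_unique)
  show "(\<lambda>n. V n (P.floor_index n 0)) \<longlonglongrightarrow> v 0" using V_lim[of 0] T_pos by simp
  have "P.floor_index n 0 = 0" for n using P.floor_index_\<tau>[of 0 n] by (simp add: P.\<tau>_0)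
  then show "(\<lambda>n. V n (P.floor_index n 0)) \<longlonglongrightarrow> v\<^sub>0" by (simp add: V_0)
qed

text \<open>
    The discrete positions are exact primitives, so they converge when the velocities do.
\<close>
lemma U_eq_integral: "i \<le> N n \<Longrightarrow> U n i = u\<^sub>0 + (LINT x:{0<..\<tau> n i}|\<nu>. V_at n x)"
proof (induction i)
  case 0
  then show ?case by (simp add: U_0 P.\<tau>_0 set_lebesgue_integral_def)
next
  case (Suc i)
  then have i: "i < N n" by simp
  define s t where "s = \<tau> n i" and "t = \<tau> n (Suc i)"
  have st: "0 \<le> s" "s < t" "t \<le> T" using step_points[OF i] by (auto simp: s_def t_def)
  have [measurable]: "{t} \<in> sets \<nu>" "{s<..t} \<in> sets \<nu>" using st by auto
  have "(LINT x:{s<..t}|\<nu>. V_at n x) = (LINT x:{s<..t}|\<nu>. V n i + indicator {t} x *\<^sub>R (V n (Suc i) - V n i))"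
    unfolding s_def t_def
  proof (rule P.set_integral_cell_cong)
    fix x assume x: "x \<in> {\<tau> n i<..\<tau> n (Suc i)}"
    show "V_at n x = V n i + indicator {\<tau> n (Suc i)} x *\<^sub>R (V n (Suc i) - V n i)"
    proof (cases "x = \<tau> n (Suc i)")
      case True
      then show ?thesis using i by (simp add: V_at_def P.floor_index_\<tau>)
    next
      case False
      then have "P.floor_index n x = i" using x i by (intro P.floor_index_eq) auto
      then show ?thesis using False by (simp add: V_at_def)
    qed
  qed
  also have "\<dots> = (LINT x:{s<..t}|\<nu>. V n i) + (LINT x:{s<..t}|\<nu>. indicator {t} x *\<^sub>R (V n (Suc i) - V n i))"
    unfolding set_integrable_def
    by (rule set_integral_add(2)) (auto intro!: set_integrable_Ioc st less_imp_le integrable_scaleR_left simp: emeasure_eq_measure)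
  also have "(LINT x:{s<..t}|\<nu>. indicator {t} x *\<^sub>R (V n (Suc i) - V n i))
      = (LINT x|\<nu>. indicator {t} x *\<^sub>R (V n (Suc i) - V n i))"
    unfolding set_lebesgue_integral_def
    by (rule Bochner_Integration.integral_cong) (use st in \<open>auto simp: indicator_def\<close>)
  also have "\<dots> = measure \<nu> {t} *\<^sub>R (V n (Suc i) - V n i)"
  proof -
    have "{t} \<inter> {0..T} = {t}" using st by auto
    then show ?thesis by (subst integral_scaleR_left) (auto simp: emeasure_eq_measure)
  qed
  also have "(LINT x:{s<..t}|\<nu>. V n i) = (\<sigma> t - \<sigma> s) *\<^sub>R V n i"
    using st by (intro set_integral_const_Ioc) auto
  finally have increment: "(LINT x:{s<..t}|\<nu>. V_at n x)
      = (\<sigma> t - \<sigma> s) *\<^sub>R V n i + measure \<nu> {t} *\<^sub>R (V n (Suc i) - V n i)" .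
  have "U n (Suc i) = U n i + (\<sigma> t - \<sigma> s - measure \<nu> {t}) *\<^sub>R V n i + measure \<nu> {t} *\<^sub>R V n (Suc i)"
    using step[OF i] by (simp add: is_step_def s_def t_def)
  also have "\<dots> = U n i + (LINT x:{s<..t}|\<nu>. V_at n x)"
    unfolding increment by (simp only: scaleR_diff_left scaleR_diff_right add_diff_eq diff_add_eq add.assoc)
  also have "U n i = u\<^sub>0 + (LINT x:{0<..s}|\<nu>. V_at n x)" using Suc by (simp add: s_def)
  finally show ?case
    using set_integral_Ioc_split[OF V_at_integrable, of 0 s t n] st by (simp add: t_def[symmetric] add.assoc)
qed

lemma U_at_lim:
  assumes t: "t \<in> {0..T}"
  shows "(\<lambda>n. U_at n t) \<longlonglongrightarrow> u t"
proof -
  have "(\<lambda>n. LINT x:{0<..t}|\<nu>. V_at n x) \<longlonglongrightarrow> (LINT x:{0<..t}|\<nu>. v x)"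
    by (rule tendsto_set_integral_Ioc[OF V_at_measurable v_measurable _ V_at_le])
      (use t in \<open>auto simp: V_at_def intro!: AE_I2 V_lim\<close>)
  moreover have "(\<lambda>n. (LINT x:{0<..P.node_below n t}|\<nu>. V_at n x) - (LINT x:{0<..t}|\<nu>. V_at n x)) \<longlonglongrightarrow> 0"
  proof (rule Lim_null_comparison)
    show "\<forall>\<^sub>F n in sequentially. norm ((LINT x:{0<..P.node_below n t}|\<nu>. V_at n x) - (LINT x:{0<..t}|\<nu>. V_at n x))
        \<le> M * (\<sigma> t - \<sigma> (P.node_below n t))"
    proof (rule always_eventually, rule allI)
      fix n
      have b: "0 \<le> P.node_below n t" "P.node_below n t \<le> t" using node_below[OF t] by auto
      have "norm (LINT x:{P.node_below n t<..t}|\<nu>. V_at n x) \<le> M * (\<sigma> t - \<sigma> (P.node_below n t))"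
        using b t by (intro norm_set_integral_Ioc_le[OF V_at_integrable]) (auto intro!: AE_I2 V_at_le)
      then show "norm ((LINT x:{0<..P.node_below n t}|\<nu>. V_at n x) - (LINT x:{0<..t}|\<nu>. V_at n x))
        \<le> M * (\<sigma> t - \<sigma> (P.node_below n t))"
        using set_integral_Ioc_split[OF V_at_integrable, of 0 "P.node_below n t" t n] b t by simp
    qed
    have "(\<lambda>n. M * (\<sigma> t - \<sigma> (P.node_below n t))) \<longlonglongrightarrow> M * (\<sigma> t - \<sigma> t)"
      by (intro tendsto_intros node_below_lim t)
    then show "(\<lambda>n. M * (\<sigma> t - \<sigma> (P.node_below n t))) \<longlonglongrightarrow> 0" by simp
  qed
  ultimately have "(\<lambda>n. (LINT x:{0<..P.node_below n t}|\<nu>. V_at n x)) \<longlonglongrightarrow> 0 + (LINT x:{0<..t}|\<nu>. v x)"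
    using tendsto_add by fastforce
  then have "(\<lambda>n. u\<^sub>0 + (LINT x:{0<..P.node_below n t}|\<nu>. V_at n x)) \<longlonglongrightarrow> u t"
    unfolding u_def by (intro tendsto_add tendsto_const) simp
  moreover have "U_at n t = u\<^sub>0 + (LINT x:{0<..P.node_below n t}|\<nu>. V_at n x)" for n
    unfolding U_at_def P.node_below_def by (rule U_eq_integral[OF floor_le[OF t]])
  ultimately show ?thesis by simp
qed

lemma u_integral: "u t = u 0 + (LINT x:{0<..t}|\<nu>. v x)"
  by (simp add: u_def set_lebesgue_integral_def)

lemma u_lip:
  assumes "0 \<le> s" "s \<le> t" "t \<le> T"
  shows "norm (u t - u s) \<le> M * (\<sigma> t - \<sigma> s)"
proof -
  have "u t - u s = (LINT x:{s<..t}|\<nu>. v x)"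
    using set_integral_Ioc_split[OF v_integrable, of 0 s t] assms by (simp add: u_def)
  then show ?thesis using assms by (auto intro!: norm_set_integral_Ioc_le[OF v_integrable] AE_I2 v_le)
qed

lemma uv_le:
  assumes t: "t \<in> {0..T}"
  shows "1 + norm (u t) + norm (v t) \<le> M"
proof (rule LIMSEQ_le_const2)
  show "(\<lambda>n. 1 + norm (U_at n t) + norm (V_at n t)) \<longlonglongrightarrow> 1 + norm (u t) + norm (v t)"
    unfolding V_at_def by (intro tendsto_intros U_at_lim V_lim t)
  show "\<exists>N. \<forall>n\<ge>N. 1 + norm (U_at n t) + norm (V_at n t) \<le> M"
    unfolding U_at_def V_at_def using UV_le[OF floor_le[OF t]] by blast
qed

text \<open>
    Monotonicity passes to the limit because the operator at the last node before \<open>t\<close> approaches the one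
    at \<open>t\<close> in pseudo-distance.
\<close>
lemma v_in_domain:
  assumes t: "t \<in> {0..T}"
  shows "v t \<in> op_dom (A t (u t))"
proof (rule mem_op_dom_if_asymptotically_monotone[OF A_maxmon[OF t]])
  show "(\<lambda>n. V_at n t) \<longlonglongrightarrow> v t" unfolding V_at_def by (rule V_lim[OF t])
  show "norm (W n (P.floor_index n t)) \<le> 4 * (L * M)" for n by (rule W_le[OF floor_le[OF t]])
  fix x y assume y: "y \<in> A t (u t) x"
  define e where "e n = (\<bar>\<sigma> (P.node_below n t) - \<sigma> t\<bar> + \<gamma> * norm (U_at n t - u t)) * (1 + 4 * (L * M) + norm y)" for n
  have "e \<longlonglongrightarrow> (\<bar>\<sigma> t - \<sigma> t\<bar> + \<gamma> * norm (u t - u t)) * (1 + 4 * (L * M) + norm y)"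
    unfolding e_def by (intro tendsto_intros node_below_lim U_at_lim t)
  then have "e \<longlonglongrightarrow> 0" by simp
  moreover have "(W n (P.floor_index n t) - y) \<bullet> (x - V_at n t) \<le> e n" for n
  proof -
    have "(W n (P.floor_index n t) - y) \<bullet> (x - V_at n t)
      \<le> (\<bar>\<sigma> (P.node_below n t) - \<sigma> t\<bar> + \<gamma> * norm (U_at n t - u t)) * (1 + norm (W n (P.floor_index n t)) + norm y)"
      using W_mem[OF floor_le[OF t]] node_below[OF t, of n] t y
      by (intro dis_le) (auto simp: U_at_def V_at_def P.node_below_def)
    also have "\<dots> \<le> e n"
      unfolding e_def using W_le[OF floor_le[OF t]] \<gamma>_nonneg by (intro mult_left_mono) auto
    finally show ?thesis .
  qed
  ultimately show "\<exists>e. e \<longlonglongrightarrow> 0 \<and> (\<forall>n. (W n (P.floor_index n t) - y) \<bullet> (x - V_at n t) \<le> e n)" by blast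
qed

text \<open>
    The perturbation is frozen on each cell at the values of its left end, as in the scheme. The limit is
    cut off at \<open>0\<close>, a null set that lies in no cell.
\<close>
definition forcing_n :: "nat \<Rightarrow> real \<Rightarrow> 'a" where
  "forcing_n n x = \<theta> x *\<^sub>R f x (U n (P.cell_index n x)) (V n (P.cell_index n x))"

definition forcing :: "real \<Rightarrow> 'a" where
  "forcing x = indicator {0<..T} x *\<^sub>R (\<theta> x *\<^sub>R f x (u x) (v x))"

lemma forcing_n_measurable [measurable]: "forcing_n n \<in> borel_measurable \<nu>"
  unfolding forcing_n_def[abs_def] by (rule P.indexed_measurable) measurable

lemma forcing_n_le: "x \<in> {0..T} \<Longrightarrow> norm (forcing_n n x) \<le> m * M"
proof -
  assume x: "x \<in> {0..T}"
  have i: "P.cell_index n x \<le> N n" using P.cell_index_less[OF x, of n] by simp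
  show ?thesis unfolding forcing_n_def
    by (rule order_trans[OF norm_\<theta>_f_le[OF x] mult_left_mono[OF UV_le[OF i] m_nonneg]])
qed

lemma forcing_n_integrable: "integrable \<nu> (forcing_n n)"
  by (rule integrable_bounded[OF forcing_n_measurable forcing_n_le])

text \<open>
    The left ends of the cells only see the left limit of \<open>v\<close>. This is the value of \<open>v\<close> unless \<open>x\<close> is an
    atom, and there the factor \<open>\<theta> x\<close> vanishes.
\<close>
lemma forcing_lim:
  assumes x: "x \<in> {0<..T}"
  shows "(\<lambda>n. forcing_n n x) \<longlonglongrightarrow> forcing x"
proof (cases "\<theta> x = 0")
  case True
  then show ?thesis by (simp add: forcing_n_def forcing_def)
next
  case False
  have x': "x \<in> {0..T}" using x by auto
  have no_atom: "measure \<nu> {x} = 0" using density_zero_at_atoms[OF \<theta>_density x'] False by blast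
  have left: "(\<lambda>n. X n (P.cell_index n x)) \<longlonglongrightarrow> l"
    if X: "\<And>n i j. i \<le> j \<Longrightarrow> j \<le> N n \<Longrightarrow> norm (X n j - X n i) \<le> B * (\<sigma> (\<tau> n j) - \<sigma> (\<tau> n i))"
      and lim: "(\<lambda>n. X n (P.floor_index n x)) \<longlonglongrightarrow> l" for X :: "nat \<Rightarrow> nat \<Rightarrow> 'a" and B l
  proof -
    have "(\<lambda>n. X n (P.floor_index n x) - X n (P.cell_index n x)) \<longlonglongrightarrow> 0"
    proof (rule Lim_null_comparison)
      have "P.cell_index n x \<le> P.floor_index n x" for n
        unfolding P.cell_index_def P.floor_index_def by (intro card_mono) auto
      then show "\<forall>\<^sub>F n in sequentially. norm (X n (P.floor_index n x) - X n (P.cell_index n x))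
          \<le> B * (\<sigma> (P.node_below n x) - \<sigma> (P.left_end n x))"
        unfolding P.node_below_def P.left_end_def using X floor_le[OF x'] by auto
      have "(\<lambda>n. B * (\<sigma> (P.node_below n x) - \<sigma> (P.left_end n x))) \<longlonglongrightarrow> B * (\<sigma> x - (\<sigma> x - measure \<nu> {x}))"
        by (intro tendsto_intros node_below_lim left_end_lim x x')
      then show "(\<lambda>n. B * (\<sigma> (P.node_below n x) - \<sigma> (P.left_end n x))) \<longlonglongrightarrow> 0" by (simp add: no_atom)
    qed
    from tendsto_diff[OF lim this] show ?thesis by simp
  qed
  have lim: "(\<lambda>n. U n (P.cell_index n x)) \<longlonglongrightarrow> u x" "(\<lambda>n. V n (P.cell_index n x)) \<longlonglongrightarrow> v x"
    using left[OF U_lip] left[OF V_lip V_lim[OF x']] U_at_lim[OF x'] by (auto simp: U_at_def)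
  have "(\<lambda>n. f x (U n (P.cell_index n x)) (V n (P.cell_index n x)) - f x (u x) (v x)) \<longlonglongrightarrow> 0"
  proof (rule Lim_null_comparison)
    show "\<forall>\<^sub>F n in sequentially. norm (f x (U n (P.cell_index n x)) (V n (P.cell_index n x)) - f x (u x) (v x))
      \<le> k x * (norm (U n (P.cell_index n x) - u x) + norm (V n (P.cell_index n x) - v x))"
      using f_lipschitz[OF x'] by auto
    have "(\<lambda>n. k x * (norm (U n (P.cell_index n x) - u x) + norm (V n (P.cell_index n x) - v x)))
        \<longlonglongrightarrow> k x * (norm (u x - u x) + norm (v x - v x))"
      by (intro tendsto_intros lim)
    then show "(\<lambda>n. k x * (norm (U n (P.cell_index n x) - u x) + norm (V n (P.cell_index n x) - v x))) \<longlonglongrightarrow> 0"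
      by simp
  qed
  then have "(\<lambda>n. f x (U n (P.cell_index n x)) (V n (P.cell_index n x))) \<longlonglongrightarrow> f x (u x) (v x)"
    by (rule LIM_zero_cancel)
  then show ?thesis unfolding forcing_n_def forcing_def using x by (auto intro!: tendsto_intros)
qed

lemma forcing_measurable [measurable]: "forcing \<in> borel_measurable \<nu>"
proof (rule borel_measurable_LIMSEQ_metric)
  have [measurable]: "{0<..T} \<in> sets \<nu>" using T_pos by auto
  show "(\<lambda>x. indicator {0<..T} x *\<^sub>R forcing_n n x) \<in> borel_measurable \<nu>" for n by measurable
  show "(\<lambda>n. indicator {0<..T} x *\<^sub>R forcing_n n x) \<longlonglongrightarrow> forcing x" for x
    using forcing_lim[of x] by (cases "x \<in> {0<..T}") (auto simp: forcing_def)
qed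

lemma forcing_le: "norm (forcing x) \<le> m * M"
proof (cases "x \<in> {0<..T}")
  case True
  then have x: "x \<in> {0..T}" by auto
  show ?thesis using True norm_\<theta>_f_le[OF x, of "u x" "v x"] mult_left_mono[OF uv_le[OF x] m_nonneg]
    by (simp add: forcing_def)
next
  case False
  then show ?thesis using m_nonneg M_ge by (simp add: forcing_def)
qed

lemma forcing_integrable: "integrable \<nu> forcing"
  by (rule integrable_bounded[OF forcing_measurable forcing_le])

text \<open>
    Adding back the primitive of the perturbation leaves the motion that is driven by \<open>A\<close> alone: its
    discrete increments are \<open>- \<delta> w\<close> with \<open>w\<close> in the operator.
\<close>
definition unforced :: "real \<Rightarrow> 'a" where "unforced t = v t + (LINT x:{0<..t}|\<nu>. forcing x)"

definition unforced_n :: "nat \<Rightarrow> real \<Rightarrow> 'a" where "unforced_n n t = V_at n t + (LINT x:{0<..t}|\<nu>. forcing_n n x)"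

lemma unforced_n_lim:
  assumes t: "t \<in> {0..T}"
  shows "(\<lambda>n. unforced_n n t) \<longlonglongrightarrow> unforced t"
  unfolding unforced_n_def unforced_def
proof (rule tendsto_add)
  show "(\<lambda>n. V_at n t) \<longlonglongrightarrow> v t" unfolding V_at_def by (rule V_lim[OF t])
  show "(\<lambda>n. LINT x:{0<..t}|\<nu>. forcing_n n x) \<longlonglongrightarrow> (LINT x:{0<..t}|\<nu>. forcing x)"
  proof (rule tendsto_set_integral_Ioc[OF forcing_n_measurable forcing_measurable _ forcing_n_le])
    show "AE x in \<nu>. (\<lambda>n. forcing_n n x) \<longlonglongrightarrow> forcing x"
      using AE_nu_pos by eventually_elim (rule forcing_lim)
  qed (use t in auto)
qed

lemma unforced_lip:
  assumes "0 \<le> s" "s \<le> t" "t \<le> T"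
  shows "norm (unforced t - unforced s) \<le> (C + m * M) * (\<sigma> t - \<sigma> s)"
proof -
  have "unforced t - unforced s = (v t - v s) + (LINT x:{s<..t}|\<nu>. forcing x)"
    using set_integral_Ioc_split[OF forcing_integrable, of 0 s t] assms by (simp add: unforced_def)
  also have "norm \<dots> \<le> C * (\<sigma> t - \<sigma> s) + m * M * (\<sigma> t - \<sigma> s)"
    using assms by (intro norm_triangle_le add_mono v_lip norm_set_integral_Ioc_le[OF forcing_integrable])
      (auto intro!: AE_I2 forcing_le)
  finally show ?thesis by (simp add: algebra_simps)
qed

lemma unforced_n_step:
  assumes i: "i < N n"
  shows "unforced_n n (\<tau> n (Suc i)) - unforced_n n (\<tau> n i) = - ((\<sigma> (\<tau> n (Suc i)) - \<sigma> (\<tau> n i)) *\<^sub>R W n (Suc i))"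
proof -
  have st: "0 \<le> \<tau> n i" "\<tau> n i \<le> \<tau> n (Suc i)" "\<tau> n (Suc i) \<le> T" using step_points[OF i] by auto
  have "(LINT x:{\<tau> n i<..\<tau> n (Suc i)}|\<nu>. forcing_n n x) = force (\<tau> n i) (\<tau> n (Suc i)) (U n i) (V n i)"
    unfolding force_def forcing_n_def
    by (rule P.set_integral_cell_cong) (simp add: P.cell_index_in_cell[OF i])
  then show ?thesis
    using step[OF i] set_integral_Ioc_split[OF forcing_n_integrable, of 0 "\<tau> n i" "\<tau> n (Suc i)" n] st i
    by (simp add: unforced_n_def V_at_def P.floor_index_\<tau> is_step_def)
qed

text \<open>
    At each node \<open>j\<close> of a finer partition inside the cell, the pseudo-distance between the operator at the
    node and the one at \<open>t\<close>, together with the distance from the discrete velocity to \<open>v t\<close>, is controlled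
    by \<open>|\<sigma> (\<tau> j) - \<sigma> t|\<close> up to an error \<open>\<epsilon>\<close> that vanishes under refinement. Summation with the weights
    \<open>\<delta>\<close> of the fine cells leaves \<open>\<Sum> \<delta> |\<sigma> (\<tau> j) - \<sigma> t|\<close>. The nodes after \<open>t\<close> contribute at most
    \<open>\<nu> {r<..r'} \<nu> {t<..r'}\<close>. The nodes before \<open>t\<close> may be at a distance of the size of the atom at \<open>t\<close>, but
    their total weight is at most \<open>\<nu> {r<..<t}\<close>.
\<close>
lemma cell_inequality:
  fixes l :: nat
  assumes t: "t \<in> {0<..T}" and y: "y \<in> A t (u t) x"
  defines "r \<equiv> P.left_end l t" and "r' \<equiv> P.right_end l t"
    and "K \<equiv> (1 + 4 * (L * M) + norm y) * (1 + \<gamma> * M + C)"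
  shows "(unforced r' - unforced r + (\<sigma> r' - \<sigma> r) *\<^sub>R y) \<bullet> (v t - x)
    \<le> K * ((\<sigma> r' - \<sigma> r) * ((\<sigma> t - measure \<nu> {t} - \<sigma> r) + (\<sigma> r' - \<sigma> t)))"
proof -
  have t': "t \<in> {0..T}" using t by auto
  have r: "0 \<le> r" "r < t" "t \<le> r'" "r' \<le> T" using left_end[OF t] right_end[OF t] by (auto simp: r_def r'_def)
  have \<sigma>r: "\<sigma> r \<le> \<sigma> t" "\<sigma> t \<le> \<sigma> r'" using r by (auto intro: \<sigma>_mono)
  have atom: "measure \<nu> {t} \<le> \<sigma> t - \<sigma> r" using atom_le_increment[of r t] r by simp
  define B where "B = 1 + 4 * (L * M) + norm y"
  define G where "G = 1 + \<gamma> * M + C"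
  have B: "B \<ge> 0" using L_ge M_ge by (simp add: B_def)
  have G: "G \<ge> 1" using \<gamma>_nonneg M_ge C_nonneg by (simp add: G_def)
  define \<epsilon> where "\<epsilon> n = \<gamma> * norm (U_at n t - u t) + norm (V_at n t - v t)
      + (\<gamma> * M + C) * (\<sigma> t - \<sigma> (P.node_below n t))" for n
  have \<epsilon>: "\<epsilon> \<longlonglongrightarrow> 0"
  proof -
    have "\<epsilon> \<longlonglongrightarrow> \<gamma> * norm (u t - u t) + norm (v t - v t) + (\<gamma> * M + C) * (\<sigma> t - \<sigma> t)"
      unfolding \<epsilon>_def V_at_def by (intro tendsto_intros node_below_lim U_at_lim V_lim t')
    then show ?thesis by simp
  qed
  have pointwise: "(W n j - y) \<bullet> (x - v t) \<le> B * (G * \<bar>\<sigma> (\<tau> n j) - \<sigma> t\<bar> + \<epsilon> n)" if j: "j \<le> N n" for n j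
  proof -
    define b where "b = \<sigma> (P.node_below n t)"
    have b: "b \<le> \<sigma> t" unfolding b_def using node_below[OF t', of n] t' by (intro \<sigma>_mono) auto
    have dist_b: "\<bar>\<sigma> (\<tau> n j) - b\<bar> \<le> \<bar>\<sigma> (\<tau> n j) - \<sigma> t\<bar> + (\<sigma> t - b)" using b by linarith
    have near: "norm (X j - X (P.floor_index n t)) \<le> B' * (\<bar>\<sigma> (\<tau> n j) - \<sigma> t\<bar> + (\<sigma> t - b))"
      if X: "\<And>i j. i \<le> j \<Longrightarrow> j \<le> N n \<Longrightarrow> norm (X j - X i) \<le> B' * (\<sigma> (\<tau> n j) - \<sigma> (\<tau> n i))" and "B' \<ge> 0"
      for X :: "nat \<Rightarrow> 'a" and B'
    proof -
      have "norm (X j - X (P.floor_index n t)) \<le> B' * \<bar>\<sigma> (\<tau> n j) - b\<bar>"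
      proof (cases "P.floor_index n t \<le> j")
        case True
        have "B' * (\<sigma> (\<tau> n j) - b) \<le> B' * \<bar>\<sigma> (\<tau> n j) - b\<bar>" using \<open>B' \<ge> 0\<close> by (intro mult_left_mono) auto
        then show ?thesis using X[OF True j] unfolding b_def P.node_below_def by linarith
      next
        case False
        then have "norm (X (P.floor_index n t) - X j) \<le> B' * (b - \<sigma> (\<tau> n j))"
          using X[of j "P.floor_index n t"] floor_le[OF t', of n] by (simp add: b_def P.node_below_def)
        also have "\<dots> \<le> B' * \<bar>\<sigma> (\<tau> n j) - b\<bar>" using \<open>B' \<ge> 0\<close> by (intro mult_left_mono) auto
        finally show ?thesis by (simp add: norm_minus_commute)
      qed
      also have "\<dots> \<le> B' * (\<bar>\<sigma> (\<tau> n j) - \<sigma> t\<bar> + (\<sigma> t - b))" using dist_b \<open>B' \<ge> 0\<close> by (intro mult_left_mono)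
      finally show ?thesis .
    qed
    have nU: "norm (U n j - U_at n t) \<le> M * (\<bar>\<sigma> (\<tau> n j) - \<sigma> t\<bar> + (\<sigma> t - b))"
      unfolding U_at_def by (rule near[OF U_lip]) (use M_ge in auto)
    have nV: "norm (V n j - V_at n t) \<le> C * (\<bar>\<sigma> (\<tau> n j) - \<sigma> t\<bar> + (\<sigma> t - b))"
      unfolding V_at_def by (rule near[OF V_lip C_nonneg])
    have dU: "norm (U n j - u t) \<le> M * (\<bar>\<sigma> (\<tau> n j) - \<sigma> t\<bar> + (\<sigma> t - b)) + norm (U_at n t - u t)"
      using norm_triangle_ineq[of "U n j - U_at n t" "U_at n t - u t"] nU by simp
    have dV: "norm (V n j - v t) \<le> C * (\<bar>\<sigma> (\<tau> n j) - \<sigma> t\<bar> + (\<sigma> t - b)) + norm (V_at n t - v t)"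
      using norm_triangle_ineq[of "V n j - V_at n t" "V_at n t - v t"] nV by simp
    have "(W n j - y) \<bullet> (x - V n j)
        \<le> (\<bar>\<sigma> (\<tau> n j) - \<sigma> t\<bar> + \<gamma> * norm (U n j - u t)) * (1 + norm (W n j) + norm y)"
      by (rule dis_le[OF t' P.\<tau>_mem[OF j] W_mem[OF j] y])
    also have "\<dots> \<le> (\<bar>\<sigma> (\<tau> n j) - \<sigma> t\<bar> + \<gamma> * norm (U n j - u t)) * B"
      unfolding B_def using W_le[OF j] \<gamma>_nonneg by (intro mult_left_mono) auto
    finally have 1: "(W n j - y) \<bullet> (x - V n j) \<le> (\<bar>\<sigma> (\<tau> n j) - \<sigma> t\<bar> + \<gamma> * norm (U n j - u t)) * B" .
    have "(W n j - y) \<bullet> (V n j - v t) \<le> norm (W n j - y) * norm (V n j - v t)" by (rule norm_cauchy_schwarz)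
    also have "\<dots> \<le> B * norm (V n j - v t)"
      using W_le[OF j] norm_triangle_ineq4[of "W n j" y] by (intro mult_right_mono) (auto simp: B_def)
    finally have 2: "(W n j - y) \<bullet> (V n j - v t) \<le> B * norm (V n j - v t)" .
    have "(W n j - y) \<bullet> (x - v t) = (W n j - y) \<bullet> (x - V n j) + (W n j - y) \<bullet> (V n j - v t)"
      by (simp flip: inner_add_right)
    also have "\<dots> \<le> B * (\<bar>\<sigma> (\<tau> n j) - \<sigma> t\<bar> + \<gamma> * norm (U n j - u t) + norm (V n j - v t))"
      using 1 2 by (simp add: algebra_simps)
    also have "\<dots> \<le> B * (G * \<bar>\<sigma> (\<tau> n j) - \<sigma> t\<bar> + \<epsilon> n)"
    proof (intro mult_left_mono[OF _ B])
      have "\<gamma> * norm (U n j - u t) \<le> \<gamma> * (M * (\<bar>\<sigma> (\<tau> n j) - \<sigma> t\<bar> + (\<sigma> t - b)) + norm (U_at n t - u t))"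
        using dU \<gamma>_nonneg by (intro mult_left_mono)
      then show "\<bar>\<sigma> (\<tau> n j) - \<sigma> t\<bar> + \<gamma> * norm (U n j - u t) + norm (V n j - v t)
          \<le> G * \<bar>\<sigma> (\<tau> n j) - \<sigma> t\<bar> + \<epsilon> n"
        using dV unfolding G_def \<epsilon>_def b_def[symmetric] by (simp add: algebra_simps)
    qed
    finally show ?thesis .
  qed
  define E where "E = (\<sigma> r' - \<sigma> r) * ((\<sigma> t - measure \<nu> {t} - \<sigma> r) + (\<sigma> r' - \<sigma> t))"
  have bound: "(unforced_n n r' - unforced_n n r + (\<sigma> r' - \<sigma> r) *\<^sub>R y) \<bullet> (v t - x) \<le> B * (G * E + (\<sigma> r' - \<sigma> r) * \<epsilon> n)"
    if "l \<le> n" for n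
  proof -
    obtain i where i: "P.cell_index l t = i" "i < N l" using P.cell_index_ex[OF t] by metis
    obtain a where a: "a \<le> N n" "\<tau> n a = r"
      using nested[OF \<open>l \<le> n\<close>, of i] i by (auto simp: r_def P.left_end_def)
    obtain b where b: "b \<le> N n" "\<tau> n b = r'"
      using nested[OF \<open>l \<le> n\<close>, of "Suc i"] i by (auto simp: r'_def P.right_end_def)
    have ab: "a \<le> b" using P.\<tau>_le_iff[OF a(1) b(1)] a b r by simp
    define d where "d j = \<sigma> (\<tau> n (Suc j)) - \<sigma> (\<tau> n j)" for j
    have d: "d j \<ge> 0" if "j < N n" for j using P.\<sigma>_cell_pos[OF that] by (simp add: d_def)
    have sum_d: "(\<Sum>j = a..<b. d j) = \<sigma> r' - \<sigma> r"
      using sum_Suc_diff'[OF ab, of "\<lambda>j. \<sigma> (\<tau> n j)"] a b by (simp add: d_def)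
    \<comment> \<open>On fine cells that end before \<open>t\<close> the increment of \<open>h\<close> is the weight of the cell. All increments are nonnegative and add up to \<open>\<nu> {r<..<t}\<close>.\<close>
    define h where "h s = min (\<sigma> s) (\<sigma> t - measure \<nu> {t})" for s
    have cell: "d j * \<bar>\<sigma> (\<tau> n (Suc j)) - \<sigma> t\<bar>
        \<le> (h (\<tau> n (Suc j)) - h (\<tau> n j)) * (\<sigma> t - \<sigma> r) + d j * (\<sigma> r' - \<sigma> t)" if j: "a \<le> j" "j < b" for j
    proof -
      have jN: "j < N n" using j b by simp
      have pts: "r \<le> \<tau> n j" "\<tau> n j < \<tau> n (Suc j)" "\<tau> n (Suc j) \<le> r'"
        using P.\<tau>_le[of a j n] P.\<tau>_le[of "Suc j" b n] P.\<tau>_less[of j "Suc j" n] a b j by auto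
      have \<sigma>_pts: "\<sigma> r \<le> \<sigma> (\<tau> n j)" "\<sigma> (\<tau> n j) \<le> \<sigma> (\<tau> n (Suc j))" "\<sigma> (\<tau> n (Suc j)) \<le> \<sigma> r'"
        using pts r by (auto intro!: \<sigma>_mono)
      show ?thesis
      proof (cases "\<tau> n (Suc j) < t")
        case True
        have "\<sigma> (\<tau> n (Suc j)) \<le> \<sigma> t - measure \<nu> {t}"
          using atom_le_increment[of "\<tau> n (Suc j)" t] True pts r by simp
        then have hd: "h (\<tau> n (Suc j)) - h (\<tau> n j) = d j" using \<sigma>_pts by (simp add: h_def d_def)
        have "\<sigma> (\<tau> n (Suc j)) \<le> \<sigma> t" using True pts r by (intro \<sigma>_mono) auto
        then have "d j * \<bar>\<sigma> (\<tau> n (Suc j)) - \<sigma> t\<bar> \<le> d j * (\<sigma> t - \<sigma> r)"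
          using \<sigma>_pts d[OF jN] by (intro mult_left_mono) auto
        moreover have "0 \<le> d j * (\<sigma> r' - \<sigma> t)" using d[OF jN] \<sigma>r by simp
        ultimately show ?thesis using hd by simp
      next
        case False
        then have "\<sigma> t \<le> \<sigma> (\<tau> n (Suc j))" using pts r t' by (intro \<sigma>_mono) auto
        then have "d j * \<bar>\<sigma> (\<tau> n (Suc j)) - \<sigma> t\<bar> \<le> d j * (\<sigma> r' - \<sigma> t)"
          using \<sigma>_pts d[OF jN] by (intro mult_left_mono) auto
        moreover have "0 \<le> (h (\<tau> n (Suc j)) - h (\<tau> n j)) * (\<sigma> t - \<sigma> r)"
          using \<sigma>_pts \<sigma>r by (intro mult_nonneg_nonneg) (auto simp: h_def)
        ultimately show ?thesis by simp
      qed
    qed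
    have "(\<Sum>j = a..<b. d j * \<bar>\<sigma> (\<tau> n (Suc j)) - \<sigma> t\<bar>)
        \<le> (\<Sum>j = a..<b. (h (\<tau> n (Suc j)) - h (\<tau> n j)) * (\<sigma> t - \<sigma> r) + d j * (\<sigma> r' - \<sigma> t))"
      by (intro sum_mono cell) auto
    also have "\<dots> = (h r' - h r) * (\<sigma> t - \<sigma> r) + (\<sigma> r' - \<sigma> r) * (\<sigma> r' - \<sigma> t)"
      using sum_Suc_diff'[OF ab, of "\<lambda>j. h (\<tau> n j)"] a b
      by (simp add: sum.distrib sum_d flip: sum_distrib_right)
    also have "\<dots> \<le> E"
    proof -
      have "h r' - h r = \<sigma> t - measure \<nu> {t} - \<sigma> r"
        using atom \<sigma>r measure_nonneg[of \<nu> "{t}"] unfolding h_def by linarith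
      then have "(h r' - h r) * (\<sigma> t - \<sigma> r) \<le> (\<sigma> t - measure \<nu> {t} - \<sigma> r) * (\<sigma> r' - \<sigma> r)"
        using atom \<sigma>r by (simp add: mult_left_mono)
      then show ?thesis unfolding E_def
        by (simp only: distrib_left mult.commute[of "\<sigma> r' - \<sigma> r" "\<sigma> t - measure \<nu> {t} - \<sigma> r"])
    qed
    finally have sum_E: "(\<Sum>j = a..<b. d j * \<bar>\<sigma> (\<tau> n (Suc j)) - \<sigma> t\<bar>) \<le> E" .
    have "unforced_n n r' - unforced_n n r = (\<Sum>j = a..<b. unforced_n n (\<tau> n (Suc j)) - unforced_n n (\<tau> n j))"
      using sum_Suc_diff'[OF ab, of "\<lambda>j. unforced_n n (\<tau> n j)"] a b by simp
    also have "\<dots> = (\<Sum>j = a..<b. - (d j *\<^sub>R W n (Suc j)))"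
      using b unfolding d_def by (intro sum.cong unforced_n_step) auto
    finally have "unforced_n n r' - unforced_n n r + (\<sigma> r' - \<sigma> r) *\<^sub>R y
        = (\<Sum>j = a..<b. - (d j *\<^sub>R W n (Suc j))) + (\<Sum>j = a..<b. d j *\<^sub>R y)"
      unfolding sum_d[symmetric] scaleR_sum_left by simp
    also have "\<dots> = (\<Sum>j = a..<b. - (d j *\<^sub>R W n (Suc j)) + d j *\<^sub>R y)" by (rule sum.distrib[symmetric])
    finally have "(unforced_n n r' - unforced_n n r + (\<sigma> r' - \<sigma> r) *\<^sub>R y) \<bullet> (v t - x)
        = (\<Sum>j = a..<b. (- (d j *\<^sub>R W n (Suc j)) + d j *\<^sub>R y) \<bullet> (v t - x))"
      by (simp only: inner_sum_left)
    also have "\<dots> = (\<Sum>j = a..<b. d j * ((W n (Suc j) - y) \<bullet> (x - v t)))"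
      by (intro sum.cong refl) (simp add: inner_diff_left inner_diff_right inner_add_left algebra_simps)
    also have "\<dots> \<le> (\<Sum>j = a..<b. d j * (B * (G * \<bar>\<sigma> (\<tau> n (Suc j)) - \<sigma> t\<bar> + \<epsilon> n)))"
      using b by (intro sum_mono mult_left_mono pointwise d) auto
    also have "\<dots> = B * (G * (\<Sum>j = a..<b. d j * \<bar>\<sigma> (\<tau> n (Suc j)) - \<sigma> t\<bar>) + (\<Sum>j = a..<b. d j) * \<epsilon> n)"
    proof -
      have "(\<Sum>j = a..<b. d j * (B * (G * \<bar>\<sigma> (\<tau> n (Suc j)) - \<sigma> t\<bar> + \<epsilon> n)))
          = (\<Sum>j = a..<b. (B * G) * (d j * \<bar>\<sigma> (\<tau> n (Suc j)) - \<sigma> t\<bar>) + d j * (B * \<epsilon> n))"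
        by (intro sum.cong refl) (simp only: distrib_left mult_ac)
      also have "\<dots> = (B * G) * (\<Sum>j = a..<b. d j * \<bar>\<sigma> (\<tau> n (Suc j)) - \<sigma> t\<bar>) + (\<Sum>j = a..<b. d j) * (B * \<epsilon> n)"
        by (simp only: sum.distrib sum_distrib_left sum_distrib_right)
      finally show ?thesis by (simp only: distrib_left mult_ac)
    qed
    also have "\<dots> \<le> B * (G * E + (\<sigma> r' - \<sigma> r) * \<epsilon> n)"
      using sum_E B G unfolding sum_d by (intro mult_left_mono add_right_mono) auto
    finally show ?thesis .
  qed
  have "(\<lambda>n. (unforced_n n r' - unforced_n n r + (\<sigma> r' - \<sigma> r) *\<^sub>R y) \<bullet> (v t - x))
      \<longlonglongrightarrow> (unforced r' - unforced r + (\<sigma> r' - \<sigma> r) *\<^sub>R y) \<bullet> (v t - x)"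
    using r by (intro tendsto_intros unforced_n_lim) auto
  moreover have "(\<lambda>n. B * (G * E + (\<sigma> r' - \<sigma> r) * \<epsilon> n)) \<longlonglongrightarrow> B * (G * E + (\<sigma> r' - \<sigma> r) * 0)"
    by (intro tendsto_intros \<epsilon>)
  ultimately have "(unforced r' - unforced r + (\<sigma> r' - \<sigma> r) *\<^sub>R y) \<bullet> (v t - x) \<le> B * (G * E + (\<sigma> r' - \<sigma> r) * 0)"
    by (rule LIMSEQ_le) (intro exI[of _ l] allI impI bound)
  then show ?thesis unfolding K_def B_def[symmetric] G_def[symmetric] E_def[symmetric] by (simp add: mult.assoc)
qed

lemma quotient_inequality:
  assumes t: "t \<in> {0<..T}" and y: "y \<in> A t (u t) x"
  shows "(P.quotient l unforced t + y) \<bullet> (v t - x) \<le> (1 + 4 * (L * M) + norm y) * (1 + \<gamma> * M + C) *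
    ((\<sigma> t - measure \<nu> {t} - \<sigma> (P.left_end l t)) + (\<sigma> (P.right_end l t) - \<sigma> t))"
proof -
  define r r' where "r = P.left_end l t" and "r' = P.right_end l t"
  define d where "d = \<sigma> r' - \<sigma> r"
  obtain i where i: "P.cell_index l t = i" "i < N l" using P.cell_index_ex[OF t] by metis
  have d: "d > 0" using P.\<sigma>_cell_pos[OF i(2)] i by (simp add: d_def r_def r'_def P.left_end_def P.right_end_def)
  have increment: "unforced r' - unforced r = d *\<^sub>R P.quotient l unforced t"
    using d by (simp add: P.quotient_def Let_def d_def r_def r'_def P.left_end_def P.right_end_def)
  have "d * ((P.quotient l unforced t + y) \<bullet> (v t - x)) = (unforced r' - unforced r + (\<sigma> r' - \<sigma> r) *\<^sub>R y) \<bullet> (v t - x)"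
    unfolding increment d_def[symmetric] by (simp only: inner_scaleR_left distrib_left flip: scaleR_add_right)
  also have "\<dots> \<le> (1 + 4 * (L * M) + norm y) * (1 + \<gamma> * M + C) *
      (d * ((\<sigma> t - measure \<nu> {t} - \<sigma> r) + (\<sigma> r' - \<sigma> t)))"
    unfolding d_def r_def r'_def by (rule cell_inequality[OF t y])
  finally have "d * ((P.quotient l unforced t + y) \<bullet> (v t - x)) \<le> d * ((1 + 4 * (L * M) + norm y) * (1 + \<gamma> * M + C) *
      ((\<sigma> t - measure \<nu> {t} - \<sigma> r) + (\<sigma> r' - \<sigma> t)))"
    by (simp only: mult.left_commute)
  then show ?thesis using d unfolding r_def r'_def by (simp only: mult_le_cancel_left_pos)
qed

text \<open>
    The constant in \<open>quotient_inequality\<close> depends on \<open>y\<close>, but the exceptional null set, on which the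
    quotients fail to converge, does not. So the limit inequality holds for the whole graph at once.
\<close>
theorem solution: "BVRC_solution T \<rho> \<theta> A f u\<^sub>0 v\<^sub>0 u v"
proof -
  obtain \<phi> :: "nat \<Rightarrow> nat" and g :: "real \<Rightarrow> 'a" where g: "strict_mono \<phi>" "g \<in> borel_measurable \<nu>"
    "\<forall>t. norm (g t) \<le> C + m * M" "AE t in \<nu>. (\<lambda>k. P.quotient (\<phi> k) unforced t) \<longlonglongrightarrow> g t"
    "\<forall>t\<in>{0..T}. unforced t = unforced 0 + (LINT x:{0<..t}|\<nu>. g x)"
    by (rule quotients_converge[OF unforced_lip], assumption, assumption, assumption, rule that)
  have g_int: "integrable \<nu> g" by (rule integrable_bounded[OF g(2) g(3)[rule_format]])
  define v' where "v' t = g t - forcing t" for t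
  have v'_int: "integrable \<nu> v'" unfolding v'_def[abs_def] using g_int forcing_integrable by simp
  have v_integral: "v t = v 0 + (LINT x:{0<..t}|\<nu>. v' x)" if t: "0 \<le> t" "t \<le> T" for t
  proof -
    have "(LINT x:{0<..t}|\<nu>. v' x) = (LINT x:{0<..t}|\<nu>. g x) - (LINT x:{0<..t}|\<nu>. forcing x)"
      unfolding v'_def
      by (rule set_integral_diff(2)[OF set_integrable_Ioc[OF g_int order_refl t(2)]
            set_integrable_Ioc[OF forcing_integrable order_refl t(2)]])
    moreover have "v t = unforced t - (LINT x:{0<..t}|\<nu>. forcing x)" unfolding unforced_def by (rule add_diff_cancel_right'[symmetric])
    moreover have "unforced 0 = v 0" by (simp add: unforced_def set_lebesgue_integral_def)
    then have "unforced t = v 0 + (LINT x:{0<..t}|\<nu>. g x)" using g(5) t by (metis atLeastAtMost_iff)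
    ultimately show ?thesis by (metis add_diff_eq)
  qed
  have inclusion: "AE t in \<nu>. - g t \<in> A t (u t) (v t)"
    using g(4) AE_nu_pos
  proof eventually_elim
    case (elim t)
    then have t: "t \<in> {0<..T}" and t': "t \<in> {0..T}" by auto
    show "- g t \<in> A t (u t) (v t)"
    proof (rule maximal_monotone_mem[OF A_maxmon[OF t']])
      fix x y assume y: "y \<in> A t (u t) x"
      define K where "K = (1 + 4 * (L * M) + norm y) * (1 + \<gamma> * M + C)"
      let ?err = "\<lambda>l. (\<sigma> t - measure \<nu> {t} - \<sigma> (P.left_end l t)) + (\<sigma> (P.right_end l t) - \<sigma> t)"
      have err: "(\<lambda>k. K * ?err k)
          \<longlonglongrightarrow> K * ((\<sigma> t - measure \<nu> {t} - (\<sigma> t - measure \<nu> {t})) + (\<sigma> t - \<sigma> t))"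
        by (intro tendsto_intros left_end_lim right_end_lim t)
      have err_0: "(\<lambda>k. K * ?err (\<phi> k)) \<longlonglongrightarrow> 0"
        using LIMSEQ_subseq_LIMSEQ[OF err g(1)] unfolding o_def by simp
      have quot: "(\<lambda>k. (P.quotient (\<phi> k) unforced t + y) \<bullet> (v t - x)) \<longlonglongrightarrow> (g t + y) \<bullet> (v t - x)"
        by (intro tendsto_inner tendsto_add tendsto_const elim(1))
      have "(g t + y) \<bullet> (v t - x) \<le> 0"
        by (rule LIMSEQ_le[OF quot err_0]) (intro exI allI impI, unfold K_def, rule quotient_inequality[OF t y])
      then show "0 \<le> (y - - g t) \<bullet> (x - v t)" by (simp add: inner_diff_left inner_diff_right inner_add_left)
    qed
  qed
  have BV: "BVRC T u" "BVRC T v"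
    by (rule BVRC_of_increments[OF u_lip], assumption+) (rule BVRC_of_increments[OF v_lip])
  have du: "differential_measure T u (\<lambda>B. LINT x:B|\<nu>. v x)" "vector_density \<nu> (\<lambda>B. LINT x:B|\<nu>. v x) v"
    by (rule differential_measure_of_density[OF v_integrable u_integral])+
  have dv: "differential_measure T v (\<lambda>B. LINT x:B|\<nu>. v' x)" "vector_density \<nu> (\<lambda>B. LINT x:B|\<nu>. v' x) v'"
    by (rule differential_measure_of_density[OF v'_int v_integral], assumption+)+
  have u_0: "u 0 = u\<^sub>0" by (simp add: u_def set_lebesgue_integral_def)
  have v\<^sub>0: "v\<^sub>0 \<in> op_dom (A 0 u\<^sub>0)" using v_in_domain[of 0] T_pos v_0 u_0 by simp
  have inclusion': "AE t in \<nu>. - v' t \<in> {a + \<theta> t *\<^sub>R f t (u t) (v t) | a. a \<in> A t (u t) (v t)}"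
    using inclusion AE_nu_pos
  proof eventually_elim
    case (elim t)
    then have "- v' t = - g t + \<theta> t *\<^sub>R f t (u t) (v t)" by (simp add: v'_def forcing_def)
    then show ?case using elim(1) by (intro CollectI exI[of _ "- g t"] conjI)
  qed
  show ?thesis
    unfolding BVRC_solution_def
    by (rule conjI[OF BV(1)], rule conjI[OF BV(2)], rule exI, rule exI, rule exI, rule exI,
        rule conjI[OF du(1)], rule conjI[OF du(2)], rule conjI[OF dv(1)], rule conjI[OF dv(2)],
        rule conjI[OF u_0], rule conjI[OF v_0], rule conjI[OF v\<^sub>0], intro conjI ballI v_in_domain inclusion' AE_I2 refl)
qed

end


section \<open>Existence\<close>
theorem (in evolution_problem) solution_exists:
  assumes v\<^sub>0: "v\<^sub>0 \<in> op_dom (A 0 u\<^sub>0)"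
  shows "\<exists>u v. BVRC_solution T \<rho> \<theta> A f u\<^sub>0 v\<^sub>0 u v"
proof -
  obtain N \<tau> where ref: "refining T \<rho> N \<tau>" using refining_exists by blast
  interpret R: refining T \<rho> N \<tau> by (rule ref)
  define M where "M = (1 + norm u\<^sub>0 + norm v\<^sub>0) * exp (growth_rate * (\<sigma> T - \<sigma> 0))"
  define good where "good n U V W \<longleftrightarrow> U 0 = u\<^sub>0 \<and> V 0 = v\<^sub>0 \<and>
    (\<forall>i\<le>N n. W i \<in> A (\<tau> n i) (U i) (V i) \<and> norm (W i) \<le> 4 * (L * M) \<and> 1 + norm (U i) + norm (V i) \<le> M) \<and>
    (\<forall>i<N n. is_step (\<tau> n i) (\<tau> n (Suc i)) (U i) (V i) (U (Suc i)) (V (Suc i)) (W (Suc i)))" for n U V W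
  have "\<exists>U V W. good n U V W" for n
  proof (rule discrete_trajectory[OF R.part[of n] v\<^sub>0, folded M_def])
    fix U V W
    assume "U 0 = u\<^sub>0" "V 0 = v\<^sub>0" "\<And>i. i \<le> N n \<Longrightarrow> W i \<in> A (\<tau> n i) (U i) (V i)"
      "\<And>i. i \<le> N n \<Longrightarrow> norm (W i) \<le> 4 * (L * M)"
      "\<And>i. i \<le> N n \<Longrightarrow> 1 + norm (U i) + norm (V i) \<le> M"
      "\<And>i. i < N n \<Longrightarrow> is_step (\<tau> n i) (\<tau> n (Suc i)) (U i) (V i) (U (Suc i)) (V (Suc i)) (W (Suc i))"
    then have "good n U V W" by (simp add: good_def)
    then show ?thesis by (intro exI)
  qed
  then obtain U V W where good: "\<And>n. good n (U n) (V n) (W n)" by metis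
  have discr: "discretization T \<rho> \<gamma> c m \<theta> k A f N \<tau> U V W u\<^sub>0 v\<^sub>0 M"
    by unfold_locales (use good in \<open>simp_all add: good_def\<close>)
  interpret D: discretization T \<rho> \<gamma> c m \<theta> k A f N \<tau> U V W u\<^sub>0 v\<^sub>0 M by (rule discr)
  obtain \<phi> :: "nat \<Rightarrow> nat" and v where \<phi>: "strict_mono \<phi>"
    and lim: "\<forall>t\<in>{0..T}. (\<lambda>n. D.V_at (\<phi> n) t) \<longlonglongrightarrow> v t"
    by (rule D.convergent_subsequence) (rule that)
  interpret R': refining T \<rho> "\<lambda>n. N (\<phi> n)" "\<lambda>n. \<tau> (\<phi> n)" by (rule R.subsequence[OF \<phi>])
  interpret D': approximation T \<rho> \<gamma> c m \<theta> k A f "\<lambda>n. N (\<phi> n)" "\<lambda>n. \<tau> (\<phi> n)"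
    "\<lambda>n. U (\<phi> n)" "\<lambda>n. V (\<phi> n)" "\<lambda>n. W (\<phi> n)" u\<^sub>0 v\<^sub>0 M v
    by unfold_locales (use good lim in \<open>simp_all add: good_def D.V_at_def\<close>)
  show ?thesis using D'.solution by blast
qed

theorem theorem3p1:
  fixes T \<gamma> c m :: real
    and \<rho> \<theta> k :: "real \<Rightarrow> real"
    and A :: "real \<Rightarrow> 'a::{real_inner,banach,second_countable_topology} \<Rightarrow> 'a \<Rightarrow> 'a set"
    and f :: "real \<Rightarrow> 'a \<Rightarrow> 'a \<Rightarrow> 'a"
    and u\<^sub>0 v\<^sub>0 :: 'a
  assumes T_pos: "T > 0"
    and A_maxmon: "\<And>t x. t \<in> {0..T} \<Longrightarrow> maximal_monotone (A t x)"
    and \<rho>_nonneg: "\<And>t. t \<in> {0..T} \<Longrightarrow> \<rho> t \<ge> 0"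
    and \<rho>_right_cont: "\<And>t. t \<in> {0..<T} \<Longrightarrow> continuous (at_right t) \<rho>"
    and \<rho>_mono: "mono_on {0..T} \<rho>"
    and \<rho>_0: "\<rho> 0 = 0"
    and \<theta>_density: "lebesgue_density T \<rho> \<theta>"
    and \<gamma>_nonneg: "\<gamma> \<ge> 0"
    and A_dis: "\<And>s t x y. 0 \<le> s \<Longrightarrow> s \<le> t \<Longrightarrow> t \<le> T \<Longrightarrow>
      vladimirov_dis (A t x) (A s y)
        \<le> ereal (measure (stieltjes_I T \<rho>) {s<..t} + \<gamma> * norm (x - y) * \<theta> s)"
    and c_nonneg: "c \<ge> 0"
    and A_growth: "\<And>t x y. t \<in> {0..T} \<Longrightarrow> y \<in> op_dom (A t x) \<Longrightarrow>
      norm (min_section (A t x) y) \<le> c * (1 + norm x + norm y)"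
    and A_compact: "\<And>E. bounded E \<Longrightarrow>
      relatively_ball_compact (\<Union>(t, x)\<in>{0..T} \<times> E. op_dom (A t x))"
    and f_measurable: "\<And>x y. (\<lambda>t. f t x y) \<in> borel_measurable (restrict_space borel {0..T})"
    and k_nonneg: "\<And>t. t \<in> {0..T} \<Longrightarrow> k t \<ge> 0"
    and k_integrable: "integrable (lebesgue_on {0..T}) k"
    and f_lipschitz: "\<And>t x y x' y'. t \<in> {0..T} \<Longrightarrow>
      norm (f t x y - f t x' y') \<le> k t * (norm (x - x') + norm (y - y'))"
    and m_nonneg: "m \<ge> 0"
    and f_growth: "\<And>t x y. t \<in> {0..T} \<Longrightarrow> norm (f t x y) \<le> m * (1 + norm x + norm y)"
    and v\<^sub>0_dom: "v\<^sub>0 \<in> op_dom (A 0 u\<^sub>0)"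
  shows "\<exists>u v. BVRC_solution T \<rho> \<theta> A f u\<^sub>0 v\<^sub>0 u v"
proof -
  interpret evolution_problem T \<rho> \<gamma> c m \<theta> k A f
    by unfold_locales (fact assms)+
  show ?thesis by (rule solution_exists[OF v\<^sub>0_dom])
qed

end
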